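(* Let $X=\mathrm{Spec}(\mathbb{C}[S])$ be an affine toric variety, let $H=\{\nu_1,\dots,\nu_r\}\subset\overset{\circ}{\sigma}\cap N$ be a finite set of monomial divisorial valuations, and let $P(\underline t)=P_{X,H}(\underline t)$ be the Poincaré series of the multi-index filtration on $\mathcal{O}_{X,o}$ defined by $H$. Let $\underline t^{\underline\nu}$ be the function on $\mathbb{P}\mathcal{O}_{X,o}$ with values in the additive group $\mathbb{Z}[[t_1,\dots,t_r]]$ sending the class of $g$ to $\underline t^{\underline\nu(g)}$, where $\underline\nu(g)=(\nu_1(g),\dots,\nu_r(g))$. Then $$P(\underline t)=\int_{\mathbb{P}\mathcal{O}_{X,o}}\underline t^{\underline\nu}\,d\chi .$$
   Context: Setting: $N=\mathbb{Z}^d$, $M$ is the dual lattice with pairing $\langle m,n\rangle$. $\sigma\subset N\otimes_{\mathbb Z}\mathbb{R}$ is a rational polyhedral strongly convex $d$-dimensional cone with interior $\overset{\circ}{\sigma}$, and $\check\sigma$ is its dual cone. $S\subset\check\sigma\cap M$ is a finitely generated semigroup (containing $0$) which generates $\check\sigma$ as a cone and $M$ as a group. $\mathbb{C}[S]=\bigoplus_{s\in S}\mathbb{C}\chi^s$, $X=\mathrm{Spec}(\mathbb{C}[S])$, $o\in X$ is the unique $0$-dimensional torus orbit, and $\mathcal{O}_{X,o}$ is the ring of germs at $o$ with maximal ideal $\mathsf m$. Monomial valuations: a lattice point $\nu\in\overset{\circ}{\sigma}\cap N$ defines the valuation $\nu\big(\sum_{m\in F}a_m\chi^m\big)=\min\{\langle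 m,\nu\rangle\mid m\in F,\ a_m\neq 0\}$, centred at $\mathsf m$ (primitive lattice points give the normalized valuations). Poincaré series: for $\underline v\in\mathbb{Z}^r$ put $I(\underline v)=\{g\in\mathcal{O}_{X,o}\mid \nu_i(g)\ge v_i,\ 1\le i\le r\}$, $\underline 1=(1,\dots,1)$, $d(\underline v)=\dim_{\mathbb C} I(\underline v)/I(\underline v+\underline 1)$ (finite), $L=\sum_{\underline v\in\mathbb{Z}^r}d(\underline v)\,\underline t^{\underline v}$. Then $\prod_{i=1}^r(t_i-1)L\in\mathbb{Z}[[t_1,\dots,t_r]]$ and $P_{X,H}(\underline t)=\prod_{i=1}^r(t_i-1)L/(t_1\cdots t_r-1)\in\mathbb{Z}[[t_1,\dots,t_r]]$. Integration with respect to the Euler characteristic: for $k\ge0$ let $\mathcal{J}^k_{X,o}=\mathcal{O}_{X,o}/\mathsf m^{k+1}$. For a complex vector space $V$ let $\mathbb{P}V=(V\setminus\{0\})/\mathbb{C}^*$ and let $\mathbb{P}^*V$ be the disjoint union of $\mathbb{P}V$ with a point; there is a natural map $\pi_k:\mathbb{P}\mathcal{O}_{X,o}\to\mathbb{P}^*\mathcal{J}^k_{X,o}$ (germs with zero $k$-jet are sent to the added point). A subset $A\subset\mathbb{P}\mathcal{O}_{X,o}$ is cylindrical if $A=\pi_k^{-1}(B)$ for some $k$ and some constructible $B\subset\mathbb{P}\mathcal{J}^k_{X,o}\subset\mathbb{P}^*\mathcal{J}^k_{X,o}$; then $\chi(A):=\chi(B)$. A function $\psi:\mathbb{P}\mathcal{O}_{X,o}\to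 G$ with values in an abelian group $G$ is cylindrical if $\psi^{-1}(g)$ is cylindrical for every $g\in G$, $g\ne0$; its integral is $$\int_{\mathbb{P}\mathcal{O}_{X,o}}\psi\,d\chi:=\sum_{g\in G,\ g\neq0}\chi(\psi^{-1}(g))\cdot g$$ if this sum makes sense in $G$ (for $G=\mathbb{Z}[[\underline t]]$ and $\psi=\underline t^{\underline\nu}$, as a formal power series). *)

theory Defs
  imports
    "HOL-Analysis.Analysis"
    "HOL-Homology.Homology"
    "HOL-Library.Poly_Mapping"
    "HOL-Computational_Algebra.Group_Closure"
    "HOL-Algebra.Ideal_Product"
    "HOL-Algebra.QuotRing"
    "HOL-Algebra.Algebraic_Closure_Type"
    "Jordan_Normal_Form.Missing_VectorSpace"
begin

unbundle no fps_syntax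

section \<open>Cones and semigroups\<close>

text \<open>
  Both \<open>N = \<int>\<^sup>d\<close> and its dual lattice \<open>M\<close> are represented by \<^typ>\<open>int ^ 'd\<close>, using dual bases;
  \<open>N \<otimes> \<real>\<close> and \<open>M \<otimes> \<real>\<close> are \<^typ>\<open>real ^ 'd\<close>, where the pairing is the inner product.
\<close>

definition pairing :: "int ^ 'd \<Rightarrow> int ^ 'd \<Rightarrow> int" where
  "pairing m n = (\<Sum>i\<in>UNIV. m $ i * n $ i)"

definition real_vec :: "int ^ 'd \<Rightarrow> real ^ 'd" where
  "real_vec m = (\<chi> i. real_of_int (m $ i))"

definition rational_polyhedral_cone :: "(real ^ 'd) set \<Rightarrow> bool" where
  "rational_polyhedral_cone \<sigma> \<longleftrightarrow>
     (\<exists>A :: (int ^ 'd) set. finite A \<and> \<sigma> = convex_cone hull (real_vec ` A))"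

definition strongly_convex_cone :: "(real ^ 'd) set \<Rightarrow> bool" where
  "strongly_convex_cone \<sigma> \<longleftrightarrow> \<sigma> \<inter> uminus ` \<sigma> = {0}"

definition dual_cone :: "(real ^ 'd) set \<Rightarrow> (real ^ 'd) set" where
  "dual_cone \<sigma> = {m. \<forall>n\<in>\<sigma>. 0 \<le> m \<bullet> n}"

definition add_submonoid :: "'a::comm_monoid_add set \<Rightarrow> bool" where
  "add_submonoid T \<longleftrightarrow> 0 \<in> T \<and> (\<forall>a\<in>T. \<forall>b\<in>T. a + b \<in> T)"

definition finitely_generated_submonoid :: "'a::comm_monoid_add set \<Rightarrow> bool" where
  "finitely_generated_submonoid T \<longleftrightarrow> (\<exists>G. finite G \<and> T = add_submonoid hull G)"

section \<open>The affine toric variety and its torus-fixed point\<close>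

type_synonym 'd laurent = "(int ^ 'd) \<Rightarrow>\<^sub>0 complex"

definition semigroup_algebra :: "(int ^ 'd) set \<Rightarrow> 'd laurent set" where
  "semigroup_algebra S = {f. Poly_Mapping.keys f \<subseteq> S}"

text \<open>
  Closed points of \<open>Spec \<complex>[S]\<close> are the \<open>\<complex>\<close>-algebra homomorphisms \<open>\<complex>[S] \<rightarrow> \<complex>\<close>, i.e. the monoid
  homomorphisms from \<open>S\<close> to \<open>(\<complex>, \<cdot>)\<close>; the torus consists of the homomorphisms \<open>M \<rightarrow> \<complex>\<^sup>*\<close>.
\<close>

definition closed_points :: "(int ^ 'd) set \<Rightarrow> (int ^ 'd \<Rightarrow> complex) set" where
  "closed_points S =
     {x \<in> extensional S. x 0 = 1 \<and> (\<forall>a\<in>S. \<forall>b\<in>S. x (a + b) = x a * x b)}"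

definition torus :: "(int ^ 'd \<Rightarrow> complex) set" where
  "torus = {t. (\<forall>m. t m \<noteq> 0) \<and> (\<forall>a b. t (a + b) = t a * t b)}"

definition torus_orbit ::
  "(int ^ 'd) set \<Rightarrow> (int ^ 'd \<Rightarrow> complex) \<Rightarrow> (int ^ 'd \<Rightarrow> complex) set" where
  "torus_orbit S x = (\<lambda>t. restrict (\<lambda>m. t m * x m) S) ` torus"

text \<open>An orbit of the torus is \<open>0\<close>-dimensional iff it is finite.\<close>

definition origin :: "(int ^ 'd) set \<Rightarrow> (int ^ 'd \<Rightarrow> complex)" where
  "origin S = (THE x. x \<in> closed_points S \<and> finite (torus_orbit S x))"

definition eval_at :: "(int ^ 'd \<Rightarrow> complex) \<Rightarrow> 'd laurent \<Rightarrow> complex" where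
  "eval_at x f = (\<Sum>m\<in>Poly_Mapping.keys f. Poly_Mapping.lookup f m * x m)"

section \<open>The local ring at the fixed point\<close>

text \<open>
  \<open>\<O>\<^sub>X\<^sub>,\<^sub>o\<close> is the localization of \<open>\<complex>[S]\<close> at the maximal ideal of \<open>o\<close>. It is a ring as well as a
  complex vector space, hence a \<^typ>\<open>(complex, 'a) module\<close> record.
\<close>

type_synonym 'd germ = "('d laurent \<times> 'd laurent) set"

definition denominators :: "(int ^ 'd) set \<Rightarrow> 'd laurent set" where
  "denominators S = {g \<in> semigroup_algebra S. eval_at (origin S) g \<noteq> 0}"

definition fraction_rel ::
  "(int ^ 'd) set \<Rightarrow> (('d laurent \<times> 'd laurent) \<times> ('d laurent \<times> 'd laurent)) set" where
  "fraction_rel S =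
     {((a, s), (b, t)). a \<in> semigroup_algebra S \<and> b \<in> semigroup_algebra S \<and>
        s \<in> denominators S \<and> t \<in> denominators S \<and>
        (\<exists>u\<in>denominators S. u * (a * t - b * s) = 0)}"

definition frac :: "(int ^ 'd) set \<Rightarrow> 'd laurent \<Rightarrow> 'd laurent \<Rightarrow> 'd germ" where
  "frac S a s = fraction_rel S `` {(a, s)}"

definition local_ring :: "(int ^ 'd) set \<Rightarrow> (complex, 'd germ) module" where
  "local_ring S =
     \<lparr>carrier = (semigroup_algebra S \<times> denominators S) // fraction_rel S,
      monoid.mult = (\<lambda>x y. \<Union>(a, s)\<in>x. \<Union>(b, t)\<in>y. frac S (a * b) (s * t)),
      one = frac S 1 1,
      ring.zero = frac S 0 1,
      add = (\<lambda>x y. \<Union>(a, s)\<in>x. \<Union>(b, t)\<in>y. frac S (a * t + b * s) (s * t)),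
      smult = (\<lambda>c x. \<Union>(a, s)\<in>x. frac S (Poly_Mapping.single 0 c * a) s)\<rparr>"

definition max_ideal :: "(int ^ 'd) set \<Rightarrow> 'd germ set" where
  "max_ideal S =
     {frac S a s | a s. a \<in> semigroup_algebra S \<and> s \<in> denominators S \<and>
                        eval_at (origin S) a = 0}"

section \<open>Complex vector spaces\<close>

definition quotient_space ::
  "(complex, 'a) module \<Rightarrow> 'a set \<Rightarrow> (complex, 'a set) module" where
  "quotient_space V W =
     \<lparr>carrier = carrier (V Quot W), monoid.mult = monoid.mult (V Quot W), one = one (V Quot W),
      ring.zero = ring.zero (V Quot W), add = add (V Quot W),
      smult = (\<lambda>c A. \<Union>a\<in>A. W +>\<^bsub>V\<^esub> (c \<odot>\<^bsub>V\<^esub> a))\<rparr>"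

definition complex_dim :: "(complex, 'a) module \<Rightarrow> nat" where
  "complex_dim V = vectorspace.dim (ring_of_type_algebra :: complex ring) V"

definition punctured_line :: "(complex, 'a) module \<Rightarrow> 'a \<Rightarrow> 'a set" where
  "punctured_line V x = {c \<odot>\<^bsub>V\<^esub> x | c. c \<noteq> 0}"

text \<open>Points of \<open>\<P>V = (V - {0}) / \<complex>\<^sup>*\<close> are the \<open>\<complex>\<^sup>*\<close>-orbits in \<open>V - {0}\<close>.\<close>

definition proj :: "(complex, 'a) module \<Rightarrow> 'a set set" where
  "proj V = punctured_line V ` (carrier V - {\<zero>\<^bsub>V\<^esub>})"

definition linear_forms :: "(complex, 'a) module \<Rightarrow> ('a \<Rightarrow> complex) set" where
  "linear_forms V =
     {l. (\<forall>x\<in>carrier V. \<forall>y\<in>carrier V. l (x \<oplus>\<^bsub>V\<^esub> y) = l x + l y) \<and>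
         (\<forall>c. \<forall>x\<in>carrier V. l (c \<odot>\<^bsub>V\<^esub> x) = c * l x)}"

text \<open>
  The coarsest topology making all linear forms continuous; on a finite-dimensional space this is
  the Euclidean topology. \<open>\<P>V\<close> carries the quotient topology.
\<close>

definition vector_topology :: "(complex, 'a) module \<Rightarrow> 'a topology" where
  "vector_topology V =
     topology_generated_by {{x \<in> carrier V. l x \<in> U} | l U. l \<in> linear_forms V \<and> open U}"

definition proj_topology :: "(complex, 'a) module \<Rightarrow> 'a set topology" where
  "proj_topology V = topology (\<lambda>U. U \<subseteq> proj V \<and>
     openin (subtopology (vector_topology V) (carrier V - {\<zero>\<^bsub>V\<^esub>}))
       {x \<in> carrier V - {\<zero>\<^bsub>V\<^esub>}. punctured_line V x \<in> U})"

lemma openin_proj_topology: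
  "openin (proj_topology V) U \<longleftrightarrow> U \<subseteq> proj V \<and>
     openin (subtopology (vector_topology V) (carrier V - {\<zero>\<^bsub>V\<^esub>}))
       {x \<in> carrier V - {\<zero>\<^bsub>V\<^esub>}. punctured_line V x \<in> U}"
proof -
  let ?T = "subtopology (vector_topology V) (carrier V - {\<zero>\<^bsub>V\<^esub>})"
  let ?pre = "\<lambda>U. {x \<in> carrier V - {\<zero>\<^bsub>V\<^esub>}. punctured_line V x \<in> U}"
  have int: "openin ?T (?pre (A \<inter> B))" if "openin ?T (?pre A)" "openin ?T (?pre B)" for A B
  proof -
    have "?pre (A \<inter> B) = ?pre A \<inter> ?pre B" by auto
    then show ?thesis using openin_Int[OF that] by simp
  qed
  have un: "openin ?T (?pre (\<Union>\<K>))" if "\<forall>K\<in>\<K>. openin ?T (?pre K)" for \<K>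
  proof -
    have "?pre (\<Union>\<K>) = \<Union>(?pre ` \<K>)" by auto
    then show ?thesis using that openin_Union[of "?pre ` \<K>" ?T] by auto
  qed
  have "istopology (\<lambda>U. U \<subseteq> proj V \<and> openin ?T (?pre U))"
    unfolding istopology_def using int un by blast
  then show ?thesis
    unfolding proj_topology_def by (simp only: topology_inverse')
qed

inductive homogeneous_poly :: "(complex, 'a) module \<Rightarrow> nat \<Rightarrow> ('a \<Rightarrow> complex) \<Rightarrow> bool"
  for V :: "(complex, 'a) module" where
  const: "homogeneous_poly V 0 (\<lambda>_. c)"
| linear: "l \<in> linear_forms V \<Longrightarrow> homogeneous_poly V 1 l"
| plus: "homogeneous_poly V n p \<Longrightarrow> homogeneous_poly V n q \<Longrightarrow> homogeneous_poly V n (\<lambda>x. p x + q x)"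
| times: "homogeneous_poly V n p \<Longrightarrow> homogeneous_poly V m q \<Longrightarrow>
            homogeneous_poly V (n + m) (\<lambda>x. p x * q x)"

definition zero_locus :: "(complex, 'a) module \<Rightarrow> ('a \<Rightarrow> complex) set \<Rightarrow> 'a set set" where
  "zero_locus V F = {L \<in> proj V. \<forall>p\<in>F. \<forall>x\<in>L. p x = 0}"

inductive_set constructible :: "(complex, 'a) module \<Rightarrow> 'a set set set"
  for V :: "(complex, 'a) module" where
  closed: "(\<And>p. p \<in> F \<Longrightarrow> \<exists>n. homogeneous_poly V n p) \<Longrightarrow> zero_locus V F \<in> constructible V"
| compl: "B \<in> constructible V \<Longrightarrow> proj V - B \<in> constructible V"
| union: "B \<in> constructible V \<Longrightarrow> B' \<in> constructible V \<Longrightarrow> B \<union> B' \<in> constructible V"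

section \<open>Euler characteristic\<close>

definition int_independent :: "('a, 'b) monoid_scheme \<Rightarrow> 'a set \<Rightarrow> bool" where
  "int_independent G B \<longleftrightarrow> finite B \<and> B \<subseteq> carrier G \<and>
     (\<forall>n :: 'a \<Rightarrow> int. finprod G (\<lambda>b. b [^]\<^bsub>G\<^esub> n b) B = \<one>\<^bsub>G\<^esub> \<longrightarrow> (\<forall>b\<in>B. n b = 0))"

text \<open>The rank of a (multiplicatively written) abelian group of finite rank.\<close>

definition abelian_rank :: "('a, 'b) monoid_scheme \<Rightarrow> nat" where
  "abelian_rank G = Sup {card B | B. int_independent G B}"

definition betti_number :: "nat \<Rightarrow> 'a topology \<Rightarrow> nat" where
  "betti_number p Y = abelian_rank (homology_group (int p) Y)"

definition euler_char :: "'a topology \<Rightarrow> int" where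
  "euler_char Y = (\<Sum>p | betti_number p Y \<noteq> 0. (-1) ^ p * int (betti_number p Y))"

section \<open>Monomial valuations and the Poincare series\<close>

definition monomial_val :: "int ^ 'd \<Rightarrow> 'd laurent \<Rightarrow> int" where
  "monomial_val n f = Min ((\<lambda>m. pairing m n) ` Poly_Mapping.keys f)"

text \<open>
  The extension to \<open>\<O>\<^sub>X\<^sub>,\<^sub>o\<close> by \<open>\<nu>(a/s) = \<nu>(a) - \<nu>(s)\<close>. It is only meaningful on nonzero germs; the
  convention \<open>\<nu>(0) = \<infinity>\<close> is built into the definition of the filtration.
\<close>

definition germ_val :: "int ^ 'd \<Rightarrow> 'd germ \<Rightarrow> int" where
  "germ_val n x = (THE w. \<exists>(a, s)\<in>x. w = monomial_val n a - monomial_val n s)"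

definition filtration ::
  "(int ^ 'd) set \<Rightarrow> ('r \<Rightarrow> int ^ 'd) \<Rightarrow> int ^ 'r \<Rightarrow> 'd germ set" where
  "filtration S \<nu> v =
     {x \<in> carrier (local_ring S). x = \<zero>\<^bsub>local_ring S\<^esub> \<or> (\<forall>i. v $ i \<le> germ_val (\<nu> i) x)}"

text \<open>
  Two-sided formal series \<open>\<Sum>\<^sub>v F(v) t\<^sup>v\<close>, \<open>v \<in> \<int>\<^sup>r\<close>, are represented by their coefficient functions.
  They form a module over the Laurent polynomials.
\<close>

type_synonym 'r series = "int ^ 'r \<Rightarrow> int"

definition power_series :: "('r::finite) series set" where
  "power_series = {F. \<forall>v. F v \<noteq> 0 \<longrightarrow> (\<forall>i. 0 \<le> v $ i)}"

definition laurent_mult :: "((int ^ 'r) \<Rightarrow>\<^sub>0 int) \<Rightarrow> 'r series \<Rightarrow> 'r series" where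
  "laurent_mult p F = (\<lambda>v. \<Sum>w\<in>Poly_Mapping.keys p. Poly_Mapping.lookup p w * F (v - w))"

definition tvar :: "'r \<Rightarrow> ((int ^ 'r) \<Rightarrow>\<^sub>0 int)" where
  "tvar i = Poly_Mapping.single (axis i 1) 1"

text \<open>In \<open>v + 1\<close> below, \<open>1\<close> is the vector \<open>(1, \<dots>, 1)\<close>.\<close>

definition dim_series :: "(int ^ 'd) set \<Rightarrow> ('r::finite \<Rightarrow> int ^ 'd) \<Rightarrow> 'r series" where
  "dim_series S \<nu> = (\<lambda>v. int (complex_dim
     (quotient_space ((local_ring S)\<lparr>carrier := filtration S \<nu> v\<rparr>) (filtration S \<nu> (v + 1)))))"

definition poincare_series :: "(int ^ 'd) set \<Rightarrow> ('r::finite \<Rightarrow> int ^ 'd) \<Rightarrow> 'r series" where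
  "poincare_series S \<nu> = (THE P. P \<in> power_series \<and>
     laurent_mult ((\<Prod>i\<in>UNIV. tvar i) - 1) P =
     laurent_mult (\<Prod>i\<in>UNIV. (tvar i - 1)) (dim_series S \<nu>))"

section \<open>Integration with respect to the Euler characteristic\<close>

definition jet_ideal :: "(int ^ 'd) set \<Rightarrow> nat \<Rightarrow> 'd germ set" where
  "jet_ideal S k = max_ideal S [^]\<^bsub>ideals_set (local_ring S)\<^esub> (Suc k)"

definition jet_space :: "(int ^ 'd) set \<Rightarrow> nat \<Rightarrow> (complex, 'd germ set) module" where
  "jet_space S k = quotient_space (local_ring S) (jet_ideal S k)"

definition jet :: "(int ^ 'd) set \<Rightarrow> nat \<Rightarrow> 'd germ \<Rightarrow> 'd germ set" where
  "jet S k x = jet_ideal S k +>\<^bsub>local_ring S\<^esub> x"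

text \<open>
  \<^const>\<open>None\<close> is the point added to \<open>\<P>J\<^sup>k\<close>. The image of a \<open>\<complex>\<^sup>*\<close>-orbit under the linear map
  \<^const>\<open>jet\<close> is either \<open>{0}\<close> or again such an orbit.
\<close>

definition jet_proj ::
  "(int ^ 'd) set \<Rightarrow> nat \<Rightarrow> 'd germ set \<Rightarrow> 'd germ set set option" where
  "jet_proj S k L =
     (if jet S k ` L = {\<zero>\<^bsub>jet_space S k\<^esub>} then None else Some (jet S k ` L))"

definition cylinder ::
  "(int ^ 'd) set \<Rightarrow> nat \<Rightarrow> 'd germ set set set \<Rightarrow> 'd germ set set" where
  "cylinder S k B = {L \<in> proj (local_ring S). jet_proj S k L \<in> Some ` B}"

definition cylindrical :: "(int ^ 'd) set \<Rightarrow> 'd germ set set \<Rightarrow> bool" where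
  "cylindrical S A \<longleftrightarrow> (\<exists>k. \<exists>B\<in>constructible (jet_space S k). A = cylinder S k B)"

definition cylinder_euler_char :: "(int ^ 'd) set \<Rightarrow> 'd germ set set \<Rightarrow> int" where
  "cylinder_euler_char S A =
     (THE c. \<exists>k. \<exists>B\<in>constructible (jet_space S k). A = cylinder S k B \<and>
        c = euler_char (subtopology (proj_topology (jet_space S k)) B))"

definition level_set ::
  "(int ^ 'd) set \<Rightarrow> ('d germ set \<Rightarrow> ('r::finite) series) \<Rightarrow> 'r series \<Rightarrow> 'd germ set set" where
  "level_set S \<psi> g = {L \<in> proj (local_ring S). \<psi> L = g}"

definition cylindrical_function :: "(int ^ 'd) set \<Rightarrow> ('d germ set \<Rightarrow> ('r::finite) series) \<Rightarrow> bool" where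
  "cylindrical_function S \<psi> \<longleftrightarrow> \<psi> ` proj (local_ring S) \<subseteq> power_series \<and>
     (\<forall>g\<in>power_series. g \<noteq> (\<lambda>_. 0) \<longrightarrow> cylindrical S (level_set S \<psi> g))"

text \<open>
  \<open>I\<close> is the sum of \<open>\<chi>(\<psi>\<^sup>-\<^sup>1(g)) \<cdot> g\<close> over \<open>g \<noteq> 0\<close> as a formal power series: for every exponent \<open>v\<close>,
  only finitely many summands have a nonzero coefficient at \<open>t\<^sup>v\<close>.
\<close>

definition has_euler_integral ::
  "(int ^ 'd) set \<Rightarrow> ('d germ set \<Rightarrow> ('r::finite) series) \<Rightarrow> 'r series \<Rightarrow> bool" where
  "has_euler_integral S \<psi> I \<longleftrightarrow> cylindrical_function S \<psi> \<and>
     (\<forall>v. let G = {g \<in> power_series - {\<lambda>_. 0}. cylinder_euler_char S (level_set S \<psi> g) * g v \<noteq> 0}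
          in finite G \<and> I v = (\<Sum>g\<in>G. cylinder_euler_char S (level_set S \<psi> g) * g v))"

definition t_monomial :: "int ^ 'r \<Rightarrow> 'r series" where
  "t_monomial w = (\<lambda>v. if v = w then 1 else 0)"

text \<open>The function \<open>t\<^sup>\<nu>\<close>; its value does not depend on the representative \<open>x\<close> of \<open>L\<close>.\<close>

definition t_nu :: "('r::finite \<Rightarrow> int ^ 'd) \<Rightarrow> 'd germ set \<Rightarrow> 'r series" where
  "t_nu \<nu> L = the_elem ((\<lambda>x. t_monomial (\<chi> i. germ_val (\<nu> i) x)) ` L)"

end

theory Submission
  imports Defs
begin

text \<open>
  Both sides are the generating function \<open>\<Sum>\<^sub>s t\<^sup>\<nu>\<^sup>(\<^sup>s\<^sup>)\<close> of the exponents \<open>s \<in> S\<close>. A germ \<open>a/s\<close> expands into a power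
  series with exponents in \<open>S\<close>, its valuations are minima over the support, and jets are truncations.

  The dimension of \<open>I(v)/I(v+1)\<close> therefore counts the exponents \<open>s\<close> with \<open>\<nu>(s) \<ge> v\<close> and some equality
  \<open>\<nu>\<^sub>i(s) = v\<^sub>i\<close>; for a single \<open>s\<close> these \<open>v\<close> form the boundary of an orthant, whose series becomes
  \<open>(t\<^sub>1\<cdots>t\<^sub>r - 1) t\<^sup>\<nu>\<^sup>(\<^sup>s\<^sup>)\<close> after multiplication by \<open>\<Prod>\<^sub>i (t\<^sub>i - 1)\<close>.

  The level set of \<open>t\<^sup>\<nu>\<close> at \<open>t\<^sup>w\<close> is a cylinder over a union of sets \<open>D\<^sub>A = {x\<^sub>s \<noteq> 0 for s \<in> A}\<close> in the
  projectivization of a coordinate subspace, open in it. These are products of copies of \<open>\<complex>\<close> and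
  \<open>\<complex>\<^sup>*\<close>, so \<open>\<chi>(D\<^sub>A)\<close> is \<open>1\<close> if \<open>A\<close> is a singleton and \<open>0\<close> otherwise. Additivity of \<open>\<chi>\<close> for open covers,
  which follows from the long exact sequence of a pair and excision, shows that the level set has
  as Euler characteristic the number of coordinate points in it, that is of \<open>s \<in> S\<close> with \<open>\<nu>(s) = w\<close>.
\<close>

section \<open>The rank of an abelian group\<close>

text \<open>\<open>euler_char\<close> is built from ordinary singular homology, so additivity over
  the locally closed torus orbits is not immediate. For open covers excision gives it directly, and
  this dictates the sets D_A: they are open in one common coordinate subspace, and D_A \<inter> D_B
  = D_(A \<union> B) keeps inclusion-exclusion inside the family. Ranks are suprema of sets of
  naturals, which say nothing when unbounded; hence the existence of a maximum is carried along with
  every rank, and vanishing in high degrees with every Euler characteristic. The Euler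
  characteristic of a cylinder is a definite description over all jet orders and all bases. For a
  nonempty level set the base over a given order is forced, and its count of coordinate points turns
  out the same for every admissible order. On the algebraic side, strict positivity of the
  valuations on nonzero exponents, together with finite generation, makes the fibres of the exponent
  map finite, singles out the fixed point and turns division of series into a well-founded
  recursion.\<close>

lemma homogeneous_integer_system:
  fixes a :: "'i \<Rightarrow> 'j \<Rightarrow> int"
  assumes "finite I" "finite J" "card I < card J"
  shows "\<exists>n. (\<exists>j\<in>J. n j \<noteq> 0) \<and> (\<forall>i\<in>I. (\<Sum>j\<in>J. a i j * n j) = 0)"
  using assms
proof (induction I arbitrary: J a rule: finite_induct)
  case empty
  then have "J \<noteq> {}" by auto
  then show ?case by (intro exI[of _ "\<lambda>_. 1"]) auto
next
  case (insert i I)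
  show ?case
  proof (cases "\<forall>j\<in>J. a i j = 0")
    case True
    have "card I < card J" using insert by simp
    from insert.IH[OF \<open>finite J\<close> this] show ?thesis using True by auto
  next
    case False
    then obtain j0 where j0: "j0 \<in> J" "a i j0 \<noteq> 0" by blast
    define J' where "J' = J - {j0}"
    have J': "finite J'" "card I < card J'" "J = insert j0 J'" "j0 \<notin> J'"
      using insert j0 by (auto simp: J'_def)
    \<comment> \<open>Fraction-free elimination: row \<open>k\<close> times the pivot
      \<open>a i j0\<close>, minus \<open>a k j0\<close> times row \<open>i\<close>. The column
      \<open>j0\<close> drops out.\<close>
    define a' where "a' = (\<lambda>k j. a k j * a i j0 - a k j0 * a i j)"
    obtain n where n: "\<exists>j\<in>J'. n j \<noteq> 0" "\<forall>k\<in>I. (\<Sum>j\<in>J'. a' k j * n j) = 0"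
      using insert.IH[OF J'(1,2), of a'] by blast
    \<comment> \<open>Back substitution, with the solution for \<open>J'\<close> scaled by the pivot
      so that the value at \<open>j0\<close> stays an integer.\<close>
    define m where "m = (\<lambda>j. if j = j0 then - (\<Sum>j\<in>J'. a i j * n j) else a i j0 * n j)"
    have sum: "(\<Sum>j\<in>J. a k j * m j) =
        - a k j0 * (\<Sum>j\<in>J'. a i j * n j) + (\<Sum>j\<in>J'. a k j * (a i j0 * n j))" for k
    proof -
      have "(\<Sum>j\<in>J. a k j * m j) = a k j0 * m j0 + (\<Sum>j\<in>J'. a k j * m j)"
        using J' by simp
      also have "(\<Sum>j\<in>J'. a k j * m j) = (\<Sum>j\<in>J'. a k j * (a i j0 * n j))"
        using J'(4) by (intro sum.cong) (auto simp: m_def)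
      finally show ?thesis by (simp add: m_def)
    qed
    have "(\<Sum>j\<in>J. a k j * m j) = (\<Sum>j\<in>J'. a' k j * n j)" for k
      unfolding sum by (subst sum_distrib_left, subst sum.distrib [symmetric], intro sum.cong)
        (auto simp: a'_def algebra_simps)
    moreover have "(\<Sum>j\<in>J'. a' i j * n j) = 0"
      by (intro sum.neutral) (simp add: a'_def)
    moreover have "\<exists>j\<in>J. m j \<noteq> 0"
      using n(1) J' j0 by (auto simp: m_def)
    ultimately show ?thesis using n(2) by (intro exI[of _ m]) auto
  qed
qed

text \<open>A relation rather than a function, since it also asserts that the maximum exists. The
  set \<open>K\<close> is arbitrary, so that kernels and images can be ranked inside the ambient
  group without passing to subgroup structures.\<close>

definition has_rank :: "('a, 'b) monoid_scheme \<Rightarrow> 'a set \<Rightarrow> nat \<Rightarrow> bool" where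
  "has_rank G K n \<longleftrightarrow> (\<exists>B. B \<subseteq> K \<and> int_independent G B \<and> card B = n) \<and>
     (\<forall>B. B \<subseteq> K \<and> int_independent G B \<longrightarrow> card B \<le> n)"

lemma has_rank_cardE:
  assumes "has_rank G K n"
  obtains B where "B \<subseteq> K" "int_independent G B" "card B = n"
  using assms unfolding has_rank_def by (elim conjE exE)

lemma has_rank_card_le:
  assumes "has_rank G K n" "B \<subseteq> K" "int_independent G B"
  shows "card B \<le> n"
  using assms unfolding has_rank_def by simp

lemma has_rank_unique:
  assumes "has_rank G K m" "has_rank G K n"
  shows "m = n"
  using has_rank_cardE[OF assms(1)] has_rank_cardE[OF assms(2)]
    has_rank_card_le[OF assms(1)] has_rank_card_le[OF assms(2)] by (metis order_antisym)

lemma has_rank_exists: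
  assumes "\<And>B. B \<subseteq> K \<Longrightarrow> int_independent G B \<Longrightarrow> card B \<le> n"
  obtains m where "has_rank G K m"
proof -
  define R where "R = {card B | B. B \<subseteq> K \<and> int_independent G B}"
  have "R \<subseteq> {..n}"
  proof
    fix r assume "r \<in> R"
    then obtain B where "B \<subseteq> K" "int_independent G B" "r = card B" unfolding R_def by auto
    then show "r \<in> {..n}" using assms[of B] by simp
  qed
  then have fin: "finite R" by (rule finite_subset) simp
  have "int_independent G {}" by (auto simp: int_independent_def)
  then have "R \<noteq> {}" unfolding R_def by blast
  with fin have "Max R \<in> R" "\<forall>r\<in>R. r \<le> Max R" by auto
  then have "has_rank G K (Max R)" unfolding has_rank_def R_def by auto
  then show ?thesis by (rule that)
qed

lemma abelian_rank_eq:
  assumes "has_rank G (carrier G) n"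
  shows "abelian_rank G = n"
proof -
  have sub: "B \<subseteq> carrier G" if "int_independent G B" for B
    using that unfolding int_independent_def by simp
  show ?thesis
    unfolding abelian_rank_def
  proof (rule cSup_eq_maximum)
    obtain B where "int_independent G B" "card B = n" using assms by (rule has_rank_cardE)
    then show "n \<in> {card B | B. int_independent G B}" by (intro CollectI exI[of _ B]) simp
  qed (use has_rank_card_le[OF assms] sub in auto)
qed

text \<open>An integral linear combination, written multiplicatively as in
  \<open>int_independent\<close>.\<close>

definition int_comb :: "('a, 'b) monoid_scheme \<Rightarrow> ('a \<Rightarrow> int) \<Rightarrow> 'a set \<Rightarrow> 'a" where
  "int_comb G n B = finprod G (\<lambda>b. b [^]\<^bsub>G\<^esub> n b) B"

context comm_group
begin

lemma int_comb_closed [simp]: "B \<subseteq> carrier G \<Longrightarrow> int_comb G n B \<in> carrier G"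
  unfolding int_comb_def by (intro finprod_closed) auto

lemma int_independent_altdef: "int_independent G B \<longleftrightarrow> finite B \<and> B \<subseteq> carrier G \<and>
     (\<forall>n :: 'a \<Rightarrow> int. int_comb G n B = \<one> \<longrightarrow> (\<forall>b\<in>B. n b = 0))"
  unfolding int_independent_def int_comb_def by simp

lemma int_comb_cong: "B \<subseteq> carrier G \<Longrightarrow> (\<And>b. b \<in> B \<Longrightarrow> m b = n b) \<Longrightarrow> int_comb G m B = int_comb G n B"
  unfolding int_comb_def by (intro finprod_cong') auto

lemma int_comb_add: "B \<subseteq> carrier G \<Longrightarrow> int_comb G (\<lambda>b. m b + n b) B = int_comb G m B \<otimes> int_comb G n B"
  unfolding int_comb_def
  by (subst finprod_multf [symmetric]) (auto intro!: finprod_cong' simp: int_pow_mult subset_iff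
      simp del: finprod_multf)

lemma int_comb_zero: "(\<And>b. b \<in> B \<Longrightarrow> n b = 0) \<Longrightarrow> int_comb G n B = \<one>"
  unfolding int_comb_def by (rule finprod_one_eqI) auto

lemma int_comb_pow:
  assumes "finite B" "B \<subseteq> carrier G"
  shows "int_comb G n B [^] (k::int) = int_comb G (\<lambda>b. k * n b) B"
  using assms
proof (induction B rule: finite_induct)
  case empty
  then show ?case by (simp add: int_comb_def)
next
  case (insert x B)
  have "int_comb G n (insert x B) = x [^] n x \<otimes> int_comb G n B" for n
    using insert unfolding int_comb_def by (intro finprod_insert) auto
  then show ?case using insert
    by (simp add: int_pow_distrib int_pow_pow mult.commute)
qed

lemma int_comb_Un:
  assumes "finite A" "finite B" "A \<inter> B = {}" "A \<subseteq> carrier G" "B \<subseteq> carrier G"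
  shows "int_comb G n (A \<union> B) = int_comb G n A \<otimes> int_comb G n B"
  unfolding int_comb_def using assms by (intro finprod_Un_disjoint) auto

lemma int_comb_sum:
  assumes "finite I" "B \<subseteq> carrier G"
  shows "finprod G (\<lambda>i. int_comb G (f i) B) I = int_comb G (\<lambda>b. \<Sum>i\<in>I. f i b) B"
  using assms
proof (induction I rule: finite_induct)
  case empty
  then show ?case by (simp add: int_comb_zero)
next
  case (insert i I)
  then show ?case by (subst finprod_insert) (auto simp: int_comb_add)
qed

text \<open>The exchange bound over the rationals: only a nonzero multiple of each element of
  \<open>B\<close> has to be a combination of \<open>A\<close>. If \<open>B\<close> were larger, the
  coefficient vectors would satisfy a nontrivial integral relation; multiplied by the nonzero
  factors \<open>k b\<close> it becomes a nontrivial relation in \<open>B\<close>.\<close>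

lemma int_independent_card_le:
  assumes ind: "int_independent G B" and A: "finite A" "A \<subseteq> carrier G"
    and dep: "\<And>b. b \<in> B \<Longrightarrow> \<exists>k c. k \<noteq> 0 \<and> b [^] (k::int) = int_comb G c A"
  shows "card B \<le> card A"
proof (rule ccontr)
  assume "\<not> ?thesis"
  then have lt: "card A < card B" by simp
  have B: "finite B" "B \<subseteq> carrier G" using ind by (auto simp: int_independent_def)
  obtain k c where kc: "\<And>b. b \<in> B \<Longrightarrow> k b \<noteq> 0 \<and> b [^] (k b::int) = int_comb G (c b) A"
    using dep by metis
  obtain n where n: "\<exists>b\<in>B. n b \<noteq> 0" "\<forall>a\<in>A. (\<Sum>b\<in>B. c b a * n b) = 0"
    using homogeneous_integer_system[OF A(1) B(1) lt, of "\<lambda>a b. c b a"] by blast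
  have "int_comb G (\<lambda>b. k b * n b) B = finprod G (\<lambda>b. int_comb G (\<lambda>a. n b * c b a) A) B"
    unfolding int_comb_def[of G _ B]
  proof (intro finprod_cong')
    fix b assume b: "b \<in> B"
    then have "b [^] (k b * n b) = (b [^] k b) [^] n b"
      using B by (auto simp: int_pow_pow)
    then show "b [^] (k b * n b) = int_comb G (\<lambda>a. n b * c b a) A"
      using kc[OF b] A by (simp add: int_comb_pow)
  qed (use A in auto)
  also have "\<dots> = int_comb G (\<lambda>a. \<Sum>b\<in>B. n b * c b a) A"
    using B A by (intro int_comb_sum) auto
  also have "\<dots> = \<one>"
    using n(2) by (intro int_comb_zero) (simp add: mult.commute)
  finally have "\<forall>b\<in>B. k b * n b = 0"
    using ind unfolding int_independent_altdef by blast
  then show False using n(1) kc by auto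
qed

text \<open>Adjoining \<open>x\<close> to a maximal independent family creates a relation. Its
  coefficient at \<open>x\<close> cannot vanish, since otherwise the relation would live in
  \<open>B\<close>, so it can be solved for a power of \<open>x\<close>.\<close>

lemma maximal_independent_dependence:
  assumes K: "K \<subseteq> carrier G" and max: "\<And>B'. B' \<subseteq> K \<Longrightarrow> int_independent G B' \<Longrightarrow> card B' \<le> card B"
    and B: "B \<subseteq> K" "int_independent G B" and x: "x \<in> K"
  shows "\<exists>k c. k \<noteq> 0 \<and> x [^] (k::int) = int_comb G c B"
proof (cases "x \<in> B")
  case True
  have B': "finite B" "B \<subseteq> carrier G" using B by (auto simp: int_independent_def)
  have "int_comb G (\<lambda>b. if b = x then 1 else 0) ({x} \<union> (B - {x})) =
      int_comb G (\<lambda>b. if b = x then 1 else 0) {x} \<otimes> int_comb G (\<lambda>b. if b = x then 1 else 0) (B - {x})"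
    using B' True by (intro int_comb_Un) auto
  moreover have "{x} \<union> (B - {x}) = B" using True by auto
  moreover have "int_comb G (\<lambda>b. if b = x then 1 else 0) (B - {x}) = \<one>"
    by (intro int_comb_zero) auto
  moreover have "int_comb G (\<lambda>b. if b = x then 1 else 0) {x} = x"
    using B' True unfolding int_comb_def by (auto simp: subset_iff)
  ultimately have "x [^] (1::int) = int_comb G (\<lambda>b. if b = x then 1 else 0) B"
    using B' True by (auto simp: subset_iff)
  then show ?thesis by (intro exI[of _ 1]) auto
next
  case False
  have B': "finite B" "B \<subseteq> carrier G" using B by (auto simp: int_independent_def)
  have xG: "x \<in> carrier G" using x K by auto
  have "\<not> int_independent G (insert x B)"
    using max[of "insert x B"] False B' x B(1) by auto
  then obtain n b where n: "int_comb G n (insert x B) = \<one>" "b \<in> insert x B" "n b \<noteq> 0"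
    using B' xG unfolding int_independent_altdef by auto
  have eq: "int_comb G n (insert x B) = x [^] n x \<otimes> int_comb G n B"
    using B' xG False unfolding int_comb_def by (intro finprod_insert) auto
  have "n x \<noteq> 0"
  proof
    assume 0: "n x = 0"
    then have "int_comb G n B = \<one>" using eq n(1) B' by simp
    then have "\<forall>b\<in>B. n b = 0" using B(2) unfolding int_independent_altdef by blast
    then show False using n 0 by auto
  qed
  moreover have "x [^] n x = inv (int_comb G n B)"
    using eq n(1) B' xG by (metis int_comb_closed int_pow_closed inv_equality)
  moreover have "inv (int_comb G n B) = int_comb G n B [^] (-1::int)"
    using B' by (metis int_comb_closed int_pow_1 int_pow_neg)
  ultimately show ?thesis using B' by (auto simp: int_comb_pow)
qed

lemma has_rank_trivial:
  assumes "K \<subseteq> {\<one>}"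
  shows "has_rank G K 0"
proof -
  have "card B = 0" if "B \<subseteq> K" "int_independent G B" for B
  proof -
    have "card B \<le> card ({} :: 'a set)"
    proof (rule int_independent_card_le[OF that(2)])
      fix b assume "b \<in> B"
      then have "b = \<one>" using that assms by auto
      then show "\<exists>k c. k \<noteq> 0 \<and> b [^] (k::int) = int_comb G c {}"
        by (intro exI[of _ 1]) (auto simp: int_comb_def)
    qed auto
    then show ?thesis by simp
  qed
  moreover have "int_independent G {}" by (auto simp: int_independent_def)
  ultimately show ?thesis unfolding has_rank_def by auto
qed

end

section \<open>Homomorphisms and additivity of the rank\<close>

lemma hom_int_comb:
  assumes "comm_group G" "comm_group H" "h \<in> hom G H" "finite B" "B \<subseteq> carrier G"
  shows "h (int_comb G n B) = finprod H (\<lambda>b. h b [^]\<^bsub>H\<^esub> n b) B"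
  using assms(4,5)
proof (induction B rule: finite_induct)
  interpret G: comm_group G by fact
  interpret H: comm_group H by fact
  interpret h: group_hom G H h using assms by unfold_locales auto
  case empty
  then show ?case by (simp add: int_comb_def)
next
  interpret G: comm_group G by fact
  interpret H: comm_group H by fact
  interpret h: group_hom G H h using assms by unfold_locales auto
  case (insert x B)
  have "int_comb G n (insert x B) = x [^]\<^bsub>G\<^esub> n x \<otimes>\<^bsub>G\<^esub> int_comb G n B"
    using insert unfolding int_comb_def by (intro G.finprod_insert) auto
  moreover have "finprod H (\<lambda>b. h b [^]\<^bsub>H\<^esub> n b) (insert x B) =
     h x [^]\<^bsub>H\<^esub> n x \<otimes>\<^bsub>H\<^esub> finprod H (\<lambda>b. h b [^]\<^bsub>H\<^esub> n b) B"
    using insert by (intro H.finprod_insert) auto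
  ultimately show ?case using insert by (simp add: h.hom_int_pow)
qed

text \<open>Being a right inverse makes \<open>s\<close> injective, so the image of a combination is
  again an \<open>int_comb\<close>. For general families images may coincide, and only a product
  indexed by the domain is available.\<close>

lemma hom_int_comb_section:
  assumes "comm_group G" "comm_group H" "h \<in> hom G H" "finite Q" "s ` Q \<subseteq> carrier G"
    "\<And>q. q \<in> Q \<Longrightarrow> h (s q) = q" "Q \<subseteq> carrier H"
  shows "h (int_comb G n (s ` Q)) = int_comb H (\<lambda>q. n (s q)) Q"
proof -
  interpret H: comm_group H by fact
  have inj: "inj_on s Q" using assms(6) by (metis inj_on_inverseI)
  have "h (int_comb G n (s ` Q)) = finprod H (\<lambda>b. h b [^]\<^bsub>H\<^esub> n b) (s ` Q)"
    using assms by (intro hom_int_comb) auto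
  also have "\<dots> = finprod H (\<lambda>q. h (s q) [^]\<^bsub>H\<^esub> n (s q)) Q"
    using assms inj by (intro H.finprod_reindex) (auto simp: subset_iff)
  also have "\<dots> = int_comb H (\<lambda>q. n (s q)) Q"
    unfolding int_comb_def using assms by (intro H.finprod_cong') auto
  finally show ?thesis .
qed

text \<open>Applying \<open>h\<close> to a relation kills the kernel part and leaves a relation in
  \<open>Q\<close>, so the coefficients on the lifts vanish; what remains is a relation in
  \<open>K\<close>.\<close>

lemma int_independent_lift:
  assumes G: "comm_group G" and H: "comm_group H" and h: "h \<in> hom G H"
    and K: "int_independent G K" "K \<subseteq> kernel G H h"
    and Q: "int_independent H Q" "s ` Q \<subseteq> carrier G" "\<And>q. q \<in> Q \<Longrightarrow> h (s q) = q"
  shows "int_independent G (K \<union> s ` Q)" "card (K \<union> s ` Q) = card K + card Q"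
proof -
  interpret G: comm_group G by fact
  interpret H: comm_group H by fact
  interpret h: group_hom G H h using h by unfold_locales auto
  have K': "finite K" "K \<subseteq> carrier G" and Q': "finite Q" "Q \<subseteq> carrier H"
    using K(1) Q(1) by (auto simp: int_independent_def)
  have inj: "inj_on s Q" using Q(3) by (metis inj_on_inverseI)
  \<comment> \<open>An independent family never contains the neutral element. Hence no lift lies in
    the kernel, and \<open>K\<close> is disjoint from the lifts.\<close>
  have one: "\<one>\<^bsub>H\<^esub> \<notin> Q"
  proof
    assume 1: "\<one>\<^bsub>H\<^esub> \<in> Q"
    have "int_comb H (\<lambda>q. if q = \<one>\<^bsub>H\<^esub> then 1 else 0) Q = \<one>\<^bsub>H\<^esub>"
      unfolding int_comb_def by (intro H.finprod_one_eqI) auto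
    then have "\<forall>q\<in>Q. (if q = \<one>\<^bsub>H\<^esub> then 1 else 0) = (0::int)"
      using Q(1) unfolding H.int_independent_altdef by blast
    then show False using 1 by auto
  qed
  have disj: "K \<inter> s ` Q = {}"
  proof (rule ccontr)
    assume "\<not> ?thesis"
    then obtain q where "q \<in> Q" "s q \<in> K" by auto
    then show False using K(2) Q(3) one by (auto simp: kernel_def)
  qed
  show "card (K \<union> s ` Q) = card K + card Q"
    using K' Q' disj inj by (simp add: card_Un_disjoint card_image)
  show "int_independent G (K \<union> s ` Q)"
    unfolding G.int_independent_altdef
  proof (intro conjI allI impI)
    fix n assume n: "int_comb G n (K \<union> s ` Q) = \<one>\<^bsub>G\<^esub>"
    have split: "int_comb G n (K \<union> s ` Q) = int_comb G n K \<otimes>\<^bsub>G\<^esub> int_comb G n (s ` Q)"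
      using K' Q' Q disj by (intro G.int_comb_Un) auto
    have "h (int_comb G n K) = \<one>\<^bsub>H\<^esub>"
      using K K' by (subst hom_int_comb[OF G H h]) (auto intro!: H.finprod_one_eqI simp: kernel_def
          subset_iff)
    moreover have "h (int_comb G n (s ` Q)) = int_comb H (\<lambda>q. n (s q)) Q"
      using Q Q' by (intro hom_int_comb_section[OF G H h])
    ultimately have "int_comb H (\<lambda>q. n (s q)) Q = \<one>\<^bsub>H\<^esub>"
      using n split K' Q Q' h.hom_mult[of "int_comb G n K" "int_comb G n (s ` Q)"] by simp
    then have q0: "\<forall>q\<in>Q. n (s q) = 0" using Q(1) unfolding H.int_independent_altdef
      by (elim conjE allE) (erule impE)
    then have "int_comb G n (s ` Q) = \<one>\<^bsub>G\<^esub>" by (intro G.int_comb_zero) auto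
    then have "int_comb G n K = \<one>\<^bsub>G\<^esub>" using n split K' by simp
    then have "\<forall>b\<in>K. n b = 0" using K(1) unfolding G.int_independent_altdef by blast
    then show "\<forall>b\<in>K \<union> s ` Q. n b = 0" using q0 by auto
  qed (use K' Q' Q in auto)
qed

text \<open>Rank-nullity. Maximal independent families of the kernel and, lifted, of the image give
  a lower bound; for the upper bound every \<open>g\<close> is shown to depend on their union after
  taking a power.\<close>

lemma has_rank_kernel_image:
  assumes G: "comm_group G" and H: "comm_group H" and h: "h \<in> hom G H"
    and a: "has_rank G (kernel G H h) a" and b: "has_rank H (h ` carrier G) b"
  shows "has_rank G (carrier G) (a + b)"
proof -
  interpret G: comm_group G by fact
  interpret H: comm_group H by fact
  interpret h: group_hom G H h using h by unfold_locales auto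
  obtain K where K: "K \<subseteq> kernel G H h" "int_independent G K" "card K = a"
    and Km: "\<And>B. B \<subseteq> kernel G H h \<Longrightarrow> int_independent G B \<Longrightarrow> card B \<le> card K"
    using a unfolding has_rank_def by metis
  obtain Q where Q: "Q \<subseteq> h ` carrier G" "int_independent H Q" "card Q = b"
    and Qm: "\<And>B. B \<subseteq> h ` carrier G \<Longrightarrow> int_independent H B \<Longrightarrow> card B \<le> card Q"
    using b unfolding has_rank_def by metis
  have "\<forall>q\<in>Q. \<exists>x\<in>carrier G. h x = q" using Q(1) by auto
  then obtain s where s: "s ` Q \<subseteq> carrier G" "\<And>q. q \<in> Q \<Longrightarrow> h (s q) = q" by (metis image_subsetI)
  note lift = int_independent_lift[OF G H h K(2,1) Q(2) s]
  have K': "finite K" "K \<subseteq> carrier G" and Q': "finite Q" "Q \<subseteq> carrier H"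
    using K Q by (auto simp: int_independent_def)
  have fin: "finite (K \<union> s ` Q)" "K \<union> s ` Q \<subseteq> carrier G"
    using lift(1) by (auto simp: int_independent_def)
  have inj: "inj_on s Q" using s(2) by (metis inj_on_inverseI)
  have disj: "K \<inter> s ` Q = {}"
    using lift(2) K' Q' inj card_Un_Int[of K "s ` Q"] by (simp add: card_image)
  have "card B \<le> a + b" if B: "int_independent G B" for B
  proof -
    have "card B \<le> card (K \<union> s ` Q)"
    proof (rule G.int_independent_card_le[OF B fin])
      fix g assume "g \<in> B"
      then have g: "g \<in> carrier G" using B by (auto simp: int_independent_def)
      obtain k c where kc: "k \<noteq> 0" "h g [^]\<^bsub>H\<^esub> (k::int) = int_comb H c Q"
        using H.maximal_independent_dependence[of "h ` carrier G" Q "h g", OF _ Qm Q(1,2)] g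
          by (meson h.hom_closed image_eqI image_subsetI)
      define y where "y = int_comb G (\<lambda>x. c (h x)) (s ` Q)"
      have y: "y \<in> carrier G" using s Q' unfolding y_def by (intro G.int_comb_closed) auto
      have "h y = int_comb H (\<lambda>q. c (h (s q))) Q"
        unfolding y_def using s Q' by (intro hom_int_comb_section[OF G H h]) auto
      also have "\<dots> = int_comb H c Q" using s(2) Q' by (intro H.int_comb_cong) auto
      finally have hy: "h y = h g [^]\<^bsub>H\<^esub> k" using kc by simp
      \<comment> \<open>The power of \<open>g\<close> whose image lies in the span of
        \<open>Q\<close> is corrected by a combination \<open>y\<close> of the lifts with the same
        image. The quotient lies in the kernel, where \<open>K\<close> is maximal.\<close>
      define x where "x = g [^]\<^bsub>G\<^esub> k \<otimes>\<^bsub>G\<^esub> inv\<^bsub>G\<^esub> y"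
      have x: "x \<in> kernel G H h"
        using g y hy by (auto simp: x_def kernel_def h.hom_int_pow)
      obtain l d where ld: "l \<noteq> 0" "x [^]\<^bsub>G\<^esub> (l::int) = int_comb G d K"
        using G.maximal_independent_dependence[of "kernel G H h" K x, OF _ Km K(1,2) x]
          by (auto simp: kernel_def)
      have xc: "x \<in> carrier G" using x by (auto simp: kernel_def)
      have "g [^]\<^bsub>G\<^esub> k = x \<otimes>\<^bsub>G\<^esub> y" using g y by (simp add: x_def G.m_assoc)
      then have "g [^]\<^bsub>G\<^esub> (k * l) = x [^]\<^bsub>G\<^esub> l \<otimes>\<^bsub>G\<^esub> y [^]\<^bsub>G\<^esub> l"
        using g xc y by (simp add: G.int_pow_distrib flip: G.int_pow_pow)
      also have "y [^]\<^bsub>G\<^esub> l = int_comb G (\<lambda>x. l * c (h x)) (s ` Q)"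
        unfolding y_def using s Q' by (intro G.int_comb_pow) auto
      also have "x [^]\<^bsub>G\<^esub> l \<otimes>\<^bsub>G\<^esub> \<dots> = int_comb G (\<lambda>x. if x \<in> K then d x else l * c (h x)) (K \<union> s ` Q)"
        using K' Q' s disj ld
        by (subst G.int_comb_Un) (auto intro!: arg_cong2[of _ _ _ _ "mult G"] G.int_comb_cong simp:
            disjoint_iff)
      finally show "\<exists>k c. k \<noteq> 0 \<and> g [^]\<^bsub>G\<^esub> (k::int) = int_comb G c (K \<union> s ` Q)"
        using kc ld by (metis mult_eq_0_iff)
    qed
    then show ?thesis using lift(2) K Q by simp
  qed
  moreover have "K \<union> s ` Q \<subseteq> carrier G" "int_independent G (K \<union> s ` Q)" "card (K \<union> s ` Q) = a + b"
    using fin lift K Q by auto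
  ultimately show ?thesis unfolding has_rank_def by (intro conjI exI[of _ "K \<union> s ` Q"]) auto
qed

text \<open>Finite rank passes to the kernel, which is a subset, and to the image, because
  independent families of the image lift to independent families of the same size.\<close>

lemma has_rank_image:
  assumes G: "comm_group G" and H: "comm_group H" and h: "h \<in> hom G H"
    and n: "has_rank G (carrier G) n"
  shows "\<exists>a b. has_rank G (kernel G H h) a \<and> has_rank H (h ` carrier G) b \<and> n = a + b"
proof -
  interpret G: comm_group G by fact
  interpret H: comm_group H by fact
  interpret h: group_hom G H h using h by unfold_locales auto
  have "kernel G H h \<subseteq> carrier G" by (auto simp: kernel_def)
  then have "card B \<le> n" if "B \<subseteq> kernel G H h" "int_independent G B" for B
    using that by (intro has_rank_card_le[OF n]) auto
  then obtain a where a: "has_rank G (kernel G H h) a" by (rule has_rank_exists)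
  have "card Q \<le> n" if Q: "Q \<subseteq> h ` carrier G" "int_independent H Q" for Q
  proof -
    have "\<forall>q\<in>Q. \<exists>x\<in>carrier G. h x = q" using Q(1) by auto
    then obtain s where s: "s ` Q \<subseteq> carrier G" "\<And>q. q \<in> Q \<Longrightarrow> h (s q) = q" by (metis image_subsetI)
    have "int_independent G {}" by (auto simp: int_independent_def)
    from int_independent_lift[OF G H h this _ Q(2) s]
    have "int_independent G (s ` Q)" "card (s ` Q) = card Q" by auto
    then show ?thesis using has_rank_card_le[OF n s(1)] by simp
  qed
  then obtain b where b: "has_rank H (h ` carrier G) b" by (rule has_rank_exists)
  show ?thesis using has_rank_kernel_image[OF G H h a b] has_rank_unique[OF n] a b by blast
qed

lemma has_rank_iso:
  assumes G: "comm_group G" and H: "comm_group H" and "G \<cong> H" and n: "has_rank G (carrier G) n"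
  shows "has_rank H (carrier H) n"
proof -
  interpret G: comm_group G by fact
  interpret H: comm_group H by fact
  obtain h where h: "h \<in> iso G H" using assms by (auto simp: is_iso_def)
  then have hom: "h \<in> hom G H" "h ` carrier G = carrier H" by (auto simp: iso_def bij_betw_def)
  interpret h: group_hom G H h using hom by unfold_locales auto
  have "kernel G H h \<subseteq> {\<one>\<^bsub>G\<^esub>}"
    using h h.inj_on_one_iff by (auto simp: iso_def bij_betw_def kernel_def)
  then have "has_rank G (kernel G H h) 0" by (rule G.has_rank_trivial)
  note ker = this
  from has_rank_image[OF G H hom(1) n] obtain a b
    where ab: "has_rank G (kernel G H h) a" "has_rank H (h ` carrier G) b" "n = a + b" by metis
  then show ?thesis using has_rank_unique[OF ab(1) ker] hom(2) by simp
qed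

lemma has_rank_integer_group: "has_rank integer_group (carrier integer_group) 1"
proof -
  interpret comm_group integer_group by (rule abelian_integer_group)
  have pow: "x [^]\<^bsub>integer_group\<^esub> (k::int) = k * x" for x k
    by simp
  have single: "int_comb integer_group c {1} = c 1" for c
    unfolding int_comb_def by (simp add: pow)
  have "int_independent integer_group {1}"
    unfolding int_independent_altdef by (auto simp: single)
  moreover have "card B \<le> 1" if "int_independent integer_group B" for B
  proof -
    have "card B \<le> card {1::int}"
      by (rule int_independent_card_le[OF that])
         (auto simp: single pow intro!: exI[of _ 1] exI[of _ "\<lambda>_. _"])
    then show ?thesis by simp
  qed
  ultimately show ?thesis unfolding has_rank_def by (intro conjI exI[of _ "{1}"]) auto
qed

section \<open>Additivity of the Euler characteristic\<close>

text \<open>Both directions occur along the long exact sequence: where the rank of the middle group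
  is known it is split into the ranks of two maps, and where it is sought it is assembled from
  them.\<close>

lemma has_rank_exact:
  assumes "comm_group A" "comm_group B" "comm_group C" "f \<in> hom A B" "g \<in> hom B C"
    and "kernel B C g = f ` carrier A"
  shows "has_rank B (carrier B) b \<Longrightarrow>
      \<exists>x y. has_rank B (f ` carrier A) x \<and> has_rank C (g ` carrier B) y \<and> b = x + y"
    and "has_rank B (f ` carrier A) x \<Longrightarrow> has_rank C (g ` carrier B) y \<Longrightarrow> has_rank B (carrier B) (x + y)"
  using has_rank_image[OF assms(2,3,5)] has_rank_kernel_image[OF assms(2,3,5)] assms(6) by simp_all

section \<open>Euler characteristics of spaces and pairs\<close>

definition homology_ranks :: "'a topology \<Rightarrow> 'a set \<Rightarrow> (nat \<Rightarrow> nat) \<Rightarrow> bool" where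
  "homology_ranks Z S h \<longleftrightarrow> (\<forall>p. has_rank (relative_homology_group (int p) Z S)
     (carrier (relative_homology_group (int p) Z S)) (h p))"

definition alternating_sum :: "(nat \<Rightarrow> nat) \<Rightarrow> nat \<Rightarrow> int" where
  "alternating_sum h N = (\<Sum>p<N. (-1) ^ p * int (h p))"

text \<open>Finite ranks and vanishing in high degrees belong to the predicate, so that values can
  be added and subtracted without further conditions.\<close>

definition has_rel_euler :: "'a topology \<Rightarrow> 'a set \<Rightarrow> int \<Rightarrow> bool" where
  "has_rel_euler Z S c \<longleftrightarrow>
     (\<exists>h N. homology_ranks Z S h \<and> (\<forall>p\<ge>N. h p = 0) \<and> c = alternating_sum h N)"

lemma has_rel_eulerE:
  assumes "has_rel_euler Z S c"
  obtains h N where "homology_ranks Z S h" "\<And>p. p \<ge> N \<Longrightarrow> h p = 0" "c = alternating_sum h N"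
proof -
  from assms obtain h N where "homology_ranks Z S h" "\<forall>p\<ge>N. h p = 0" "c = alternating_sum h N"
    unfolding has_rel_euler_def by (elim exE conjE)
  then show ?thesis by (intro that[of h N]) auto
qed

lemma homology_ranksD:
  "homology_ranks Z S h \<Longrightarrow> has_rank (relative_homology_group (int p) Z S)
     (carrier (relative_homology_group (int p) Z S)) (h p)"
  unfolding homology_ranks_def by (rule spec)

abbreviation has_euler :: "'a topology \<Rightarrow> int \<Rightarrow> bool" where
  "has_euler Z c \<equiv> has_rel_euler Z {} c"

lemma alternating_sum_extend:
  assumes "\<forall>p\<ge>N. h p = 0" "N \<le> N'"
  shows "alternating_sum h N = alternating_sum h N'"
  unfolding alternating_sum_def using assms by (intro sum.mono_neutral_left) auto

lemma has_euler_euler_char: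
  assumes "has_euler Z c"
  shows "euler_char Z = c"
proof -
  obtain h N where h: "homology_ranks Z {} h" and N: "\<forall>p\<ge>N. h p = 0" and c: "c = alternating_sum h N"
    using assms unfolding has_rel_euler_def by (elim exE conjE)
  have "betti_number p Z = h p" for p
    unfolding betti_number_def using h by (auto intro!: abelian_rank_eq simp: homology_ranks_def)
  then have "euler_char Z = (\<Sum>p | h p \<noteq> 0. (-1) ^ p * int (h p))"
    unfolding euler_char_def by simp
  also have "\<dots> = (\<Sum>p<N. (-1) ^ p * int (h p))"
  proof (rule sum.mono_neutral_left)
    show "{p. h p \<noteq> 0} \<subseteq> {..<N}"
    proof
      fix p assume "p \<in> {p. h p \<noteq> 0}"
      then show "p \<in> {..<N}" using N by (cases "p < N") auto
    qed
  qed auto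
  finally show ?thesis unfolding c alternating_sum_def .
qed

lemma homology_ranks_iso:
  assumes "homology_ranks Z S h" "\<And>p. relative_homology_group p Z S \<cong> relative_homology_group p Y T"
  shows "homology_ranks Y T h"
  unfolding homology_ranks_def
proof
  fix p
  show "has_rank (relative_homology_group (int p) Y T) (carrier (relative_homology_group (int p) Y
      T)) (h p)"
    by (rule has_rank_iso[OF abelian_relative_homology_group abelian_relative_homology_group assms(2)])
       (use assms(1) in \<open>auto simp: homology_ranks_def\<close>)
qed

lemma has_rel_euler_iso:
  assumes "has_rel_euler Z S c" "\<And>p. relative_homology_group p Z S \<cong> relative_homology_group p Y T"
  shows "has_rel_euler Y T c"
proof -
  obtain h N where h: "homology_ranks Z S h" and N: "\<forall>p\<ge>N. h p = 0" "c = alternating_sum h N"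
    using assms(1) unfolding has_rel_euler_def by (elim exE conjE)
  show ?thesis
    unfolding has_rel_euler_def using homology_ranks_iso[OF h assms(2)] N
    by (intro exI[of _ h] exI[of _ N] conjI)
qed

lemma has_euler_homotopy_equivalent:
  "has_euler Z c \<Longrightarrow> Z homotopy_equivalent_space Y \<Longrightarrow> has_euler Y c"
  by (erule has_rel_euler_iso) (rule homotopy_equivalent_space_imp_isomorphic_homology_groups)

lemma has_rank_trivial_group:
  assumes "comm_group G" "trivial_group G" "K \<subseteq> carrier G"
  shows "has_rank G K 0"
  using comm_group.has_rank_trivial[OF assms(1), of K] assms by (auto simp: trivial_group_def)

lemma has_euler_empty:
  assumes "topspace Z = {}"
  shows "has_euler Z 0"
proof -
  have "homology_ranks Z {} (\<lambda>_. 0)"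
    unfolding homology_ranks_def using trivial_homology_group_empty[OF assms]
    by (auto intro!: has_rank_trivial_group)
  then show ?thesis unfolding has_rel_euler_def alternating_sum_def
    by (intro exI[of _ "\<lambda>_. 0"] exI[of _ 0]) auto
qed

lemma has_euler_contractible:
  assumes "contractible_space Z" "topspace Z \<noteq> {}"
  shows "has_euler Z 1"
proof -
  obtain a where a: "a \<in> topspace Z" "Z homotopy_equivalent_space (subtopology Z {a})"
    using assms by (auto simp: contractible_eq_homotopy_equivalent_singleton_subtopology)
  let ?Y = "subtopology Z {a}"
  have Y: "topspace ?Y = {a}" using a by auto
  have "has_rank (homology_group (int p) ?Y) (carrier (homology_group (int p) ?Y)) (if p
      = 0 then 1 else 0)" for p
  proof (cases "p = 0")
    case True
    have "path_connected_space ?Y"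
      by (intro contractible_imp_path_connected_space contractible_space_subtopology_singleton)
    then have "homology_group 0 ?Y \<cong> integer_group"
      using Y by (intro isomorphic_integer_zeroth_homology_group) auto
    then have "integer_group \<cong> homology_group 0 ?Y"
      by (rule group.iso_sym [OF group_relative_homology_group])
    from has_rank_iso[OF abelian_integer_group abelian_relative_homology_group this
        has_rank_integer_group]
    show ?thesis using True by simp
  next
    case False
    then show ?thesis using homology_dimension_axiom[OF Y, of "int p"]
      by (auto intro!: has_rank_trivial_group)
  qed
  then have "has_euler ?Y 1"
    unfolding has_rel_euler_def homology_ranks_def alternating_sum_def
    by (intro exI[of _ "\<lambda>p. if p = 0 then 1 else 0"] exI[of _ 1]) auto
  then show ?thesis
    by (rule has_euler_homotopy_equivalent) (subst homotopy_equivalent_space_sym, rule a(2))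
qed

section \<open>The long exact sequence of a pair\<close>

lemma telescoping_alternating:
  fixes d :: "nat \<Rightarrow> nat"
  shows "(\<Sum>p<N. (-1) ^ p * (int (d p) + int (d (Suc p)))) = int (d 0) - (-1) ^ N * int (d N)"
  by (induction N) (auto simp: algebra_simps)

text \<open>\<open>y\<close>, \<open>x\<close>, \<open>r\<close> are the ranks for subspace, space
  and pair; \<open>i\<close>, \<open>j\<close> are the ranks of the maps induced by inclusion, and
  \<open>d p\<close> is the rank of the boundary map leaving degree \<open>p\<close>. Each group
  contributes the ranks of its incoming and outgoing maps, \<open>i\<close> and \<open>j\<close>
  cancel, and the sum over \<open>d\<close> telescopes.\<close>

lemma alternating_sum_LES:
  assumes "\<And>p. y p = d (Suc p) + i p" "\<And>p. x p = i p + j p" "\<And>p. r p = j p + d p"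
    and "d 0 = 0" "d N = 0"
  shows "alternating_sum r N = alternating_sum x N - alternating_sum y N"
proof -
  have "alternating_sum r N - alternating_sum x N + alternating_sum y N =
      (\<Sum>p<N. (-1) ^ p * (int (d p) + int (d (Suc p))))"
    unfolding alternating_sum_def sum_subtractf [symmetric] sum.distrib [symmetric]
    by (intro sum.cong) (auto simp: assms algebra_simps)
  then show ?thesis using assms by (simp add: telescoping_alternating)
qed

context
  fixes Z :: "'a topology" and S :: "'a set"
begin

private definition "ii p = hom_induced p (subtopology Z S) {} Z {} id"
private definition "jj p = hom_induced p Z {} Z S id"
private definition "dd p = hom_boundary p Z S"
private definition "HY p = homology_group p (subtopology Z S)"
private definition "HX p = homology_group p Z"
private definition "HR p = relative_homology_group p Z S"

private lemmas les_defs = ii_def jj_def dd_def HY_def HX_def HR_def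

private lemma hom: "ii p \<in> hom (HY p) (HX p)" "jj p \<in> hom (HX p) (HR p)"
    "dd p \<in> hom (HR p) (HY (p - 1))"
  using homology_exactness_axiom_3[of p Z S] homology_exactness_axiom_1[of p Z S]
  by (auto simp: les_defs group_hom_def group_hom_axioms_def)

private lemma ker:
  "kernel (HX p) (HR p) (jj p) = ii p ` carrier (HY p)"
  "kernel (HR p) (HY (p - 1)) (dd p) = jj p ` carrier (HX p)"
  "kernel (HY (p - 1)) (HX (p - 1)) (ii (p - 1)) = dd p ` carrier (HR p)"
  using homology_exactness_axiom_3[of p Z S] homology_exactness_axiom_1[of p Z S]
    homology_exactness_axiom_2[of p Z S]
  by (auto simp: les_defs)

private lemma ker': "kernel (HY p) (HX p) (ii p) = dd (p + 1) ` carrier (HR (p + 1))"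
  using ker(3)[of "p + 1"] by simp

private lemma hom': "dd (p + 1) \<in> hom (HR (p + 1)) (HY p)"
  using hom(3)[of "p + 1"] by simp

private lemma comm: "comm_group (HY p)" "comm_group (HX p)" "comm_group (HR p)"
  by (simp_all add: les_defs)

private lemmas exact_Y = has_rank_exact[OF comm(3,1,2) hom' hom(1) ker']
private lemmas exact_X = has_rank_exact[OF comm(1,2,3) hom(1,2) ker(1)]
private lemmas exact_R = has_rank_exact[OF comm(2,3,1) hom(2,3) ker(2)]

text \<open>The sequence ends in degree 0 because the homology in degree -1 is trivial.\<close>

private lemma boundary_0: "has_rank (HY (-1)) (dd 0 ` carrier (HR 0)) 0"
proof (rule has_rank_trivial_group)
  show "dd 0 ` carrier (HR 0) \<subseteq> carrier (HY (- 1))" using hom(3)[of 0] by (auto simp: hom_def)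
qed (use comm(1) in \<open>auto simp: HY_def\<close>)

text \<open>Two out of three for a pair: the splittings at the subspace and at the space supply the
  ranks of all maps, from which the relative ranks are assembled.\<close>

lemma has_rel_euler_pair:
  assumes "has_euler Z a" "has_euler (subtopology Z S) b"
  shows "has_rel_euler Z S (a - b)"
proof -
  obtain x N where x0: "homology_ranks Z {} x" and xN: "\<And>p. p \<ge> N \<Longrightarrow> x p = 0"
      and a: "a = alternating_sum x N"
    using assms(1) by (rule has_rel_eulerE) blast
  note x = homology_ranksD[OF x0, folded HX_def]
  obtain y M where y0: "homology_ranks (subtopology Z S) {} y" and yM: "\<And>p. p \<ge> M \<Longrightarrow> y p = 0"
      and b: "b = alternating_sum y M"
    using assms(2) by (rule has_rel_eulerE) blast
  note y = homology_ranksD[OF y0, folded HY_def]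
  have "\<exists>d i. has_rank (HY (int p)) (dd (int p + 1) ` carrier (HR (int p + 1))) d \<and>
     has_rank (HX (int p)) (ii (int p) ` carrier (HY (int p))) i \<and> y p = d + i" for p
    using exact_Y(1)[OF y] .
  then obtain d' i where d': "\<And>p. has_rank (HY (int p)) (dd (int p + 1) ` carrier (HR (int p + 1)))
      (d' p)"
     and i: "\<And>p. has_rank (HX (int p)) (ii (int p) ` carrier (HY (int p))) (i p)"
     and y': "\<And>p. y p = d' p + i p" by metis
  have "\<exists>j. has_rank (HR (int p)) (jj (int p) ` carrier (HX (int p))) j \<and> x p = i p + j" for p
    using exact_X(1)[OF x[of p]] has_rank_unique[OF i[of p]] by metis
  then obtain j where j: "\<And>p. has_rank (HR (int p)) (jj (int p) ` carrier (HX (int p))) (j p)"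
    and x': "\<And>p. x p = i p + j p" by metis
  \<comment> \<open>Splitting at the subspace in degree \<open>p\<close> yields the boundary map out
    of degree \<open>p + 1\<close>. The ranks are reindexed by the degree the map leaves, with 0 at
    the end.\<close>
  define d where "d = (\<lambda>p. case p of 0 \<Rightarrow> 0 | Suc q \<Rightarrow> d' q)"
  have d_simps: "d 0 = 0" "d (Suc p) = d' p" for p by (simp_all add: d_def)
  have d: "has_rank (HY (int p - 1)) (dd (int p) ` carrier (HR (int p))) (d p)" for p
  proof (cases p)
    case 0
    then show ?thesis using boundary_0 by (simp add: d_def)
  next
    case (Suc q)
    then show ?thesis using d'[of q] by (simp add: d_def add.commute)
  qed
  have r: "has_rank (HR (int p)) (carrier (HR (int p))) (j p + d p)" for p
    by (rule exact_R(2)[OF j d])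
  \<comment> \<open>One beyond both bounds, since \<open>d p\<close> is controlled by the subspace
    in degree \<open>p - 1\<close>.\<close>
  define K where "K = Suc (max M N)"
  have d0: "d p = 0" if "p \<ge> K" for p
    using that y'[of "p - 1"] yM[of "p - 1"] by (cases p) (auto simp: d_def K_def)
  have "alternating_sum (\<lambda>p. j p + d p) K = alternating_sum x K - alternating_sum y K"
    by (rule alternating_sum_LES[of _ d i _ j]) (use d0[of K] in \<open>auto simp: x' y' d_simps\<close>)
  moreover have "alternating_sum x K = a" "alternating_sum y K = b"
    unfolding a b by (rule alternating_sum_extend [symmetric]; use xN yM in \<open>auto simp: K_def\<close>)+
  moreover have "j p + d p = 0" if "p \<ge> K" for p
    using that d0 xN[of p] x'[of p] by (auto simp: K_def)
  ultimately show ?thesis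
    unfolding has_rel_euler_def homology_ranks_def using r unfolding HR_def
    by (intro exI[of _ "\<lambda>p. j p + d p"] exI[of _ K]) auto
qed

text \<open>The other direction of two out of three: the relative groups and the subspace now
  determine the ranks of the maps, and the groups of the space are assembled.\<close>

lemma has_euler_from_pair:
  assumes "has_rel_euler Z S a" "has_euler (subtopology Z S) b"
  shows "has_euler Z (a + b)"
proof -
  obtain r N where r0: "homology_ranks Z S r" and rN: "\<And>p. p \<ge> N \<Longrightarrow> r p = 0"
      and a: "a = alternating_sum r N"
    using assms(1) by (rule has_rel_eulerE) blast
  note r = homology_ranksD[OF r0, folded HR_def]
  obtain y M where y0: "homology_ranks (subtopology Z S) {} y" and yM: "\<And>p. p \<ge> M \<Longrightarrow> y p = 0"
      and b: "b = alternating_sum y M"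
    using assms(2) by (rule has_rel_eulerE) blast
  note y = homology_ranksD[OF y0, folded HY_def]
  have "\<exists>j d. has_rank (HR (int p)) (jj (int p) ` carrier (HX (int p))) j \<and>
     has_rank (HY (int p - 1)) (dd (int p) ` carrier (HR (int p))) d \<and> r p = j + d" for p
    using exact_R(1)[OF r] .
  then obtain j d where j: "\<And>p. has_rank (HR (int p)) (jj (int p) ` carrier (HX (int p))) (j p)"
     and d: "\<And>p. has_rank (HY (int p - 1)) (dd (int p) ` carrier (HR (int p))) (d p)"
     and r': "\<And>p. r p = j p + d p" by metis
  have d': "has_rank (HY (int p)) (dd (int p + 1) ` carrier (HR (int p + 1))) (d (Suc p))" for p
    using d[of "Suc p"] by (simp add: add.commute)
  have "\<exists>i. has_rank (HX (int p)) (ii (int p) ` carrier (HY (int p))) i \<and> y p = d (Suc p) + i" for p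
    using exact_Y(1)[OF y[of p]] has_rank_unique[OF d'[of p]] by metis
  then obtain i where i: "\<And>p. has_rank (HX (int p)) (ii (int p) ` carrier (HY (int p))) (i p)"
    and y': "\<And>p. y p = d (Suc p) + i p" by metis
  have x: "has_rank (HX (int p)) (carrier (HX (int p))) (i p + j p)" for p
    by (rule exact_X(2)[OF i j])
  have "d 0 = 0" using has_rank_unique[OF d[of 0]] boundary_0 by simp
  define K where "K = Suc (max M N)"
  have d0: "d p = 0" if "p \<ge> K" for p
    using that r'[of p] rN[of p] by (auto simp: K_def)
  have "alternating_sum r K = alternating_sum (\<lambda>p. i p + j p) K - alternating_sum y K"
    by (rule alternating_sum_LES[of _ d i _ j]) (auto simp: r' y' d0 \<open>d 0 = 0\<close>)
  moreover have "alternating_sum r K = a" "alternating_sum y K = b"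
    unfolding a b by (rule alternating_sum_extend [symmetric]; use rN yM in \<open>auto simp: K_def\<close>)+
  moreover have "i p + j p = 0" if "p \<ge> K" for p
    using that y'[of p] rN[of p] r'[of p] yM[of p] by (auto simp: K_def)
  ultimately show ?thesis
    unfolding has_rel_euler_def homology_ranks_def using x unfolding HX_def
    by (intro exI[of _ "\<lambda>p. i p + j p"] exI[of _ K]) auto
qed

end

text \<open>Excision identifies the pairs (U, U \<inter> V) and (Z, V). The sequence of the first
  pair gives the relative value \<open>a - c\<close>, and the sequence of the second one adds
  \<open>b\<close>.\<close>

theorem has_euler_Un:
  assumes U: "openin Z U" and V: "openin Z V" and UV: "U \<union> V = topspace Z"
    and a: "has_euler (subtopology Z U) a" and b: "has_euler (subtopology Z V) b"
    and c: "has_euler (subtopology Z (U \<inter> V)) c"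
  shows "has_euler Z (a + b - c)"
proof -
  have sub: "subtopology (subtopology Z U) (U \<inter> V) = subtopology Z (U \<inter> V)"
    by (simp add: subtopology_subtopology Int_assoc [symmetric])
  have rel: "has_rel_euler (subtopology Z U) (U \<inter> V) (a - c)"
    by (rule has_rel_euler_pair[OF a]) (simp add: sub c)
  have U': "U \<subseteq> topspace Z" and V': "V \<subseteq> topspace Z" using U V openin_subset by auto
  have cl: "closedin Z (topspace Z - U)" using U by auto
  \<comment> \<open>The set to be excised is the complement of \<open>U\<close>: it is closed, and
    lies in the open set \<open>V\<close> since the two sets cover \<open>Z\<close>.\<close>
  have "Z closure_of (topspace Z - U) \<subseteq> Z interior_of V"
    using closure_of_closedin[OF cl] interior_of_openin[OF V] UV by auto
  note excision = homology_excision_axiom[OF this V']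
  have sets: "topspace Z - (topspace Z - U) = U" "V - (topspace Z - U) = U \<inter> V" using U' V' by auto
  from excision[unfolded sets subtopology_topspace]
  have "relative_homology_group p (subtopology Z U) (U \<inter> V) \<cong> relative_homology_group p Z V" for p
    by (rule is_isoI)
  from has_rel_euler_iso[OF rel this] have "has_rel_euler Z V (a - c)" .
  from has_euler_from_pair[OF this b] show ?thesis by (simp add: algebra_simps)
qed

section \<open>Complements of coordinate subspaces in projective space\<close>

lemma continuous_map_binop:
  fixes f g :: "'b \<Rightarrow> complex" and h :: "complex \<Rightarrow> complex \<Rightarrow> complex"
  assumes f: "continuous_map Y euclidean f" and g: "continuous_map Y euclidean g"
    and h: "continuous_on S (\<lambda>p. h (fst p) (snd p))"
    and S: "\<And>y. y \<in> topspace Y \<Longrightarrow> (f y, g y) \<in> S"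
  shows "continuous_map Y euclidean (\<lambda>y. h (f y) (g y))"
proof -
  have "continuous_map Y (prod_topology euclidean euclidean) (\<lambda>y. (f y, g y))"
    by (intro continuous_map_pairedI f g)
  then have "continuous_map Y (top_of_set S) (\<lambda>y. (f y, g y))"
    using S by (intro continuous_map_into_subtopology) (auto simp: euclidean_product_topology)
  from continuous_map_compose[OF this, of euclidean "\<lambda>p. h (fst p) (snd p)"]
  show ?thesis using h by (simp add: o_def)
qed

lemma continuous_map_mult_complex:
  fixes f g :: "'b \<Rightarrow> complex"
  assumes "continuous_map Y euclidean f" "continuous_map Y euclidean g"
  shows "continuous_map Y euclidean (\<lambda>y. f y * g y)"
  using assms by (rule continuous_map_binop[where S=UNIV]) (auto intro!: continuous_intros)

lemma continuous_map_divide_complex: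
  fixes f g :: "'b \<Rightarrow> complex"
  assumes "continuous_map Y euclidean f" "continuous_map Y euclidean g"
    and "\<And>y. y \<in> topspace Y \<Longrightarrow> g y \<noteq> 0"
  shows "continuous_map Y euclidean (\<lambda>y. f y / g y)"
  using assms by (intro continuous_map_binop[where S="UNIV \<times> (-{0})" and h="(/)"])
    (auto intro!: continuous_intros)

text \<open>A finite-dimensional space presented by a bijective system of linear coordinates.
  Identities such as associativity are not assumed; they are pulled back from the complex numbers
  through injectivity of the coordinates.\<close>

locale coordinates =
  fixes V :: "(complex, 'a) module" (structure) and T :: "'m set" and l :: "'m \<Rightarrow> 'a \<Rightarrow> complex"
  assumes finite_T: "finite T"
    and add_closed: "\<And>x y. x \<in> carrier V \<Longrightarrow> y \<in> carrier V \<Longrightarrow> x \<oplus> y \<in> carrier V"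
    and smult_closed: "\<And>c x. x \<in> carrier V \<Longrightarrow> c \<odot> x \<in> carrier V"
    and zero_closed: "\<zero> \<in> carrier V"
    and coord_linear: "\<And>m. m \<in> T \<Longrightarrow> l m \<in> linear_forms V"
    and coord_zero: "\<And>m. m \<in> T \<Longrightarrow> l m \<zero> = 0"
    and coord_inj: "\<And>x y. x \<in> carrier V \<Longrightarrow> y \<in> carrier V \<Longrightarrow> (\<And>m. m \<in> T \<Longrightarrow> l m x = l m y) \<Longrightarrow> x = y"
    and coord_surj: "\<And>c. \<exists>x\<in>carrier V. \<forall>m\<in>T. l m x = c m"
begin

definition vec :: "('m \<Rightarrow> complex) \<Rightarrow> 'a" where
  "vec c = (SOME x. x \<in> carrier V \<and> (\<forall>m\<in>T. l m x = c m))"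

lemma vec: "vec c \<in> carrier V" "m \<in> T \<Longrightarrow> l m (vec c) = c m"
proof -
  have "vec c \<in> carrier V \<and> (\<forall>m\<in>T. l m (vec c) = c m)"
    unfolding vec_def by (rule someI_ex) (use coord_surj[of c] in auto)
  then show "vec c \<in> carrier V" "m \<in> T \<Longrightarrow> l m (vec c) = c m" by auto
qed

lemma coord_add: "m \<in> T \<Longrightarrow> x \<in> carrier V \<Longrightarrow> y \<in> carrier V \<Longrightarrow> l m (x \<oplus> y) = l m x + l m y"
  and coord_smult: "m \<in> T \<Longrightarrow> x \<in> carrier V \<Longrightarrow> l m (c \<odot> x) = c * l m x"
  using coord_linear[of m] unfolding linear_forms_def by auto

text \<open>Proved by adding one coordinate of \<open>x\<close> at a time. It reduces the topology
  defined by all linear forms to the finitely many coordinates.\<close>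

lemma linear_form_expansion:
  assumes f: "f \<in> linear_forms V" and x: "x \<in> carrier V"
  shows "f x = (\<Sum>m\<in>T. l m x * f (vec (\<lambda>k. if k = m then 1 else 0)))"
proof -
  have add: "f (x \<oplus> y) = f x + f y" "f (c \<odot> x) = c * f x"
    if "x \<in> carrier V" "y \<in> carrier V" for x y c
    using f that unfolding linear_forms_def by auto
  have "f (vec (\<lambda>k. if k \<in> F then l k x else 0)) = (\<Sum>m\<in>F. l m x * f (vec (\<lambda>k. if k = m then 1 else 0)))"
    if "F \<subseteq> T" for F
    using finite_subset[OF that finite_T] that
  proof (induction F rule: finite_induct)
    case empty
    let ?z = "vec (\<lambda>k. if k \<in> {} then l k x else 0)"
    \<comment> \<open>Membership in \<open>linear_forms\<close> gives additivity and homogeneity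
      only; the value at the zero vector is extracted from homogeneity.\<close>
    have "?z = 0 \<odot> ?z"
      by (rule coord_inj) (auto simp: vec smult_closed coord_smult)
    then have "f ?z = 0 * f ?z" using add(2)[of ?z ?z 0] vec(1) by metis
    then show ?case by simp
  next
    case (insert m F)
    let ?z = "\<lambda>F. vec (\<lambda>k. if k \<in> F then l k x else 0)" and ?e = "vec (\<lambda>k. if k = m then 1 else 0)"
    have "?z (insert m F) = ?z F \<oplus> (l m x \<odot> ?e)"
      using insert by (intro coord_inj) (auto simp: vec smult_closed add_closed coord_smult coord_add)
    then have "f (?z (insert m F)) = f (?z F) + l m x * f ?e"
      using add(1) add(2)[OF vec(1) vec(1)] vec(1) smult_closed by simp
    then show ?case using insert by (simp add: add.commute)
  qed
  from this[of T] have "f (vec (\<lambda>k. if k \<in> T then l k x else 0)) = (\<Sum>m\<in>T. l m x * f (vec (\<lambda>k.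
      if k = m then 1 else 0)))"
    by simp
  moreover have "vec (\<lambda>k. if k \<in> T then l k x else 0) = x"
    using x by (intro coord_inj) (auto simp: vec)
  ultimately show ?thesis by simp
qed

lemma topspace_vector_topology [simp]: "topspace (vector_topology V) = carrier V"
proof -
  have "(\<lambda>_. 0) \<in> linear_forms V" by (auto simp: linear_forms_def)
  then have "carrier V \<in> {{x \<in> carrier V. l x \<in> U} | l U. l \<in> linear_forms V \<and> open U}"
    by (auto intro!: exI[of _ "\<lambda>_. 0"] exI[of _ UNIV])
  then show ?thesis unfolding vector_topology_def by auto
qed

abbreviation "vsub \<equiv> subtopology (vector_topology V)"

lemma continuous_map_coord: "m \<in> T \<Longrightarrow> continuous_map (vector_topology V) euclidean (l m)"
  unfolding continuous_map_def
  using coord_linear[of m] unfolding topspace_vector_topology unfolding vector_topology_def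
  by (auto intro!: topology_generated_by_Basis)

text \<open>The subbasic open sets come from arbitrary linear forms, but each form is a finite
  combination of coordinates, so continuity of the coordinates suffices.\<close>

lemma continuous_map_into_vector_topology:
  assumes "f ` topspace Y \<subseteq> carrier V"
    and "\<And>m. m \<in> T \<Longrightarrow> continuous_map Y euclidean (\<lambda>y. l m (f y))"
  shows "continuous_map Y (vector_topology V) f"
  unfolding vector_topology_def
proof (rule continuous_on_generated_topo)
  fix W assume "W \<in> {{x \<in> carrier V. l x \<in> U} | l U. l \<in> linear_forms V \<and> open U}"
  then obtain g U where g: "g \<in> linear_forms V" "open U" "W = {x \<in> carrier V. g x \<in> U}" by auto
  have "continuous_map Y euclidean (\<lambda>y. \<Sum>m\<in>T. l m (f y) * g (vec (\<lambda>k. if k = m then 1 else 0)))"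
    using finite_T assms(2) by (intro continuous_map_sum continuous_map_mult_complex) auto
  then have "continuous_map Y euclidean (\<lambda>y. g (f y))"
    by (rule continuous_map_eq) (use assms(1) g(1) linear_form_expansion in auto)
  from openin_continuous_map_preimage[OF this, of U]
  have "openin Y {y \<in> topspace Y. g (f y) \<in> U}" using g by auto
  moreover have "{y \<in> topspace Y. g (f y) \<in> U} = f -` W \<inter> topspace Y" using g assms(1) by auto
  ultimately show "openin Y (f -` W \<inter> topspace Y)" by simp
qed (use assms(1) topspace_vector_topology in \<open>simp add: vector_topology_def\<close>)

section \<open>Cones without the origin and the projective topology\<close>

definition homog :: "'a set \<Rightarrow> bool" where
  "homog A \<longleftrightarrow> A \<subseteq> carrier V - {\<zero>} \<and> (\<forall>x\<in>A. \<forall>c. c \<noteq> 0 \<longrightarrow> c \<odot> x \<in> A)"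

abbreviation proj_image :: "'a set \<Rightarrow> 'a set set" where
  "proj_image A \<equiv> punctured_line V ` A"

abbreviation proj_sub :: "'a set \<Rightarrow> 'a set topology" where
  "proj_sub A \<equiv> subtopology (proj_topology V) (proj_image A)"

lemma smult_smult: "x \<in> carrier V \<Longrightarrow> c \<odot> (d \<odot> x) = (c * d) \<odot> x"
  and smult_one: "x \<in> carrier V \<Longrightarrow> 1 \<odot> x = x"
  by (rule coord_inj; simp add: smult_closed coord_smult)+

lemma smult_eq_zero: "x \<in> carrier V \<Longrightarrow> c \<noteq> 0 \<Longrightarrow> c \<odot> x = \<zero> \<Longrightarrow> x = \<zero>"
proof (rule coord_inj)
  fix m assume "x \<in> carrier V" "c \<noteq> 0" "c \<odot> x = \<zero>" "m \<in> T"
  then show "l m x = l m \<zero>" using coord_smult[of m x c] coord_zero[of m] by simp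
qed (simp_all add: zero_closed)

lemma punctured_line_eq:
  assumes "x \<in> carrier V" "y \<in> carrier V"
  shows "punctured_line V x = punctured_line V y \<longleftrightarrow> (\<exists>c. c \<noteq> 0 \<and> y = c \<odot> x)"
proof
  assume eq: "punctured_line V x = punctured_line V y"
  have "y \<in> punctured_line V y"
    unfolding punctured_line_def using smult_one[OF assms(2)] by (intro CollectI exI[of _ 1]) auto
  then show "\<exists>c. c \<noteq> 0 \<and> y = c \<odot> x" unfolding eq[symmetric] by (auto simp: punctured_line_def)
next
  assume "\<exists>c. c \<noteq> 0 \<and> y = c \<odot> x"
  then obtain c where c: "c \<noteq> 0" "y = c \<odot> x" by auto
  then have yx: "\<exists>d'. d \<odot> y = d' \<odot> x \<and> d' \<noteq> 0" if "d \<noteq> 0" for d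
    using that assms by (intro exI[of _ "d * c"]) (simp add: smult_smult)
  have xy: "\<exists>d'. d \<odot> x = d' \<odot> y \<and> d' \<noteq> 0" if "d \<noteq> 0" for d
    using that c assms by (intro exI[of _ "d / c"]) (simp add: smult_smult)
  then show "punctured_line V x = punctured_line V y"
    unfolding punctured_line_def using xy yx by blast
qed

text \<open>\<open>homog\<close> sets are saturated for the projection, so membership of a line can
  be tested on any of its representatives.\<close>

lemma proj_image_mem:
  assumes "homog A" "x \<in> carrier V"
  shows "punctured_line V x \<in> proj_image A \<longleftrightarrow> x \<in> A"
proof
  assume "punctured_line V x \<in> proj_image A"
  then obtain y where y: "y \<in> A" "punctured_line V y = punctured_line V x" by auto
  then obtain c where "c \<noteq> 0" "x = c \<odot> y"
    using assms punctured_line_eq[of y x] by (auto simp: homog_def)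
  then show "x \<in> A" using assms(1) y(1) by (auto simp: homog_def)
qed auto

lemma proj_image_Int: "homog A \<Longrightarrow> homog B \<Longrightarrow> proj_image (A \<inter> B) = proj_image A \<inter> proj_image B"
  using proj_image_mem[of B] by (auto simp: homog_def)

lemma topspace_proj [simp]: "topspace (proj_topology V) = proj V"
proof -
  let ?N = "carrier V - {\<zero>}"
  have "{x \<in> ?N. punctured_line V x \<in> proj V} = topspace (vsub ?N)"
    by (auto simp: proj_def)
  then have "openin (vsub ?N) {x \<in> ?N. punctured_line V x \<in> proj V}"
    by (simp only: openin_topspace)
  then have "openin (proj_topology V) (proj V)" unfolding openin_proj_topology by simp
  then have "proj V \<subseteq> topspace (proj_topology V)" by (rule openin_subset)
  moreover have "openin (proj_topology V) (topspace (proj_topology V))" by (rule openin_topspace)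
  then have "topspace (proj_topology V) \<subseteq> proj V" unfolding openin_proj_topology by simp
  ultimately show ?thesis by (intro subset_antisym)
qed

lemma continuous_map_smult: "continuous_map (vector_topology V) (vector_topology V) (\<lambda>x. c \<odot> x)"
proof (rule continuous_map_into_vector_topology)
  fix m assume m: "m \<in> T"
  have "continuous_map (vector_topology V) euclidean (\<lambda>y. c * l m y)"
    by (intro continuous_map_mult_complex continuous_map_coord m) auto
  then show "continuous_map (vector_topology V) euclidean (\<lambda>y. l m (c \<odot> y))"
    by (rule continuous_map_eq) (auto simp: coord_smult m)
qed (auto simp: smult_closed)

text \<open>The saturation of an open set is the union of its preimages under all nonzero scalings,
  and each scaling is continuous.\<close>

lemma open_map_punctured_line:
  "open_map (vsub (carrier V - {\<zero>})) (proj_topology V) (punctured_line V)"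
  unfolding open_map_def
proof (intro allI impI)
  let ?N = "carrier V - {\<zero>}"
  let ?T = "vsub ?N"
  fix U assume U: "openin ?T U"
  then have UN: "U \<subseteq> ?N" using openin_subset by fastforce
  have cont: "continuous_map ?T ?T (\<lambda>x. c \<odot> x)" if "c \<noteq> 0" for c
    by (intro continuous_map_into_subtopology continuous_map_from_subtopology continuous_map_smult)
       (use that smult_closed smult_eq_zero in auto)
  have "{x \<in> ?N. punctured_line V x \<in> proj_image U} = (\<Union>c\<in>-{0}. {x \<in> topspace ?T. c \<odot> x \<in> U})"
  proof (intro equalityI subsetI)
    fix x assume x: "x \<in> {x \<in> ?N. punctured_line V x \<in> proj_image U}"
    then obtain u where u: "u \<in> U" "punctured_line V x = punctured_line V u" by auto
    then obtain c where "c \<noteq> 0" "u = c \<odot> x" using UN x punctured_line_eq[of x u] by auto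
    then show "x \<in> (\<Union>c\<in>-{0}. {x \<in> topspace ?T. c \<odot> x \<in> U})" using u x by auto
  next
    fix x assume "x \<in> (\<Union>c\<in>-{0}. {x \<in> topspace ?T. c \<odot> x \<in> U})"
    then obtain c where c: "c \<noteq> 0" "x \<in> ?N" "c \<odot> x \<in> U" by auto
    then have "punctured_line V x = punctured_line V (c \<odot> x)"
      using punctured_line_eq[of x "c \<odot> x"] UN by auto
    then show "x \<in> {x \<in> ?N. punctured_line V x \<in> proj_image U}" using c by auto
  qed
  moreover have "openin ?T (\<Union>c\<in>-{0}. {x \<in> topspace ?T. c \<odot> x \<in> U})"
    by (intro openin_clauses(3) ballI) (use openin_continuous_map_preimage[OF cont U] in auto)
  ultimately show "openin (proj_topology V) (proj_image U)"
    using UN unfolding openin_proj_topology proj_def by auto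
qed

text \<open>Openness survives restriction to a saturated set. Hence the subspace topology on the
  image of \<open>A\<close> is also the quotient topology from \<open>A\<close>, and maps out of it
  can be defined on representatives.\<close>

lemma quotient_map_punctured_line:
  assumes "homog A"
  shows "open_map (vsub A) (proj_sub A) (punctured_line V)"
    and "quotient_map (vsub A) (proj_sub A) (punctured_line V)"
proof -
  let ?N = "carrier V - {\<zero>}"
  let ?T = "vsub ?N"
  have A: "A \<subseteq> ?N" using assms by (auto simp: homog_def)
  have sub: "subtopology ?T A = vsub A"
    using A by (simp add: subtopology_subtopology Int_absorb1 Int_absorb2)
  have "open_map (subtopology ?T A) (proj_sub A) (punctured_line V)"
    by (rule open_map_restriction[OF open_map_punctured_line]) (use proj_image_mem[OF assms] A in auto)
  then show op: "open_map (vsub A) (proj_sub A) (punctured_line V)"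
    by (simp only: sub)
  have "continuous_map ?T (proj_topology V) (punctured_line V)"
    unfolding continuous_map_def by (auto simp: openin_proj_topology proj_def)
  then have "continuous_map (subtopology ?T A) (proj_sub A) (punctured_line V)"
    by (intro continuous_map_into_subtopology) (auto intro: continuous_map_from_subtopology)
  then have c: "continuous_map (vsub A) (proj_sub A) (punctured_line V)"
    by (simp only: sub)
  have "proj_image A \<subseteq> proj V" using A by (auto simp: proj_def)
  then show "quotient_map (vsub A) (proj_sub A) (punctured_line V)"
    by (intro continuous_open_imp_quotient_map c op) (use A in auto)
qed

abbreviation proj_euler :: "'a set \<Rightarrow> int \<Rightarrow> bool" where
  "proj_euler A \<equiv> has_euler (proj_sub A)"

text \<open>Openness is required in some common \<open>Y\<close> and restricts to the union. In the
  applications \<open>Y\<close> is a coordinate subspace, within which all the sets involved are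
  open.\<close>

lemma proj_euler_Un:
  assumes hom: "homog A" "homog B"
    and op: "openin (vsub Y) A" "openin (vsub Y) B"
    and "proj_euler A a" "proj_euler B b" "proj_euler (A \<inter> B) c"
  shows "proj_euler (A \<union> B) (a + b - c)"
proof -
  have AB: "homog (A \<union> B)" using hom by (auto simp: homog_def)
  have sub: "A \<union> B \<subseteq> carrier V" using AB by (auto simp: homog_def)
  have ABY: "A \<union> B \<subseteq> Y" using op openin_subset by fastforce
  have opn: "openin (proj_sub (A \<union> B)) (proj_image C)"
    if "openin (vsub Y) C" "C \<subseteq> A \<union> B" for C
  proof -
    have "openin (vsub (A \<union> B)) C"
      using that ABY by (auto simp: openin_subtopology)
    then show ?thesis using quotient_map_punctured_line(1)[OF AB] unfolding open_map_def by blast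
  qed
  have top: "topspace (proj_sub (A \<union> B)) = proj_image (A \<union> B)"
    using AB by (auto simp: homog_def proj_def)
  have ss: "subtopology (proj_sub (A \<union> B)) (proj_image C) = proj_sub C" if "C \<subseteq> A \<union> B" for C
    using that by (simp add: subtopology_subtopology Int_absorb1 image_mono)
  show ?thesis
  proof (rule has_euler_Un[where U="proj_image A" and V="proj_image B"])
    show "has_euler (subtopology (proj_sub (A \<union> B)) (proj_image A \<inter> proj_image B)) c"
      using assms(7) ss[of "A \<inter> B"] by (simp add: le_infI1 flip: proj_image_Int[OF hom])
    show "openin (proj_sub (A \<union> B)) (proj_image A)" by (rule opn) (use op in auto)
    show "openin (proj_sub (A \<union> B)) (proj_image B)" by (rule opn) (use op in auto)
    show "proj_image A \<union> proj_image B = topspace (proj_sub (A \<union> B))" unfolding top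
      by (rule image_Un [symmetric])
    show "has_euler (subtopology (proj_sub (A \<union> B)) (proj_image A)) a" using assms(5) ss[of A] by simp
    show "has_euler (subtopology (proj_sub (A \<union> B)) (proj_image B)) b" using assms(6) ss[of B] by simp
  qed
qed

lemma proj_euler_empty: "proj_euler {} 0"
  by (rule has_euler_empty) simp

text \<open>In the chart where coordinate \<open>m\<close> is normalized to 1, this is the product
  of the sets \<open>K j\<close> over the remaining \<open>j\<close> in \<open>J\<close>.\<close>

definition slice_region :: "'m set \<Rightarrow> 'm \<Rightarrow> ('m \<Rightarrow> complex set) \<Rightarrow> 'a set" where
  "slice_region J m K = {x \<in> carrier V. (\<forall>j\<in>T - J. l j x = 0) \<and> l m x \<noteq> 0 \<and>
     (\<forall>j\<in>J - {m}. l j x / l m x \<in> K j)}"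

definition subspace :: "'m set \<Rightarrow> 'a set" where
  "subspace J = {x \<in> carrier V. \<forall>j\<in>T - J. l j x = 0}"

lemma homog_slice_region: "J \<subseteq> T \<Longrightarrow> m \<in> J \<Longrightarrow> homog (slice_region J m K)"
  unfolding homog_def slice_region_def
  using smult_closed coord_zero by (auto simp: coord_smult subset_iff)

lemma openin_coord_nonzero:
  assumes "m \<in> T" shows "openin (vsub Y) {x \<in> carrier V \<inter> Y. l m x \<noteq> 0}"
  using openin_continuous_map_preimage[OF continuous_map_from_subtopology[OF continuous_map_coord[OF
      assms], of Y], of "-{0}"]
  by auto

lemma openin_slice_region:
  assumes J: "J \<subseteq> T" "m \<in> J" and K: "\<And>j. j \<in> J - {m} \<Longrightarrow> open (K j)"
  shows "openin (vsub (subspace J)) (slice_region J m K)"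
proof -
  let ?S = "vsub (subspace J)"
  define W where "W = {x \<in> carrier V \<inter> subspace J. l m x \<noteq> 0}"
  have W: "openin ?S W" unfolding W_def by (rule openin_coord_nonzero) (use J in auto)
  have 1: "openin ?S {x \<in> W. l j x / l m x \<in> K j}" if j: "j \<in> J - {m}" for j
  proof -
    have "continuous_map (subtopology ?S W) euclidean (\<lambda>x. l j x / l m x)"
      by (intro continuous_map_divide_complex continuous_map_from_subtopology continuous_map_coord)
         (use J j in \<open>auto simp: W_def\<close>)
    from openin_continuous_map_preimage[OF this, of "K j"] K[OF j]
    have "openin (subtopology ?S W) {x \<in> W. l j x / l m x \<in> K j}"
      using openin_subset[OF W] by (simp add: Int_absorb1 W_def conj_ac cong: conj_cong)
    then show ?thesis using W openin_trans_full by blast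
  qed
  have "openin ?S (W \<inter> (\<Inter>j\<in>J - {m}. {x \<in> W. l j x / l m x \<in> K j}))"
  proof (cases "J - {m} = {}")
    case True
    show ?thesis using W unfolding True by simp
  next
    case False
    then have "openin ?S (\<Inter>j\<in>J - {m}. {x \<in> W. l j x / l m x \<in> K j})"
      using finite_subset[OF J(1) finite_T] 1 by (intro openin_INT2) auto
    with W show ?thesis by (rule openin_Int)
  qed
  moreover have "W \<inter> (\<Inter>j\<in>J - {m}. {x \<in> W. l j x / l m x \<in> K j}) = slice_region J m K"
    unfolding W_def slice_region_def subspace_def by auto
  ultimately show ?thesis by simp
qed

text \<open>The chart turns the region into a product of star-shaped sets, which contracts along
  straight lines.\<close>

lemma proj_euler_star_region:
  assumes J: "J \<subseteq> T" "m \<in> J"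
    and a: "\<And>j. j \<in> J - {m} \<Longrightarrow> a j \<in> K j"
    and star: "\<And>j z t. j \<in> J - {m} \<Longrightarrow> z \<in> K j \<Longrightarrow> 0 \<le> t \<Longrightarrow> t \<le> 1 \<Longrightarrow>
                 (1 - of_real t) * z + of_real t * a j \<in> K j"
  shows "proj_euler (slice_region J m K) 1"
proof (rule has_euler_contractible)
  let ?A = "slice_region J m K"
  have hom: "homog ?A" by (rule homog_slice_region[OF J])
  have m: "m \<in> T" using J by auto
  \<comment> \<open>The affine chart itself, realized as a slice of the cone; \<open>b\<close> below
    is the point given by the star centres.\<close>
  define B where "B = {x \<in> ?A. l m x = 1}"
  define SB where "SB = vsub B"
  have BA: "B \<subseteq> ?A" "B \<subseteq> carrier V" by (auto simp: B_def slice_region_def)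
  have topB: "topspace SB = B" using BA by (auto simp: SB_def)
  define b where "b = vec (\<lambda>j. if j = m then 1 else if j \<in> J then a j else 0)"
  have b: "b \<in> B"
    using J a by (auto simp: b_def B_def slice_region_def vec subset_iff)
  have "punctured_line V b \<in> topspace (proj_sub ?A)"
    using b BA hom by (auto simp: homog_def proj_def)
  then show "topspace (proj_sub ?A) \<noteq> {}" by blast
  \<comment> \<open>Straight-line motion in every coordinate at once. The coordinate
    \<open>m\<close> stays equal to 1, so the homotopy does not leave the slice.\<close>
  define H where "H = (\<lambda>(t::real, x). vec (\<lambda>j. (1 - of_real t) * l j x + of_real t * l j b))"
  have "contractible_space SB"
    unfolding contractible_space_def
  proof (rule exI[of _ b], subst homotopic_with; (intro exI[of _ H] conjI ballI)?)
    show "continuous_map (prod_topology (top_of_set {0..1}) SB) SB H"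
      unfolding SB_def
    proof (intro continuous_map_into_subtopology continuous_map_into_vector_topology)
      fix j assume j: "j \<in> T"
      let ?P = "prod_topology (top_of_set {0..1::real}) (vsub B)"
      have c1: "continuous_map ?P euclidean (\<lambda>p. l j (snd p))"
        using continuous_map_compose[OF continuous_map_snd continuous_map_from_subtopology[OF
            continuous_map_coord[OF j]]]
        by (simp add: o_def)
      have c2: "continuous_map ?P euclidean (\<lambda>p. of_real (fst p) :: complex)"
      proof -
        have "continuous_map (top_of_set {0..1}) euclidean (of_real :: real \<Rightarrow> complex)"
          by (simp add: continuous_on_of_real_id)
        from continuous_map_compose[OF continuous_map_fst this] show ?thesis by (simp add: o_def)
      qed
      have c3: "continuous_map ?P euclidean (\<lambda>p. (1 - of_real (fst p)) * l j (snd p) + of_real (fst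
          p) * l j b)"
        using c1 c2
        by (intro continuous_map_binop[where h="\<lambda>u v. (1 - u) * v + u * l j b" and S=UNIV])
           (auto intro!: continuous_intros)
      show "continuous_map ?P euclidean (\<lambda>p. l j (H p))"
        by (rule continuous_map_eq[OF c3]) (auto simp: H_def vec j)
    next
      show "H \<in> topspace (prod_topology (top_of_set {0..1}) (vsub B)) \<rightarrow> B"
      proof
        fix p assume "p \<in> topspace (prod_topology (top_of_set {0..1::real}) (vsub B))"
        then obtain t x where p: "p = (t, x)" "0 \<le> t" "t \<le> 1" "x \<in> B" by auto
        have lj: "l j (H p) = (1 - of_real t) * l j x + of_real t * l j b" if "j \<in> T" for j
          using that p by (simp add: H_def vec)
        have xb: "l m x = 1" "l m b = 1" using p b by (auto simp: B_def)
        have "l j (H p) \<in> K j" if j: "j \<in> J - {m}" for j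
        proof -
          have "l j x \<in> K j" "l j b = a j" using p j xb J
            by (auto simp: B_def slice_region_def b_def vec)
          then show ?thesis using star[OF j] p J j by (subst lj) auto
        qed
        moreover have "l j (H p) = 0" if j: "j \<in> T - J" for j
          using j p b lj[of j] by (auto simp: B_def slice_region_def)
        moreover have "l m (H p) = 1" using lj[OF m] xb by simp
        moreover have "H p \<in> carrier V" using p by (simp add: H_def vec)
        ultimately show "H p \<in> B" unfolding B_def slice_region_def by simp
      qed
    qed (auto simp: H_def vec)
  next
    fix x assume "x \<in> topspace SB"
    then have "x \<in> carrier V" using topB BA by auto
    then show "H (0, x) = id x"
      unfolding H_def by (intro coord_inj) (auto simp: vec)
    show "H (1, x) = b"
      unfolding H_def using b BA by (intro coord_inj) (auto simp: vec)
  qed auto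
  define N where "N = (\<lambda>x. (1 / l m x) \<odot> x)"
  have A: "x \<in> carrier V" "l m x \<noteq> 0" if "x \<in> ?A" for x using that by (auto simp: slice_region_def)
  have NB: "N x \<in> B" if "x \<in> ?A" for x
    using that A[OF that] J coord_smult by (auto simp: N_def B_def slice_region_def smult_closed
        subset_iff)
  have "continuous_map (vsub ?A) SB N"
    unfolding SB_def
  proof (intro continuous_map_into_subtopology continuous_map_into_vector_topology)
    fix j assume j: "j \<in> T"
    have "continuous_map (vsub ?A) euclidean (\<lambda>x. l j x / l m x)"
      by (intro continuous_map_divide_complex continuous_map_from_subtopology continuous_map_coord j m)
         (use A in auto)
    then show "continuous_map (vsub ?A) euclidean (\<lambda>x. l j (N x))"
      by (rule continuous_map_eq) (auto simp: N_def coord_smult j)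
  qed (use NB BA in auto)
  \<comment> \<open>Normalization \<open>N\<close> is constant on lines, so the chosen
    representative is immaterial and \<open>R\<close> is the map induced on the projective
    set.\<close>
  moreover define R where "R = (\<lambda>L. N (SOME x. x \<in> ?A \<and> punctured_line V x = L))"
  have R: "R (punctured_line V x) = N x" if x: "x \<in> ?A" for x
  proof -
    define y where "y = (SOME y. y \<in> ?A \<and> punctured_line V y = punctured_line V x)"
    have y: "y \<in> ?A \<and> punctured_line V y = punctured_line V x"
      unfolding y_def by (rule someI[of _ x]) (use x in auto)
    then obtain c where c: "c \<noteq> 0" "x = c \<odot> y" using punctured_line_eq[of y x] A x by auto
    have yA: "y \<in> carrier V" "l m y \<noteq> 0" using y A by auto
    have "N x = N y" using c yA m by (simp add: N_def smult_smult coord_smult)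
    then show ?thesis unfolding R_def y_def by simp
  qed
  ultimately have "continuous_map (vsub ?A) SB (R \<circ> punctured_line V)"
    by (elim continuous_map_eq) (auto simp: R)
  then have Rc: "continuous_map (proj_sub ?A) SB R"
    by (rule continuous_compose_quotient_map[OF quotient_map_punctured_line(2)[OF hom]])
  have "continuous_map (subtopology (vsub ?A) B) (proj_sub ?A) (punctured_line V)"
    by (rule continuous_map_from_subtopology[OF quotient_imp_continuous_map[OF
        quotient_map_punctured_line(2)[OF hom]]])
  then have qc: "continuous_map SB (proj_sub ?A) (punctured_line V)"
    using BA by (simp add: SB_def subtopology_subtopology Int_absorb1)
  have "punctured_line V (R L) = L" if L: "L \<in> topspace (proj_sub ?A)" for L
  proof -
    obtain x where x: "x \<in> ?A" "L = punctured_line V x" using L by auto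
    have "N x \<in> carrier V" using NB[OF x(1)] BA by auto
    then have "punctured_line V (N x) = punctured_line V x"
      using punctured_line_eq[of x "N x"] A[OF x(1)] by (auto simp: N_def intro!: exI[of _ "1 / l m x"])
    then show ?thesis using R x by simp
  qed
  \<comment> \<open>One composite is enough: contractibility passes from the slice to its
    retracts.\<close>
  then have "retraction_map SB (proj_sub ?A) (punctured_line V)"
    unfolding retraction_map_def retraction_maps_def using Rc qc by blast
  then show "contractible_space (proj_sub ?A)"
    using \<open>contractible_space SB\<close> by (rule contractible_space_retraction_map_image)
qed

definition star_open :: "complex set \<Rightarrow> bool" where
  "star_open K \<longleftrightarrow> open K \<and> (\<exists>a\<in>K. \<forall>z\<in>K. \<forall>t::real. 0 \<le> t \<longrightarrow> t \<le> 1 \<longrightarrow>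
     (1 - of_real t) * z + of_real t * a \<in> K)"

lemma slice_region_upd:
  assumes "j \<in> J - {m}"
  shows "slice_region J m (K(j := A)) \<union> slice_region J m (K(j := B)) = slice_region J m (K(j := A \<union> B))"
    and "slice_region J m (K(j := A)) \<inter> slice_region J m (K(j := B)) = slice_region J m (K(j := A \<inter> B))"
    and "slice_region J m (K(j := {})) = {}"
  using assms unfolding slice_region_def by auto

lemma proj_euler_slice_Un:
  assumes J: "J \<subseteq> T" "m \<in> J" and j: "j \<in> J - {m}" and K: "\<And>j. j \<in> J - {m} \<Longrightarrow> open (K j)"
    and "open A" "open B"
    and "proj_euler (slice_region J m (K(j := A))) a" "proj_euler (slice_region J m (K(j := B))) b"
    and "proj_euler (slice_region J m (K(j := A \<inter> B))) c"
  shows "proj_euler (slice_region J m (K(j := A \<union> B))) (a + b - c)"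
  unfolding slice_region_upd(1)[OF j, symmetric]
  by (rule proj_euler_Un[OF homog_slice_region[OF J] homog_slice_region[OF J]
        openin_slice_region[OF J] openin_slice_region[OF J]])
     (use assms slice_region_upd(2)[OF j] in auto)

lemma star_open_plane: "star_open UNIV"
  unfolding star_open_def by auto

lemma star_open_half_planes: "star_open {z. Im z > 0}" "star_open {z. Im z < 0}"
proof -
  have *: "(1 - t) * x + t > 0" if "x > 0" "0 \<le> t" "t \<le> 1" for x t :: real
    using that by (cases "t = 1") (auto intro: add_pos_nonneg)
  show "star_open {z. Im z > 0}"
    unfolding star_open_def using *
    by (intro conjI bexI[of _ \<i>] ballI allI impI) (auto simp: open_halfspace_Im_gt)
  show "star_open {z. Im z < 0}"
    unfolding star_open_def
  proof (intro conjI bexI[of _ "-\<i>"] ballI allI impI)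
    fix z and t :: real assume "z \<in> {z. Im z < 0}" "0 \<le> t" "t \<le> 1"
    then show "(1 - of_real t) * z + of_real t * - \<i> \<in> {z. Im z < 0}"
      using *[of "- Im z" t] by simp
  qed (auto simp: open_halfspace_Im_lt)
qed

text \<open>These are the planes cut along a closed half-line from 0, star-shaped about 1 and -1.
  Off the real axis the imaginary part is merely scaled until the centre is reached; on the axis the
  sign of the real part is kept.\<close>

lemma star_open_slit_planes: "star_open {z. Im z \<noteq> 0 \<or> Re z > 0}" "star_open {z. Im z \<noteq> 0 \<or> Re z < 0}"
proof -
  have *: "(1 - t) * x + t > 0" if "x > 0" "0 \<le> t" "t \<le> 1" for x t :: real
    using that by (cases "t = 1") (auto intro: add_pos_nonneg)
  have op: "open {z. Im z \<noteq> 0}"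
    using open_Collect_neq[of Im "\<lambda>_. 0"] by (simp add: continuous_intros)
  have "{z. Im z \<noteq> 0 \<or> Re z > 0} = {z. Im z \<noteq> 0} \<union> {z. Re z > 0}" by auto
  then have op1: "open {z. Im z \<noteq> 0 \<or> Re z > 0}"
    using open_Un[OF op open_halfspace_Re_gt[of 0]] by (simp only:)
  have "{z. Im z \<noteq> 0 \<or> Re z < 0} = {z. Im z \<noteq> 0} \<union> {z. Re z < 0}" by auto
  then have op2: "open {z. Im z \<noteq> 0 \<or> Re z < 0}"
    using open_Un[OF op open_halfspace_Re_lt[of 0]] by (simp only:)
  show "star_open {z. Im z \<noteq> 0 \<or> Re z > 0}"
    unfolding star_open_def
  proof (intro conjI bexI[of _ 1] ballI allI impI)
    fix z and t :: real assume "z \<in> {z. Im z \<noteq> 0 \<or> Re z > 0}" "0 \<le> t" "t \<le> 1"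
    then show "(1 - of_real t) * z + of_real t * 1 \<in> {z. Im z \<noteq> 0 \<or> Re z > 0}"
      using *[of "Re z" t] by auto
  qed (use op1 in simp_all)
  show "star_open {z. Im z \<noteq> 0 \<or> Re z < 0}"
    unfolding star_open_def
  proof (intro conjI bexI[of _ "-1"] ballI allI impI)
    fix z and t :: real assume "z \<in> {z. Im z \<noteq> 0 \<or> Re z < 0}" "0 \<le> t" "t \<le> 1"
    then show "(1 - of_real t) * z + of_real t * -1 \<in> {z. Im z \<noteq> 0 \<or> Re z < 0}"
      using *[of "- Re z" t] by auto
  qed (use op2 in simp_all)
qed

text \<open>The punctured plane is the union of two slit planes whose intersection is the disjoint union of
  two half planes, so a factor \<open>\<complex>\<^sup>*\<close> makes the Euler characteristic vanish.\<close>

lemma proj_euler_slice_region: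
  assumes J: "J \<subseteq> T" "m \<in> J" and F: "F \<subseteq> J - {m}"
    and K: "\<And>j. j \<in> F \<Longrightarrow> K j = -{0}" "\<And>j. j \<in> J - {m} - F \<Longrightarrow> star_open (K j)"
  shows "proj_euler (slice_region J m K) (if F = {} then 1 else 0)"
proof -
  have "finite F" by (rule finite_subset[OF F]) (use finite_subset[OF J(1) finite_T] in simp)
  then show ?thesis using F K
  proof (induction F arbitrary: K rule: finite_induct)
    case empty
    then have "\<forall>j\<in>J - {m}. \<exists>a\<in>K j. \<forall>z\<in>K j. \<forall>t::real. 0 \<le> t \<longrightarrow> t \<le> 1 \<longrightarrow>
       (1 - of_real t) * z + of_real t * a \<in> K j"
      unfolding star_open_def by simp
    then obtain a where "\<forall>j\<in>J - {m}. a j \<in> K j \<and> (\<forall>z\<in>K j. \<forall>t::real. 0 \<le> t \<longrightarrow> t \<le> 1 \<longrightarrow>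
       (1 - of_real t) * z + of_real t * a j \<in> K j)"
      unfolding Bex_def bchoice_iff by (elim exE)
    then have "proj_euler (slice_region J m K) 1"
      by (intro proj_euler_star_region[OF J, of a]) simp_all
    then show ?case by simp
  next
    case (insert i F)
    define c :: int where "c = (if F = {} then 1 else 0)"
    have i: "i \<in> J - {m}" using insert by auto
    \<comment> \<open>With a star-shaped set in place of the punctured factor at \<open>i\<close>,
      the number of punctured factors drops by one. The value is the same \<open>c\<close> for all
      half planes and slit planes, so everything cancels in the end.\<close>
    have IH: "proj_euler (slice_region J m (K(i := A))) c" if "star_open A" for A
      unfolding c_def using insert that by (intro insert.IH) auto
    have opK: "open (K j)" if j: "j \<in> J - {m}" for j
    proof (cases "j \<in> insert i F")
      case True
      then have "K j = -{0}" by (rule insert.prems(2))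
      then show ?thesis by auto
    next
      case False
      then show ?thesis using insert.prems(3)[of j] j by (auto simp: star_open_def)
    qed
    note union = proj_euler_slice_Un[OF J i opK]
    let ?U = "{z. Im z > 0}" and ?L = "{z. Im z < 0}"
      and ?P = "{z. Im z \<noteq> 0 \<or> Re z > 0}" and ?N = "{z. Im z \<noteq> 0 \<or> Re z < 0}"
    have "proj_euler (slice_region J m (K(i := ?U \<inter> ?L))) 0"
    proof -
      have "?U \<inter> ?L = {}" by auto
      then show ?thesis using proj_euler_empty slice_region_upd(3)[OF i] by simp
    qed
    then have "proj_euler (slice_region J m (K(i := ?U \<union> ?L))) (c + c - 0)"
      by (intro union IH star_open_half_planes) (use star_open_half_planes in \<open>auto simp:
          star_open_def\<close>)
    moreover have "?U \<union> ?L = ?P \<inter> ?N" by auto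
    ultimately have "proj_euler (slice_region J m (K(i := ?P \<inter> ?N))) (c + c)" by simp
    then have "proj_euler (slice_region J m (K(i := ?P \<union> ?N))) (c + c - (c + c))"
      by (intro union IH star_open_slit_planes) (use star_open_slit_planes in \<open>auto simp:
          star_open_def\<close>)
    moreover have "?P \<union> ?N = -{0}" by (auto simp: complex_eq_iff)
    moreover have "K(i := -{0}) = K" using insert.prems(2)[of i] by (intro ext) auto
    ultimately show ?case by simp
  qed
qed

section \<open>Inclusion-exclusion for coordinate complements\<close>

definition coords_nonzero :: "'m set \<Rightarrow> 'm set \<Rightarrow> 'a set" where
  "coords_nonzero J A = {x \<in> subspace J. \<forall>j\<in>A. l j x \<noteq> 0}"

text \<open>In the chart of any \<open>m \<in> A\<close>, the other coordinates in \<open>A\<close>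
  range over the punctured plane and those in \<open>J - A\<close> over the whole plane.\<close>

lemma coords_nonzero_slice:
  assumes "A \<subseteq> J" "m \<in> A"
  shows "coords_nonzero J A = slice_region J m (\<lambda>j. if j \<in> A - {m} then -{0} else UNIV)"
  using assms unfolding coords_nonzero_def slice_region_def subspace_def by auto

lemma coords_nonzero_region:
  assumes J: "J \<subseteq> T" and A: "A \<subseteq> J" "A \<noteq> {}"
  shows "homog (coords_nonzero J A)"
    and "openin (vsub (subspace J)) (coords_nonzero J A)"
    and "proj_euler (coords_nonzero J A) (if is_singleton A then 1 else 0)"
proof -
  obtain m where m: "m \<in> A" using A by auto
  note eq = coords_nonzero_slice[OF A(1) m]
  have mJ: "m \<in> J" using m A by auto
  show "homog (coords_nonzero J A)" unfolding eq by (rule homog_slice_region[OF J mJ])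
  show "openin (vsub (subspace J)) (coords_nonzero J A)"
    unfolding eq by (rule openin_slice_region[OF J mJ]) auto
  have "proj_euler (coords_nonzero J A) (if A - {m} = {} then 1 else 0)"
    unfolding eq by (rule proj_euler_slice_region[OF J mJ]) (use A star_open_plane in auto)
  moreover have "A - {m} = {} \<longleftrightarrow> is_singleton A" using m by (auto simp: is_singleton_def)
  ultimately show "proj_euler (coords_nonzero J A) (if is_singleton A then 1 else 0)" by simp
qed

lemma homog_Union: "(\<And>A. A \<in> \<A> \<Longrightarrow> homog (f A)) \<Longrightarrow> homog (\<Union>A\<in>\<A>. f A)"
  unfolding homog_def by fast

text \<open>One set is split off, and its intersection with the rest is again a union of the same
  kind. That family is not a subfamily of the given one, hence the induction on the number of
  members.\<close>

lemma proj_euler_Union_coords_nonzero: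
  assumes J: "J \<subseteq> T"
  shows "finite \<A> \<Longrightarrow> (\<And>A. A \<in> \<A> \<Longrightarrow> A \<subseteq> J \<and> A \<noteq> {}) \<Longrightarrow>
    proj_euler (\<Union>A\<in>\<A>. coords_nonzero J A) (int (card {A \<in> \<A>. is_singleton A}))"
proof (induction "card \<A>" arbitrary: \<A> rule: less_induct)
  case less
  show ?case
  proof (cases "\<A> = {}")
    case True
    then show ?thesis using proj_euler_empty by simp
  next
    case False
    then obtain A where A: "A \<in> \<A>" by auto
    define \<B> where "\<B> = \<A> - {A}"
    \<comment> \<open>Nonvanishing on \<open>A\<close> and on \<open>B\<close> is nonvanishing on
      \<open>A \<union> B\<close>, so the intersections are indexed by these unions; there are at
      most as many as members of \<open>\<B>\<close>.\<close>
    define \<C> where "\<C> = (\<lambda>B. A \<union> B) ` \<B>"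
    have AJ: "A \<subseteq> J" "A \<noteq> {}" using less.prems(2)[OF A] by auto
    have fin: "finite \<B>" "finite \<C>" using less.prems by (auto simp: \<B>_def \<C>_def)
    have card: "card \<B> < card \<A>" unfolding \<B>_def using A less.prems by (intro card_Diff1_less)
    then have card': "card \<C> < card \<A>"
      unfolding \<C>_def using card_image_le[OF fin(1), of "\<lambda>B. A \<union> B"] by linarith
    have B: "B \<subseteq> J \<and> B \<noteq> {}" if "B \<in> \<B>" for B using less.prems(2)[of B] that by (auto simp: \<B>_def)
    have C: "C \<subseteq> J \<and> C \<noteq> {}" if "C \<in> \<C>" for C using B AJ that by (auto simp: \<C>_def)
    let ?UB = "\<Union>B\<in>\<B>. coords_nonzero J B"
    have B1: "proj_euler ?UB (int (card {A \<in> \<B>. is_singleton A}))"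
      by (rule less.hyps[OF card fin(1) B])
    have C1: "proj_euler (\<Union>C\<in>\<C>. coords_nonzero J C) (int (card {A \<in> \<C>. is_singleton A}))"
      by (rule less.hyps[OF card' fin(2) C])
    have int: "coords_nonzero J A \<inter> ?UB = (\<Union>C\<in>\<C>. coords_nonzero J C)"
      unfolding \<C>_def coords_nonzero_def by auto
    \<comment> \<open>Two nonempty sets with a singleton union are equal, but \<open>A\<close> was
      removed from \<open>\<B>\<close>. The overlap therefore has Euler characteristic 0.\<close>
    have "{A \<in> \<C>. is_singleton A} = {}"
    proof (intro equals0I)
      fix D assume "D \<in> {A \<in> \<C>. is_singleton A}"
      then obtain B d where d: "B \<in> \<B>" "A \<union> B = {d}" by (auto simp: \<C>_def is_singleton_def)
      then have "A = {d}" "B = {d}" using AJ B[of B] by auto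
      then show False using d by (auto simp: \<B>_def)
    qed
    then have "int (card {A \<in> \<C>. is_singleton A}) = 0" by (simp only: card.empty of_nat_0)
    then have C2: "proj_euler (coords_nonzero J A \<inter> ?UB) 0" using C1 unfolding int by (simp only:)
    have "openin (vsub (subspace J)) ?UB"
      by (intro openin_clauses(3)) (use coords_nonzero_region(2)[OF J] B in auto)
    then have "proj_euler (coords_nonzero J A \<union> ?UB)
       ((if is_singleton A then 1 else 0) + int (card {A \<in> \<B>. is_singleton A}) - 0)"
      by (intro proj_euler_Un[OF _ _ coords_nonzero_region(2)[OF J AJ]] B1 C2
            coords_nonzero_region(1,3)[OF J AJ] homog_Union coords_nonzero_region(1)[OF J])
         (use B in auto)
    moreover have "coords_nonzero J A \<union> ?UB = (\<Union>A\<in>\<A>. coords_nonzero J A)"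
      using A by (auto simp: \<B>_def)
    moreover have "int (card {A \<in> \<A>. is_singleton A}) =
        (if is_singleton A then 1 else 0) + int (card {A \<in> \<B>. is_singleton A}) - 0"
    proof -
      have split: "{A \<in> \<A>. is_singleton A}
          = (if is_singleton A then {A} else {}) \<union> {A \<in> \<B>. is_singleton A}"
        using A by (auto simp: \<B>_def)
      have "card {A \<in> \<A>. is_singleton A}
          = (if is_singleton A then 1 else 0) + card {A \<in> \<B>. is_singleton A}"
        using fin unfolding split by (subst card_Un_disjoint) (auto simp: \<B>_def)
      then show ?thesis by simp
    qed
    ultimately show ?thesis by (simp only:)
  qed
qed

text \<open>Distributing the quantifiers over choice functions \<open>\<phi>\<close> turns the
  condition into nonvanishing on the range of some \<open>\<phi>\<close>. A singleton range means a
  constant \<open>\<phi>\<close>, that is, an element common to all \<open>M i\<close>.\<close>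

theorem proj_euler_coordinate_arrangement:
  fixes M :: "'r::finite \<Rightarrow> 'm set"
  assumes J: "J \<subseteq> T" and M: "\<And>i. M i \<subseteq> J"
  shows "proj_euler {x \<in> subspace J. \<forall>i. \<exists>j\<in>M i. l j x \<noteq> 0} (int (card {m. \<forall>i. m \<in> M i}))"
proof -
  define \<A> where "\<A> = (\<lambda>\<phi>. range \<phi>) ` {\<phi>. \<forall>i. \<phi> i \<in> M i}"
  have sub: "A \<subseteq> J \<and> A \<noteq> {}" if "A \<in> \<A>" for A
    using that M by (auto simp: \<A>_def)
  have "\<A> \<subseteq> Pow J" using sub by auto
  then have fin: "finite \<A>" by (rule finite_subset) (use finite_subset[OF J finite_T] in simp)
  have "{x \<in> subspace J. \<forall>i. \<exists>j\<in>M i. l j x \<noteq> 0} = (\<Union>A\<in>\<A>. coords_nonzero J A)"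
  proof (intro equalityI subsetI)
    fix x assume x: "x \<in> {x \<in> subspace J. \<forall>i. \<exists>j\<in>M i. l j x \<noteq> 0}"
    then have "\<forall>i. \<exists>j. j \<in> M i \<and> l j x \<noteq> 0" by auto
    then obtain \<phi> where "\<forall>i. \<phi> i \<in> M i \<and> l (\<phi> i) x \<noteq> 0" by (rule choice[THEN exE])
    then show "x \<in> (\<Union>A\<in>\<A>. coords_nonzero J A)"
      using x unfolding \<A>_def coords_nonzero_def by (intro UN_I[of "range \<phi>"]) auto
  qed (auto simp: \<A>_def coords_nonzero_def)
  moreover have "{A \<in> \<A>. is_singleton A} = (\<lambda>m. {m}) ` {m. \<forall>i. m \<in> M i}"
  proof (intro equalityI subsetI)
    fix A assume "A \<in> {A \<in> \<A>. is_singleton A}"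
    then obtain \<phi> m where "\<forall>i. \<phi> i \<in> M i" "range \<phi> = {m}" "A = {m}"
      by (auto simp: \<A>_def is_singleton_def)
    then show "A \<in> (\<lambda>m. {m}) ` {m. \<forall>i. m \<in> M i}" by (auto simp: image_iff) (metis rangeI singletonD)
  next
    fix A assume "A \<in> (\<lambda>m. {m}) ` {m. \<forall>i. m \<in> M i}"
    then obtain m where m: "\<forall>i. m \<in> M i" "A = {m}" by auto
    then have "A = range (\<lambda>_::'r. m)" by auto
    then show "A \<in> {A \<in> \<A>. is_singleton A}" using m unfolding \<A>_def
      by (auto intro: image_eqI[of _ _ "\<lambda>_. m"])
  qed
  ultimately show ?thesis
    using proj_euler_Union_coords_nonzero[OF J fin sub] by (simp add: card_image)
qed

end

section \<open>Convolution and affine monoids\<close>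

abbreviation lookup :: "('a \<Rightarrow>\<^sub>0 'b::zero) \<Rightarrow> 'a \<Rightarrow> 'b" where
  "lookup \<equiv> Poly_Mapping.lookup"

abbreviation keys :: "('a \<Rightarrow>\<^sub>0 'b::zero) \<Rightarrow> 'a set" where
  "keys \<equiv> Poly_Mapping.keys"

abbreviation single :: "'a \<Rightarrow> 'b::zero \<Rightarrow> 'a \<Rightarrow>\<^sub>0 'b" where
  "single \<equiv> Poly_Mapping.single"

text \<open>Finite support on one side lets arbitrary functions act on the other. With integer
  coefficients this is \<open>laurent_mult\<close>; with complex coefficients it multiplies an
  element of the semigroup algebra with a power series.\<close>

definition convolve :: "('a::ab_group_add \<Rightarrow>\<^sub>0 'b::comm_ring_1) \<Rightarrow> ('a \<Rightarrow> 'b) \<Rightarrow> 'a \<Rightarrow> 'b" where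
  "convolve p F = (\<lambda>v. \<Sum>w\<in>keys p. lookup p w * F (v - w))"

lemma convolve_superset:
  assumes "finite A" "keys p \<subseteq> A"
  shows "convolve p F v = (\<Sum>w\<in>A. lookup p w * F (v - w))"
  unfolding convolve_def using assms by (intro sum.mono_neutral_left) (auto simp: in_keys_iff)

lemma convolve_add: "convolve (p + q) F = (\<lambda>v. convolve p F v + convolve q F v)"
proof
  fix v
  let ?A = "keys p \<union> keys q"
  have "keys (p + q) \<subseteq> ?A" by (rule keys_add)
  then show "convolve (p + q) F v = convolve p F v + convolve q F v"
    by (subst (1 2 3) convolve_superset[of ?A]) (auto simp: lookup_add algebra_simps sum.distrib)
qed

lemma convolve_zero [simp]: "convolve 0 F = (\<lambda>_. 0)"
  by (simp add: convolve_def)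

lemma convolve_single: "convolve (single w c) F v = c * F (v - w)"
  by (subst convolve_superset[of "{w}"]) auto

lemma convolve_one: "convolve 1 F = F"
proof -
  have "convolve 1 F v = F v" for v using convolve_single[of 0 1 F v] by simp
  then show ?thesis by auto
qed

lemma convolve_uminus: "convolve (- p) F = (\<lambda>v. - convolve p F v)"
  by (rule ext) (simp add: convolve_def sum_negf)

lemma convolve_minus: "convolve (p - q) F = (\<lambda>v. convolve p F v - convolve q F v)"
  using convolve_add[of p "- q" F] by (simp add: convolve_uminus)

lemma convolve_fun_add: "convolve p (\<lambda>v. F v + G v) = (\<lambda>v. convolve p F v + convolve p G v)"
  by (rule ext) (simp add: convolve_def algebra_simps sum.distrib)

lemma convolve_fun_scale: "convolve p (\<lambda>v. c * F v) = (\<lambda>v. c * convolve p F v)"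
  by (rule ext) (simp add: convolve_def sum_distrib_left mult.left_commute)

lemma convolve_fun_diff: "convolve p (\<lambda>v. F v - G v) = (\<lambda>v. convolve p F v - convolve p G v)"
  by (rule ext) (simp add: convolve_def algebra_simps sum_subtractf)

text \<open>Convolution is additive in each argument, so its algebraic laws only need to be checked
  on monomials.\<close>

lemma poly_mapping_additive_induct [case_names zero single add]:
  fixes p :: "'a \<Rightarrow>\<^sub>0 'b::comm_monoid_add"
  assumes "P 0" "\<And>k v. P (single k v)" "\<And>p q. P p \<Longrightarrow> P q \<Longrightarrow> P (p + q)"
  shows "P p"
proof (induction p rule: update_induct)
  case const
  then show ?case using assms(1) .
next
  case (update f a b)
  have "Poly_Mapping.update a b f = f + single a b"
    using update(1) by (intro poly_mapping_eqI) (auto simp: lookup_update lookup_add lookup_single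
        in_keys_iff)
  then show ?case using assms update by simp
qed

lemma convolve_lookup: "convolve p (lookup q) = lookup (p * q)"
proof (induction p rule: poly_mapping_additive_induct)
  case (single k v)
  show ?case
  proof (induction q rule: poly_mapping_additive_induct)
    case (single k' v')
    then show ?case
      by (auto simp: fun_eq_iff convolve_single mult_single lookup_single when_def algebra_simps)
  next
    case (add p q)
    have "lookup (p + q) = (\<lambda>v. lookup p v + lookup q v)"
      by (simp add: fun_eq_iff lookup_add)
    with add show ?case by (simp add: convolve_fun_add distrib_left) (simp add: fun_eq_iff lookup_add)
  qed (simp add: convolve_def)
next
  case (add p q)
  then show ?case by (simp add: convolve_add distrib_right) (simp add: fun_eq_iff lookup_add)
qed auto

text \<open>The module law: a product such as that of the \<open>tvar i - 1\<close> can be applied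
  one factor at a time, and denominators can be multiplied.\<close>

lemma convolve_mult: "convolve (p * q) F = convolve p (convolve q F)"
proof (induction p rule: poly_mapping_additive_induct)
  case (single k v)
  show ?case
  proof (induction q rule: poly_mapping_additive_induct)
    case (single k' v')
    then show ?case
      by (auto simp: fun_eq_iff convolve_single mult_single algebra_simps)
  next
    case zero
    then show ?case by (simp add: convolve_def)
  next
    case (add p q)
    then show ?case by (simp add: convolve_add convolve_fun_add distrib_left)
  qed
next
  case (add p q)
  then show ?case by (simp add: convolve_add distrib_right)
qed auto

section \<open>Affine monoids with positive valuations\<close>

lemma pairing_add: "pairing (a + b) n = pairing a n + pairing b n"
  by (simp add: pairing_def algebra_simps sum.distrib)

lemma pairing_zero [simp]: "pairing 0 n = 0"
  by (simp add: pairing_def)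

text \<open>The positivity assumption is what a point in the interior of the cone gives on nonzero
  exponents; it makes the monoid pointed.\<close>

locale toric =
  fixes S :: "(int ^ 'd) set" and \<nu> :: "'r::finite \<Rightarrow> int ^ 'd"
  assumes fg: "finitely_generated_submonoid S"
    and pos: "\<And>m i. m \<in> S \<Longrightarrow> m \<noteq> 0 \<Longrightarrow> 0 < pairing m (\<nu> i)"
begin

text \<open>A grading by one arbitrary member of the family of valuations, with values in the
  naturals, which serves as the measure for inductions on exponents.\<close>

definition wt :: "int ^ 'd \<Rightarrow> nat" where "wt m = nat (pairing m (\<nu> undefined))"

lemma submonoid: "0 \<in> S" "a \<in> S \<Longrightarrow> b \<in> S \<Longrightarrow> a + b \<in> S"
proof -
  obtain G where G: "S = add_submonoid hull G" using fg unfolding finitely_generated_submonoid_def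
    by auto
  have "add_submonoid S" unfolding G by (rule hull_in) (auto simp: add_submonoid_def)
  then show "0 \<in> S" "a \<in> S \<Longrightarrow> b \<in> S \<Longrightarrow> a + b \<in> S" by (auto simp: add_submonoid_def)
qed

lemma pairing_nonneg: "m \<in> S \<Longrightarrow> 0 \<le> pairing m (\<nu> i)"
  using pos[of m i] by (cases "m = 0") auto

lemma wt_add: "a \<in> S \<Longrightarrow> b \<in> S \<Longrightarrow> wt (a + b) = wt a + wt b"
  using pairing_nonneg by (simp add: wt_def pairing_add nat_add_distrib)

lemma wt_pos: "m \<in> S \<Longrightarrow> m \<noteq> 0 \<Longrightarrow> 0 < wt m"
  using pos by (simp add: wt_def)

lemma wt_diff_less: "w \<in> S \<Longrightarrow> w \<noteq> 0 \<Longrightarrow> m - w \<in> S \<Longrightarrow> wt (m - w) < wt m"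
  using wt_add[of "m - w" w] wt_pos[of w] by simp

lemma add_eq_0: "a \<in> S \<Longrightarrow> b \<in> S \<Longrightarrow> a + b = 0 \<Longrightarrow> a = 0"
  using wt_add[of a b] wt_pos[of a] by (auto simp: wt_def)

lemma sum_list_in: "set xs \<subseteq> S \<Longrightarrow> sum_list xs \<in> S"
  by (induction xs) (auto simp: submonoid)

lemma length_le_pairing: "set xs \<subseteq> S - {0} \<Longrightarrow> int (length xs) \<le> pairing (sum_list xs) (\<nu> i)"
proof (induction xs)
  case (Cons a xs)
  then have "0 < pairing a (\<nu> i)" using pos by auto
  with Cons show ?case by (simp add: pairing_add)
qed simp

text \<open>The exponents of the monomials in the \<open>k\<close>-th power of the maximal
  ideal.\<close>

definition deg_ge :: "nat \<Rightarrow> (int ^ 'd) set" where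
  "deg_ge k = {sum_list xs | xs. set xs \<subseteq> S - {0} \<and> k \<le> length xs}"

text \<open>Every exponent is a sum of nonzero generators. Outside \<open>deg_ge k\<close> fewer
  than \<open>k\<close> of them can occur, and there are only finitely many such words.\<close>

lemma finite_diff_deg_ge: "finite (S - deg_ge k)"
proof -
  obtain G where G: "finite G" "S = add_submonoid hull G"
    using fg unfolding finitely_generated_submonoid_def by auto
  \<comment> \<open>Zero generators are discarded at once, so that the length of a word bounds the
    degree from below.\<close>
  define L where "L = {sum_list xs | xs. set xs \<subseteq> G - {0}}"
  have "S \<subseteq> L"
    unfolding G(2)
  proof (rule hull_minimal)
    show "G \<subseteq> L"
    proof
      fix g assume g: "g \<in> G"
      show "g \<in> L"
      proof (cases "g = 0")
        case True
        then show ?thesis unfolding L_def by (intro CollectI exI[of _ "[]"]) auto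
      next
        case False
        then show ?thesis unfolding L_def using g by (intro CollectI exI[of _ "[g]"]) auto
      qed
    qed
    show "add_submonoid L"
      unfolding add_submonoid_def
    proof (intro conjI ballI)
      show "0 \<in> L" unfolding L_def by (intro CollectI exI[of _ "[]"]) auto
      fix a b assume "a \<in> L" "b \<in> L"
      then obtain xs ys where "a = sum_list xs" "set xs \<subseteq> G - {0}" "b = sum_list ys" "set ys \<subseteq> G - {0}"
        unfolding L_def by auto
      then show "a + b \<in> L" unfolding L_def by (intro CollectI exI[of _ "xs @ ys"]) auto
    qed
  qed
  moreover have "G \<subseteq> S" unfolding G(2) by (rule hull_subset)
  ultimately have "S - deg_ge k \<subseteq> sum_list ` {xs. set xs \<subseteq> G - {0} \<and> length xs \<le> k}"
  proof (intro subsetI)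
    fix m assume GS: "G \<subseteq> S" and SL: "S \<subseteq> L" and m: "m \<in> S - deg_ge k"
    then obtain xs where xs: "m = sum_list xs" "set xs \<subseteq> G - {0}" unfolding L_def by auto
    have "length xs < k"
    proof (rule ccontr)
      assume "\<not> length xs < k"
      then have "m \<in> deg_ge k" unfolding deg_ge_def using xs GS by (intro CollectI exI[of _ xs]) auto
      then show False using m by simp
    qed
    then show "m \<in> sum_list ` {xs. set xs \<subseteq> G - {0} \<and> length xs \<le> k}" using xs by auto
  qed
  moreover have "finite {xs. set xs \<subseteq> G - {0} \<and> length xs \<le> k}"
    using G(1) by (intro finite_lists_length_le) auto
  ultimately show ?thesis using finite_subset by blast
qed

lemma deg_ge_pairing: "m \<in> deg_ge k \<Longrightarrow> int k \<le> pairing m (\<nu> i)"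
  unfolding deg_ge_def using length_le_pairing[of _ i] by fastforce

text \<open>Each nonzero summand contributes at least 1 to the pairing, so a sum of
  \<open>nat c + 1\<close> of them already exceeds \<open>c\<close>.\<close>

lemma finite_pairing_le: "finite {m \<in> S. pairing m (\<nu> i) \<le> c}"
proof (rule finite_subset)
  show "{m \<in> S. pairing m (\<nu> i) \<le> c} \<subseteq> S - deg_ge (Suc (nat c))"
  proof
    fix m assume m: "m \<in> {m \<in> S. pairing m (\<nu> i) \<le> c}"
    have "m \<notin> deg_ge (Suc (nat c))"
    proof
      assume "m \<in> deg_ge (Suc (nat c))"
      from deg_ge_pairing[OF this, of i] m show False by (auto split: if_splits)
    qed
    with m show "m \<in> S - deg_ge (Suc (nat c))" by simp
  qed
qed (rule finite_diff_deg_ge)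

definition monoid_ideal :: "(int ^ 'd) set \<Rightarrow> bool" where
  "monoid_ideal I \<longleftrightarrow> I \<subseteq> S \<and> (\<forall>a\<in>I. \<forall>b\<in>S. a + b \<in> I)"

lemma monoid_ideal_S: "monoid_ideal S"
  unfolding monoid_ideal_def using submonoid by auto

lemma monoid_ideal_deg_ge: "monoid_ideal (deg_ge k)"
  unfolding monoid_ideal_def
proof (intro conjI ballI)
  show "deg_ge k \<subseteq> S" unfolding deg_ge_def using sum_list_in by auto
  fix a b assume "a \<in> deg_ge k" "b \<in> S"
  then obtain xs where xs: "a = sum_list xs" "set xs \<subseteq> S - {0}"
      "k \<le> length xs" unfolding deg_ge_def by auto
  show "a + b \<in> deg_ge k"
  proof (cases "b = 0")
    case True
    then show ?thesis using \<open>a \<in> deg_ge k\<close> by simp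
  next
    case False
    then show ?thesis unfolding deg_ge_def using xs \<open>b \<in> S\<close>
      by (intro CollectI exI[of _ "b # xs"]) (auto simp: add.commute)
  qed
qed

lemma deg_ge_1: "deg_ge 1 = S - {0}"
proof (intro equalityI subsetI)
  fix m assume m: "m \<in> deg_ge 1"
  then have "m \<in> S" using monoid_ideal_deg_ge by (auto simp: monoid_ideal_def)
  moreover have "m \<noteq> 0" using deg_ge_pairing[OF m] by auto
  ultimately show "m \<in> S - {0}" by simp
next
  fix m assume "m \<in> S - {0}"
  then show "m \<in> deg_ge 1" unfolding deg_ge_def by (intro CollectI exI[of _ "[m]"]) auto
qed

lemma deg_ge_add: "a \<in> deg_ge k \<Longrightarrow> b \<in> S - {0} \<Longrightarrow> a + b \<in> deg_ge (Suc k)"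
proof -
  assume "a \<in> deg_ge k" and b: "b \<in> S - {0}"
  then obtain xs where xs: "a = sum_list xs" "set xs \<subseteq> S - {0}"
      "k \<le> length xs" unfolding deg_ge_def by auto
  then show ?thesis unfolding deg_ge_def using b
    by (intro CollectI exI[of _ "b # xs"]) (auto simp: add.commute)
qed

lemma deg_ge_Suc_cases:
  assumes "m \<in> deg_ge (Suc k)"
  obtains a b where "a \<in> deg_ge k" "b \<in> S - {0}" "m = a + b"
proof -
  obtain xs where xs: "m = sum_list xs" "set xs \<subseteq> S - {0}" "Suc k \<le> length xs"
    using assms unfolding deg_ge_def by auto
  then obtain x ys where "xs = x # ys" by (cases xs) auto
  then show ?thesis using xs that[of "sum_list ys" x] unfolding deg_ge_def by (auto simp: add.commute)
qed

lemma monoid_ideal_val1: "monoid_ideal {m \<in> S. c \<le> pairing m (\<nu> i)}"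
  unfolding monoid_ideal_def using submonoid pairing_nonneg by (auto simp: pairing_add add_increasing2)

section \<open>Series supported in the monoid and their division\<close>

abbreviation "A \<equiv> semigroup_algebra S"

definition supported :: "(int ^ 'd) set \<Rightarrow> (int ^ 'd \<Rightarrow> complex) \<Rightarrow> bool" where
  "supported I F \<longleftrightarrow> (\<forall>m. F m \<noteq> 0 \<longrightarrow> m \<in> I)"

lemma supported_lookup: "supported I (lookup f) \<longleftrightarrow> keys f \<subseteq> I"
  unfolding supported_def by (auto simp: in_keys_iff)

lemma supported_convolve:
  assumes "monoid_ideal I" "keys p \<subseteq> S" "supported I F"
  shows "supported I (convolve p F)"
  unfolding supported_def
proof (intro allI impI)
  fix m assume "convolve p F m \<noteq> 0"
  then obtain w where w: "w \<in> keys p" "lookup p w * F (m - w) \<noteq> 0"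
    unfolding convolve_def by (meson sum.not_neutral_contains_not_neutral)
  then have "m - w \<in> I" "w \<in> S" using assms by (auto simp: supported_def)
  then have "(m - w) + w \<in> I" using assms(1) unfolding monoid_ideal_def by blast
  then show "m \<in> I" by simp
qed

text \<open>The denominators of the local ring in explicit form: a function is nonzero at the fixed
  point exactly if its constant term is. This is proved as \<open>denominators_eq\<close>.\<close>

definition den :: "'d laurent set" where
  "den = {s. keys s \<subseteq> S \<and> lookup s 0 \<noteq> 0}"

text \<open>Multiplication by a series with nonzero constant term neither shrinks nor enlarges the monoid
  ideal generated by the support: look at an exponent of least weight outside the ideal.\<close>

lemma supported_convolve_den:
  assumes s: "s \<in> den" and I: "monoid_ideal I" and F: "supported S F"
    and sF: "supported I (convolve s F)"
  shows "supported I F"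
  unfolding supported_def
proof (intro allI impI)
  fix m assume "F m \<noteq> 0"
  then show "m \<in> I"
  proof (induction "wt m" arbitrary: m rule: less_induct)
    case less
    show ?case
    proof (rule ccontr)
      assume m: "m \<notin> I"
      have "lookup s w * F (m - w) = 0" if w: "w \<in> keys s - {0}" for w
      proof (rule ccontr)
        assume "\<not> ?thesis"
        then have nz: "F (m - w) \<noteq> 0" by auto
        have wS: "w \<in> S" "w \<noteq> 0" using w s by (auto simp: den_def)
        have "m - w \<in> S" using nz F by (auto simp: supported_def)
        then have "m - w \<in> I" using less.hyps[OF wt_diff_less[OF wS] nz] by simp
        then have "(m - w) + w \<in> I" using I wS unfolding monoid_ideal_def by blast
        then show False using m by simp
      qed
      then have "(\<Sum>w\<in>keys s - {0}. lookup s w * F (m - w)) = 0"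
        by (rule sum.neutral[OF ballI])
      moreover have "convolve s F m = lookup s 0 * F m +
         (\<Sum>w\<in>keys s - {0}. lookup s w * F (m - w))"
        by (subst convolve_superset[of "insert 0 (keys s)"]) (auto simp: sum.insert_remove)
      ultimately have "convolve s F m = lookup s 0 * F m" by simp
      then have "convolve s F m \<noteq> 0" using s less.prems by (auto simp: den_def)
      then show False using sF m by (auto simp: supported_def)
    qed
  qed
qed

text \<open>The empty set is a monoid ideal, so a difference annihilated by \<open>s\<close> has
  empty support.\<close>

lemma convolve_den_inj:
  assumes "s \<in> den" "supported S F" "supported S G" "convolve s F = convolve s G"
  shows "F = G"
proof -
  have "monoid_ideal {}" by (simp add: monoid_ideal_def)
  moreover have "supported S (\<lambda>m. F m - G m)"
    unfolding supported_def
  proof (intro allI impI)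
    fix m assume "F m - G m \<noteq> 0"
    then have "F m \<noteq> 0 \<or> G m \<noteq> 0" by auto
    then show "m \<in> S" using assms by (auto simp: supported_def)
  qed
  moreover have "supported {} (convolve s (\<lambda>m. F m - G m))"
    using assms(4) by (simp add: convolve_fun_diff supported_def)
  ultimately have "supported {} (\<lambda>m. F m - G m)" using supported_convolve_den[OF assms(1)] by metis
  then show ?thesis by (auto simp: supported_def fun_eq_iff)
qed

text \<open>Solves \<open>convolve s F = E\<close> for the coefficient at \<open>m\<close> in terms
  of exponents of smaller weight. The guards on \<open>w\<close> and \<open>m - w\<close> ensure
  termination for arbitrary \<open>s\<close>; for \<open>s \<in> den\<close> they only suppress
  terms that vanish anyway.\<close>

function quot :: "'d laurent \<Rightarrow> (int ^ 'd \<Rightarrow> complex) \<Rightarrow> int ^ 'd \<Rightarrow> complex" where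
  "quot s E m = (if m \<in> S then (E m - (\<Sum>w\<in>keys s - {0}.
      if w \<in> S \<and> w \<noteq> 0 \<and> m - w \<in> S then lookup s w * quot s E (m - w) else 0))
        / lookup s 0 else 0)"
  by auto
termination by (relation "Wellfounded.measure (\<lambda>(s, E, m). wt m)") (auto intro: wt_diff_less)

declare quot.simps [simp del]

lemma supported_quot: "supported S (quot s E)"
  unfolding supported_def by (subst quot.simps) auto

lemma convolve_quot:
  assumes s: "s \<in> den" and E: "supported S E"
  shows "convolve s (quot s E) = E"
proof
  fix m
  have qz: "quot s E m = 0" if "m \<notin> S" for m using that by (subst quot.simps) auto
  show "convolve s (quot s E) m = E m"
  proof (cases "m \<in> S")
    case True
    have "(\<Sum>w\<in>keys s - {0}. lookup s w * quot s E (m - w)) =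
       (\<Sum>w\<in>keys s - {0}.
      if w \<in> S \<and> w \<noteq> 0 \<and> m - w \<in> S then lookup s w * quot s E (m - w) else 0)"
      using s by (intro sum.cong) (auto simp: den_def qz)
    moreover have "lookup s 0 * quot s E m = E m - (\<Sum>w\<in>keys s - {0}.
      if w \<in> S \<and> w \<noteq> 0 \<and> m - w \<in> S then lookup s w * quot s E (m - w) else 0)"
      using True s by (subst quot.simps) (auto simp: den_def)
    moreover have "convolve s (quot s E) m = lookup s 0 * quot s E m +
       (\<Sum>w\<in>keys s - {0}. lookup s w * quot s E (m - w))"
      by (subst convolve_superset[of "insert 0 (keys s)"]) (auto simp: sum.insert_remove)
    ultimately show ?thesis by simp
  next
    case False
    have "supported S (convolve s (quot s E))"
      using s by (intro supported_convolve monoid_ideal_S supported_quot) (auto simp: den_def)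
    then show ?thesis using False E unfolding supported_def by metis
  qed
qed

end

section \<open>Germs as power series\<close>

context toric
begin

text \<open>At this point the torus acts trivially, since characters of the lattice take the value 1
  at 0. At any other point some nonzero exponent has a nonzero value, and a one-parameter subgroup
  produces infinitely many translates.\<close>

lemma origin_eq: "origin S = restrict (\<lambda>m. if m = 0 then 1 else 0) S"
  unfolding origin_def
proof (rule the_equality)
  let ?o = "restrict (\<lambda>m. if m = 0 then 1 else 0 :: complex) S"
  have "?o (a + b) = ?o a * ?o b" if "a \<in> S" "b \<in> S" for a b
    using that submonoid add_eq_0[of a b] by auto
  moreover have "torus_orbit S ?o \<subseteq> {?o}"
  proof
    fix x assume "x \<in> torus_orbit S ?o"
    then obtain t where t: "t \<in> torus" "x = restrict (\<lambda>m. t m * ?o m) S" unfolding torus_orbit_def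
      by auto
    have "t (0 + 0) = t 0 * t 0" "t 0 \<noteq> 0" using t(1) unfolding torus_def by blast+
    then have "t 0 = 1" by simp
    then have "x = ?o" unfolding t(2) by (intro restrict_ext) auto
    then show "x \<in> {?o}" by simp
  qed
  then have "finite (torus_orbit S ?o)" by (rule finite_subset) simp
  ultimately show "?o \<in> closed_points S \<and> finite (torus_orbit S ?o)"
    using submonoid unfolding closed_points_def by auto
next
  let ?o = "restrict (\<lambda>m. if m = 0 then 1 else 0 :: complex) S"
  fix x assume x: "x \<in> closed_points S \<and> finite (torus_orbit S x)"
  have "x m = 0" if m: "m \<in> S" "m \<noteq> 0" for m
  proof (rule ccontr)
    assume nz: "x m \<noteq> 0"
    define n where "n = \<nu> undefined"
    define c where "c = pairing m n"
    have c: "c > 0" using pos m by (simp add: c_def n_def)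
    \<comment> \<open>Sampled at the naturals, the one-parameter subgroup in the direction of a
      valuation. It acts on the coordinate \<open>m\<close> by powers of \<open>exp c\<close> with
      \<open>c > 0\<close>, hence injectively in \<open>k\<close>.\<close>
    define t where "t = (\<lambda>(k::nat) m. complex_of_real (exp (real k * real_of_int (pairing m n))))"
    have "t k \<in> torus" for k
      unfolding torus_def t_def by (auto simp: pairing_add algebra_simps exp_add)
    then have "range (\<lambda>k. restrict (\<lambda>m. t k m * x m) S) \<subseteq> torus_orbit S x"
      unfolding torus_orbit_def by auto
    then have "finite (range (\<lambda>k. restrict (\<lambda>m. t k m * x m) S))" using x finite_subset by blast
    moreover have "inj (\<lambda>k. restrict (\<lambda>m. t k m * x m) S)"
    proof (rule injI)
      fix k k' assume "restrict (\<lambda>m. t k m * x m) S = restrict (\<lambda>m. t k' m * x m) S"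
      then have "restrict (\<lambda>m. t k m * x m) S m = restrict (\<lambda>m. t k' m * x m) S m" by (rule arg_cong)
      then have "t k m = t k' m" using m nz by simp
      then show "k = k'" using c by (simp add: t_def flip: c_def)
    qed
    ultimately show False using finite_imageD by fastforce
  qed
  then show "x = ?o"
    using x unfolding closed_points_def by (intro extensionalityI[of _ S]) auto
qed

lemma eval_origin: "f \<in> A \<Longrightarrow> eval_at (origin S) f = lookup f 0"
proof -
  assume f: "f \<in> A"
  have "eval_at (origin S) f = (\<Sum>m\<in>keys f. if m = 0 then lookup f m else 0)"
    unfolding eval_at_def origin_eq using f by (intro sum.cong) (auto simp: semigroup_algebra_def)
  then show ?thesis by (simp add: in_keys_iff)
qed

section \<open>Fractions and their expansions\<close>

lemma denominators_eq: "denominators S = den"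
  unfolding denominators_def den_def using eval_origin by (auto simp: semigroup_algebra_def)

lemma A_closed: "a \<in> A \<Longrightarrow> b \<in> A \<Longrightarrow> a + b \<in> A" "a \<in> A \<Longrightarrow> b \<in> A \<Longrightarrow> a * b \<in> A"
  "1 \<in> A" "0 \<in> A" "single 0 c \<in> A"
proof -
  show "a + b \<in> A" if "a \<in> A" "b \<in> A"
    using that keys_add[of a b] by (auto simp: semigroup_algebra_def)
  show "a * b \<in> A" if "a \<in> A" "b \<in> A"
    using that keys_mult[of a b] submonoid by (fastforce simp: semigroup_algebra_def)
qed (auto simp: semigroup_algebra_def submonoid)

lemma den_A: "s \<in> den \<Longrightarrow> s \<in> A"
  by (simp add: den_def semigroup_algebra_def)

lemma den_one: "1 \<in> den"
  by (simp add: den_def submonoid)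

text \<open>The monoid is pointed: no nonzero \<open>w\<close> has both \<open>w\<close> and
  \<open>-w\<close> in \<open>S\<close>, so the constant term of a product is the product of the
  constant terms.\<close>

lemma den_mult: "s \<in> den \<Longrightarrow> t \<in> den \<Longrightarrow> s * t \<in> den"
proof -
  assume s: "s \<in> den" and t: "t \<in> den"
  have "lookup s w * lookup t (0 - w) = 0" if w: "w \<in> keys s - {0}" for w
  proof (rule ccontr)
    assume "\<not> ?thesis"
    then have "0 - w \<in> S" "w \<in> S" using s t w by (auto simp: den_def in_keys_iff)
    then show False using add_eq_0[of w "0 - w"] w by auto
  qed
  then have "(\<Sum>w\<in>keys s - {0}. lookup s w * lookup t (0 - w)) = 0"
    by (rule sum.neutral[OF ballI])
  moreover have "convolve s (lookup t) 0 = lookup s 0 * lookup t 0 +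
      (\<Sum>w\<in>keys s - {0}. lookup s w * lookup t (0 - w))"
    by (subst convolve_superset[of "insert 0 (keys s)"]) (auto simp: sum.insert_remove)
  ultimately have "lookup (s * t) 0 = lookup s 0 * lookup t 0"
    by (simp add: convolve_lookup)
  moreover have "s * t \<in> A" using s t A_closed den_A by blast
  ultimately show ?thesis using s t by (simp add: den_def semigroup_algebra_def)
qed

lemma den_cancel:
  assumes "u \<in> den" "a \<in> A" "u * a = 0"
  shows "a = 0"
proof -
  have "convolve u (lookup a) = convolve u (\<lambda>_. 0)"
    unfolding convolve_lookup assms(3) by (simp add: convolve_def fun_eq_iff)
  note eq = this
  have "lookup a = (\<lambda>_. 0)"
  proof (rule convolve_den_inj[OF assms(1) _ _ eq])
    show "supported S (lookup a)" using assms(2) by (simp add: supported_lookup semigroup_algebra_def)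
  qed (simp add: supported_def)
  then show ?thesis by (intro poly_mapping_eqI) simp
qed

text \<open>A fraction \<open>a/s\<close> is identified with the power series \<open>E\<close> with exponents in \<open>S\<close> and \<open>s \<cdot> E = a\<close>;
  valuations and jets of germs are read off from \<open>E\<close>.\<close>

definition expansion :: "'d laurent \<Rightarrow> 'd laurent \<Rightarrow> int ^ 'd \<Rightarrow> complex" where
  "expansion a s = quot s (lookup a)"

lemma expansion:
  assumes "a \<in> A" "s \<in> den"
  shows "supported S (expansion a s)" "convolve s (expansion a s) = lookup a"
  using assms supported_quot convolve_quot unfolding expansion_def
  by (auto simp: supported_lookup semigroup_algebra_def)

lemma expansion_unique:
  assumes "a \<in> A" "s \<in> den" "supported S F" "convolve s F = lookup a"
  shows "expansion a s = F"
  by (rule convolve_den_inj[OF assms(2)]) (use assms expansion[of a s] in auto)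

text \<open>Both directions compare the two series after multiplication with the common denominator
  \<open>s * t\<close>, which is injective on series supported in \<open>S\<close>.\<close>

lemma expansion_eq_iff:
  assumes "a \<in> A" "s \<in> den" "b \<in> A" "t \<in> den"
  shows "expansion a s = expansion b t \<longleftrightarrow> a * t = b * s"
proof
  assume eq: "expansion a s = expansion b t"
  have "lookup (t * a) = convolve (t * s) (expansion a s)"
    using expansion assms by (simp add: convolve_mult convolve_lookup)
  also have "t * s = s * t" by (rule mult.commute)
  also have "convolve (s * t) (expansion a s) = lookup (s * b)"
    unfolding eq using expansion assms by (simp add: convolve_mult convolve_lookup)
  finally show "a * t = b * s" by (simp add: mult.commute)
next
  assume eq: "a * t = b * s"
  have st: "s * t \<in> den" using assms den_mult by auto
  have "convolve (s * t) (expansion b t) = lookup (s * b)"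
    using expansion assms by (simp add: convolve_mult convolve_lookup)
  also have "s * b = t * a" using eq by (simp add: mult.commute)
  also have "lookup (t * a) = convolve (t * s) (expansion a s)"
    using expansion assms by (simp add: convolve_mult convolve_lookup)
  also have "t * s = s * t" by (rule mult.commute)
  finally have "convolve (s * t) (expansion b t) = convolve (s * t) (expansion a s)" .
  then show "expansion a s = expansion b t"
    by (rule convolve_den_inj[OF st expansion(1) expansion(1), symmetric, OF assms(3,4,1,2)])
qed

lemma fraction_rel_iff:
  "((a, s), (b, t)) \<in> fraction_rel S \<longleftrightarrow> a \<in> A \<and> b \<in> A \<and> s \<in> den \<and> t \<in> den \<and> a * t = b * s"
proof -
  have "a * t = b * s" if u: "u \<in> den" "u * (a * t - b * s) = 0" and v: "a \<in> A" "b \<in> A" "s \<in> den"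
      "t \<in> den" for u
  proof -
    have "a * t - b * s \<in> A"
    proof -
      have "keys (a * t - b * s) \<subseteq> keys (a * t) \<union> keys (b * s)"
        by (rule keys_diff)
      then show ?thesis using A_closed(2)[of a t] A_closed(2)[of b s] v den_A
        by (auto simp: semigroup_algebra_def)
    qed
    then show ?thesis using den_cancel[OF u(1) _ u(2)] by simp
  qed
  moreover have "\<exists>u\<in>den. u * (a * t - b * s) = 0" if "a * t = b * s"
    using that den_one by auto
  ultimately show ?thesis unfolding fraction_rel_def denominators_eq by auto
qed

lemma frac_mem: "(b, t) \<in> frac S a s \<longleftrightarrow> a \<in> A \<and> b \<in> A \<and> s \<in> den \<and> t \<in> den \<and> a * t = b * s"
  unfolding frac_def by (simp add: fraction_rel_iff)

lemma frac_eq_iff: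
  assumes "a \<in> A" "s \<in> den" "b \<in> A" "t \<in> den"
  shows "frac S a s = frac S b t \<longleftrightarrow> a * t = b * s"
proof
  assume "frac S a s = frac S b t"
  moreover have "(b, t) \<in> frac S b t" using assms by (simp add: frac_mem)
  ultimately have "(b, t) \<in> frac S a s" by simp
  then show "a * t = b * s" by (simp add: frac_mem)
next
  assume "a * t = b * s"
  then have "expansion a s = expansion b t" using assms by (simp add: expansion_eq_iff)
  then have "(c, u) \<in> frac S a s \<longleftrightarrow> (c, u) \<in> frac S b t" for c u
    using assms expansion_eq_iff[of a s c u] expansion_eq_iff[of b t c u] by (auto simp: frac_mem)
  then show "frac S a s = frac S b t" by auto
qed

abbreviation "R \<equiv> local_ring S"

lemma carrier_R: "carrier R = {frac S a s | a s. a \<in> A \<and> s \<in> den}"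
  unfolding local_ring_def quotient_def frac_def denominators_eq by auto

lemma carrierE:
  assumes "x \<in> carrier R"
  obtains a s where "a \<in> A" "s \<in> den" "x = frac S a s"
  using assms unfolding carrier_R by auto

lemma frac_carrier [intro]: "a \<in> A \<Longrightarrow> s \<in> den \<Longrightarrow> frac S a s \<in> carrier R"
  unfolding carrier_R by auto

lemma zero_R: "\<zero>\<^bsub>R\<^esub> = frac S 0 1"
  by (simp add: local_ring_def)

text \<open>The operations of \<open>local_ring\<close> are unions over all representatives. Once
  the result is known to be independent of the representatives, the union collapses to it.\<close>

lemma UN_const_pairs:
  assumes "(a, s) \<in> P" "\<And>a s. (a, s) \<in> P \<Longrightarrow> f a s = c"
  shows "(\<Union>(a, s)\<in>P. f a s) = c"
  using assms by fastforce

lemma frac_add: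
  assumes "a \<in> A" "s \<in> den" "b \<in> A" "t \<in> den"
  shows "frac S a s \<oplus>\<^bsub>R\<^esub> frac S b t = frac S (a * t + b * s) (s * t)"
proof -
  have "frac S (a' * t' + b' * s') (s' * t') = frac S (a * t + b * s) (s * t)"
    if "(a', s') \<in> frac S a s" "(b', t') \<in> frac S b t" for a' s' b' t'
  proof (subst frac_eq_iff)
    have e: "a * s' = a' * s" "b * t' = b' * t" using that by (auto simp: frac_mem)
    have "(a' * t' + b' * s') * (s * t) = (a' * s) * (t' * t) + (b' * t) * (s' * s)"
      by (simp add: algebra_simps)
    also have "\<dots> = (a * s') * (t' * t) + (b * t') * (s' * s)" unfolding e ..
    also have "\<dots> = (a * t + b * s) * (s' * t')" by (simp add: algebra_simps)
    finally show "(a' * t' + b' * s') * (s * t) = (a * t + b * s) * (s' * t')" .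
  qed (use that assms A_closed den_A den_mult in \<open>auto simp: frac_mem\<close>)
  note eq = this
  have mem: "(a, s) \<in> frac S a s" "(b, t) \<in> frac S b t" using assms by (auto simp: frac_mem)
  have "frac S a s \<oplus>\<^bsub>R\<^esub> frac S b t =
      (\<Union>(a', s')\<in>frac S a s. \<Union>(b', t')\<in>frac S b t. frac S (a' * t' + b' * s') (s' * t'))"
    by (simp add: local_ring_def)
  also have "\<dots> = frac S (a * t + b * s) (s * t)"
    by (rule UN_const_pairs[OF mem(1)], rule UN_const_pairs[OF mem(2)], rule eq)
  finally show ?thesis .
qed

lemma frac_mult:
  assumes "a \<in> A" "s \<in> den" "b \<in> A" "t \<in> den"
  shows "frac S a s \<otimes>\<^bsub>R\<^esub> frac S b t = frac S (a * b) (s * t)"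
proof -
  have "frac S (a' * b') (s' * t') = frac S (a * b) (s * t)"
    if "(a', s') \<in> frac S a s" "(b', t') \<in> frac S b t" for a' s' b' t'
  proof (subst frac_eq_iff)
    have e: "a * s' = a' * s" "b * t' = b' * t" using that by (auto simp: frac_mem)
    have "(a' * b') * (s * t) = (a' * s) * (b' * t)" by (simp add: algebra_simps)
    also have "\<dots> = (a * s') * (b * t')" unfolding e ..
    also have "\<dots> = (a * b) * (s' * t')" by (simp add: algebra_simps)
    finally show "(a' * b') * (s * t) = (a * b) * (s' * t')" .
  qed (use that assms A_closed den_A den_mult in \<open>auto simp: frac_mem\<close>)
  note eq = this
  have mem: "(a, s) \<in> frac S a s" "(b, t) \<in> frac S b t" using assms by (auto simp: frac_mem)
  have "frac S a s \<otimes>\<^bsub>R\<^esub> frac S b t =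
      (\<Union>(a', s')\<in>frac S a s. \<Union>(b', t')\<in>frac S b t. frac S (a' * b') (s' * t'))"
    by (simp add: local_ring_def)
  also have "\<dots> = frac S (a * b) (s * t)"
    by (rule UN_const_pairs[OF mem(1)], rule UN_const_pairs[OF mem(2)], rule eq)
  finally show ?thesis .
qed

lemma frac_smult:
  assumes "a \<in> A" "s \<in> den"
  shows "c \<odot>\<^bsub>R\<^esub> frac S a s = frac S (single 0 c * a) s"
proof -
  have "frac S (single 0 c * a') s' = frac S (single 0 c * a) s"
    if "(a', s') \<in> frac S a s" for a' s'
  proof (subst frac_eq_iff)
    have "a * s' = a' * s" using that by (auto simp: frac_mem)
    then show "single 0 c * a' * s = single 0 c * a * s'" by (simp add: mult.assoc)
  qed (use that assms A_closed den_A den_mult in \<open>auto simp: frac_mem\<close>)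
  note eq = this
  have mem: "(a, s) \<in> frac S a s" using assms by (auto simp: frac_mem)
  have "c \<odot>\<^bsub>R\<^esub> frac S a s = (\<Union>(a', s')\<in>frac S a s. frac S (single 0 c * a') s')"
    by (simp add: local_ring_def)
  also have "\<dots> = frac S (single 0 c * a) s"
    by (rule UN_const_pairs[OF mem]) (rule eq)
  finally show ?thesis .
qed

text \<open>All representatives of a germ have the same expansion, by
  \<open>expansion_eq_iff\<close>, so the choice is harmless.\<close>

definition coeff :: "'d germ \<Rightarrow> int ^ 'd \<Rightarrow> complex" where
  "coeff x = (\<lambda>(a, s). expansion a s) (SOME p. p \<in> x)"

lemma coeff_frac: "a \<in> A \<Longrightarrow> s \<in> den \<Longrightarrow> coeff (frac S a s) = expansion a s"
proof -
  assume as: "a \<in> A" "s \<in> den"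
  define p where "p = (SOME p. p \<in> frac S a s)"
  have "(a, s) \<in> frac S a s" using as by (simp add: frac_mem)
  then have "p \<in> frac S a s" unfolding p_def by (rule someI)
  then obtain b t where "p = (b, t)" "a \<in> A" "b \<in> A" "s \<in> den" "t \<in> den" "a * t = b * s"
    by (cases p) (auto simp: frac_mem)
  then show ?thesis unfolding coeff_def using expansion_eq_iff[of a s b t] by (simp flip: p_def)
qed

lemma supported_coeff: "x \<in> carrier R \<Longrightarrow> supported S (coeff x)"
  by (elim carrierE) (simp add: coeff_frac expansion)

lemma coeff_inj: "x \<in> carrier R \<Longrightarrow> y \<in> carrier R \<Longrightarrow> coeff x = coeff y \<Longrightarrow> x = y"
  by (elim carrierE) (simp add: coeff_frac expansion_eq_iff frac_eq_iff)

lemma R_closed: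
  "x \<in> carrier R \<Longrightarrow> y \<in> carrier R \<Longrightarrow> x \<oplus>\<^bsub>R\<^esub> y \<in> carrier R"
  "x \<in> carrier R \<Longrightarrow> c \<odot>\<^bsub>R\<^esub> x \<in> carrier R"
  "\<zero>\<^bsub>R\<^esub> \<in> carrier R"
proof -
  show "x \<oplus>\<^bsub>R\<^esub> y \<in> carrier R" if "x \<in> carrier R" "y \<in> carrier R"
    using that by (elim carrierE) (auto simp: frac_add A_closed den_A den_mult)
  show "c \<odot>\<^bsub>R\<^esub> x \<in> carrier R" if "x \<in> carrier R"
    using that by (elim carrierE) (auto simp: frac_smult A_closed)
qed (auto simp: zero_R A_closed den_one)

lemma coeff_zero: "coeff \<zero>\<^bsub>R\<^esub> = (\<lambda>_. 0)"
  unfolding zero_R using A_closed den_one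
  by (simp add: coeff_frac) (rule expansion_unique; simp add: supported_def convolve_one fun_eq_iff)

lemma coeff_add:
  assumes "x \<in> carrier R" "y \<in> carrier R"
  shows "coeff (x \<oplus>\<^bsub>R\<^esub> y) = (\<lambda>m. coeff x m + coeff y m)"
proof -
  obtain a s b t where x: "a \<in> A" "s \<in> den" "x = frac S a s" and y: "b \<in> A" "t \<in> den" "y = frac S b t"
    using assms by (elim carrierE) blast
  let ?F = "expansion a s" and ?G = "expansion b t"
  have st: "convolve (s * t) ?F = lookup (a * t)"
    using x y by (simp add: expansion convolve_mult convolve_lookup mult.commute[of s])
  have ts: "convolve (s * t) ?G = lookup (b * s)"
    using x y by (simp add: expansion convolve_mult convolve_lookup mult.commute)
  have "supported S (\<lambda>m. ?F m + ?G m)"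
    using expansion(1)[OF x(1,2)] expansion(1)[OF y(1,2)] unfolding supported_def
      by (metis add.right_neutral)
  then have "expansion (a * t + b * s) (s * t) = (\<lambda>m. ?F m + ?G m)"
    using x y st ts
    by (intro expansion_unique) (auto simp: A_closed den_A den_mult convolve_fun_add lookup_add
        fun_eq_iff)
  then show ?thesis using x y by (simp add: frac_add coeff_frac A_closed den_A den_mult)
qed

lemma coeff_smult:
  assumes "x \<in> carrier R"
  shows "coeff (c \<odot>\<^bsub>R\<^esub> x) = (\<lambda>m. c * coeff x m)"
proof -
  obtain a s where x: "a \<in> A" "s \<in> den" "x = frac S a s" using assms by (elim carrierE)
  have "supported S (\<lambda>m. c * expansion a s m)"
    using expansion(1)[OF x(1,2)] unfolding supported_def by auto
  moreover have "lookup (single 0 c * a) = (\<lambda>m. c * lookup a m)"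
    by (rule ext) (simp add: convolve_single flip: convolve_lookup)
  ultimately have "expansion (single 0 c * a) s = (\<lambda>m. c * expansion a s m)"
    using x by (intro expansion_unique) (auto simp: A_closed expansion convolve_fun_scale)
  then show ?thesis using x by (simp add: frac_smult coeff_frac A_closed)
qed

section \<open>Monomial ideals and powers of the maximal ideal\<close>

definition germs_in :: "(int ^ 'd) set \<Rightarrow> 'd germ set" where
  "germs_in I = {x \<in> carrier R. supported I (coeff x)}"

text \<open>Multiplying or dividing by a denominator keeps the support inside the monoid ideal, so
  membership of a germ can be read off from any numerator.\<close>

lemma frac_germs_in:
  assumes "monoid_ideal I" "a \<in> A" "s \<in> den"
  shows "frac S a s \<in> germs_in I \<longleftrightarrow> keys a \<subseteq> I"
proof -
  have "supported I (expansion a s) \<longleftrightarrow> supported I (lookup a)"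
    using supported_convolve_den[OF assms(3,1) expansion(1)[OF assms(2,3)]]
      supported_convolve[OF assms(1), of s "expansion a s"] assms
    by (auto simp: expansion den_def)
  then show ?thesis unfolding germs_in_def using assms by (auto simp: coeff_frac supported_lookup)
qed

lemma germs_in_S: "germs_in S = carrier R"
  unfolding germs_in_def using supported_coeff by auto

lemma germs_in_closed:
  "x \<in> germs_in I \<Longrightarrow> y \<in> germs_in I \<Longrightarrow> x \<oplus>\<^bsub>R\<^esub> y \<in> germs_in I"
  "x \<in> germs_in I \<Longrightarrow> c \<odot>\<^bsub>R\<^esub> x \<in> germs_in I"
  "\<zero>\<^bsub>R\<^esub> \<in> germs_in I"
proof -
  show "x \<oplus>\<^bsub>R\<^esub> y \<in> germs_in I" if "x \<in> germs_in I" "y \<in> germs_in I"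
    using that unfolding germs_in_def by (auto simp: R_closed coeff_add supported_def) (metis
        add.right_neutral)
qed (auto simp: germs_in_def R_closed coeff_smult coeff_zero supported_def)

lemma max_ideal_eq: "max_ideal S = germs_in (deg_ge 1)"
proof -
  have eq: "keys a \<subseteq> deg_ge 1 \<longleftrightarrow> lookup a 0 = 0" if "a \<in> A" for a
    using that unfolding deg_ge_1 by (auto simp: semigroup_algebra_def in_keys_iff)
  show ?thesis
  proof (intro equalityI subsetI)
    fix x assume "x \<in> max_ideal S"
    then obtain a s where "a \<in> A" "s \<in> den" "eval_at (origin S) a = 0" "x = frac S a s"
      unfolding max_ideal_def denominators_eq by auto
    then show "x \<in> germs_in (deg_ge 1)" using eq
      by (simp add: frac_germs_in monoid_ideal_deg_ge eval_origin)
  next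
    fix x assume x: "x \<in> germs_in (deg_ge 1)"
    then obtain a s where as: "a \<in> A" "s \<in> den"
        "x = frac S a s" unfolding germs_in_def by (auto elim: carrierE)
    then have "eval_at (origin S) a = 0" using x eq
      by (simp add: frac_germs_in monoid_ideal_deg_ge eval_origin)
    then show "x \<in> max_ideal S" using as unfolding max_ideal_def denominators_eq by auto
  qed
qed

text \<open>For the inclusion of the right side, the numerator is broken into monomials, and each
  exponent is split into one of degree at least \<open>k\<close> and a nonzero one. The denominator
  goes with the first factor.\<close>

lemma ideal_prod_germs_in:
  "ideal_prod R (germs_in (deg_ge k)) (germs_in (deg_ge 1)) = germs_in (deg_ge (Suc k))" (is "?P = _")
proof (intro equalityI subsetI)
  fix x assume "x \<in> ?P"
  then show "x \<in> germs_in (deg_ge (Suc k))"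
  proof induction
    case (prod i j)
    then obtain a s b t where i: "a \<in> A" "s \<in> den" "i = frac S a s" and j: "b \<in> A" "t \<in> den"
        "j = frac S b t"
      unfolding germs_in_def by (auto elim!: carrierE)
    have "keys a \<subseteq> deg_ge k" "keys b \<subseteq> S - {0}"
      using prod i j frac_germs_in monoid_ideal_deg_ge deg_ge_1 by auto
    then have "keys (a * b) \<subseteq> deg_ge (Suc k)"
      using keys_mult[of a b] deg_ge_add by blast
    then show ?case using i j by (simp add: frac_mult frac_germs_in monoid_ideal_deg_ge A_closed
        den_mult)
  next
    case (sum s1 s2)
    then show ?case by (intro germs_in_closed)
  qed
next
  fix x assume x: "x \<in> germs_in (deg_ge (Suc k))"
  then obtain a s where as: "a \<in> A" "s \<in> den"
      "x = frac S a s" unfolding germs_in_def by (auto elim: carrierE)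
  have keys: "keys a \<subseteq> deg_ge (Suc k)" using x as by (simp add: frac_germs_in monoid_ideal_deg_ge)
  have dS: "deg_ge j \<subseteq> S" for j using monoid_ideal_deg_ge by (auto simp: monoid_ideal_def)
  have "frac S (\<Sum>m\<in>K. single m (lookup a m)) s \<in> ?P \<and>
      (\<Sum>m\<in>K. single m (lookup a m)) \<in> A" if "finite K" "K \<subseteq> deg_ge (Suc k)" for K
    using that
  proof (induction K rule: finite_induct)
    case empty
    \<comment> \<open>\<open>ideal_prod\<close> is generated by products under addition, so the
      empty sum has to be exhibited as a product.\<close>
    have "frac S 0 1 \<otimes>\<^bsub>R\<^esub> frac S 0 1 \<in> ?P"
      by (rule ideal_prod.prod) (auto simp: frac_germs_in monoid_ideal_deg_ge A_closed den_one)
    moreover have "frac S 0 1 \<otimes>\<^bsub>R\<^esub> frac S 0 1 = frac S 0 s"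
      using as by (simp add: frac_mult A_closed den_one frac_eq_iff)
    ultimately show ?case by (simp add: A_closed)
  next
    case (insert m K)
    obtain p q where pq: "p \<in> deg_ge k" "q \<in> S - {0}"
        "m = p + q" using insert.prems deg_ge_Suc_cases by blast
    let ?c = "lookup a m"
    have pqA: "single p ?c \<in> A" "single q 1 \<in> A" "single m ?c \<in> A"
      using pq dS insert.prems by (auto simp: semigroup_algebra_def)
    have "frac S (single p ?c) s \<otimes>\<^bsub>R\<^esub> frac S (single q 1) 1 \<in> ?P"
    proof (rule ideal_prod.prod)
      show "frac S (single p ?c) s \<in> germs_in (deg_ge k)"
        using pq(1) pqA(1) as(2) by (simp add: frac_germs_in monoid_ideal_deg_ge)
      have "keys (single q (1::complex)) \<subseteq> deg_ge 1"
        unfolding deg_ge_1 using pq(2) by simp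
      then show "frac S (single q 1) 1 \<in> germs_in (deg_ge 1)"
        unfolding frac_germs_in[OF monoid_ideal_deg_ge pqA(2) den_one] .
    qed
    also have "frac S (single p ?c) s \<otimes>\<^bsub>R\<^esub> frac S (single q 1) 1 = frac S (single m ?c) s"
      using pqA as den_one pq(3) by (simp add: frac_mult mult_single)
    finally have 1: "frac S (single m ?c) s \<in> ?P" .
    let ?b = "\<Sum>m\<in>K. single m (lookup a m)"
    have 2: "frac S ?b s \<in> ?P" "?b \<in> A" using insert by auto
    have "frac S (single m ?c) s \<oplus>\<^bsub>R\<^esub> frac S ?b s = frac S (single m ?c + ?b) s"
      using pqA 2 as den_A by (simp add: frac_add frac_eq_iff A_closed den_mult algebra_simps)
    then have "frac S (single m ?c + ?b) s \<in> ?P"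
      using ideal_prod.sum[OF 1 2(1)] by simp
    then show ?case using insert(1,2) pqA 2 by (simp add: A_closed)
  qed
  from this[OF _ keys] have "frac S (\<Sum>m\<in>keys a. single m (lookup a m)) s \<in> ?P" by simp
  moreover have "(\<Sum>m\<in>keys a. single m (lookup a m)) = a"
    by (rule poly_mapping_eqI) (simp add: lookup_sum lookup_single when_def in_keys_iff)
  ultimately show "x \<in> ?P" using as by simp
qed

lemma jet_ideal_eq: "jet_ideal S k = germs_in (deg_ge (Suc k))"
proof -
  have "deg_ge 0 = S"
  proof (intro equalityI subsetI)
    fix m assume "m \<in> S"
    then show "m \<in> deg_ge 0"
      unfolding deg_ge_def by (intro CollectI exI[of _ "if m = 0 then [] else [m]"]) auto
  qed (use monoid_ideal_deg_ge in \<open>auto simp: monoid_ideal_def\<close>)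
  then have "max_ideal S [^]\<^bsub>ideals_set R\<^esub> (0::nat) = germs_in (deg_ge 0)"
    by (simp add: nat_pow_def ideals_set_def germs_in_S)
  then have "max_ideal S [^]\<^bsub>ideals_set R\<^esub> n = germs_in (deg_ge n)" for n :: nat
  proof (induction n)
    case (Suc n)
    then show ?case using ideal_prod_germs_in[of n]
      by (simp add: nat_pow_def ideals_set_def max_ideal_eq)
  qed
  then show ?thesis unfolding jet_ideal_def .
qed

section \<open>Valuations and the filtration\<close>

lemma le_monomial_val: "a \<noteq> 0 \<Longrightarrow> v \<le> monomial_val n a \<longleftrightarrow> (\<forall>m\<in>keys a. v \<le> pairing m n)"
  unfolding monomial_val_def by (subst Min_ge_iff) auto

text \<open>The constant term has value 0 and no exponent in \<open>S\<close> has a negative one.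
  Hence \<open>germ_val\<close> is the value of the numerator.\<close>

lemma monomial_val_den: "s \<in> den \<Longrightarrow> monomial_val (\<nu> i) s = 0"
proof -
  assume s: "s \<in> den"
  then have s0: "0 \<in> keys s" "keys s \<subseteq> S" by (auto simp: den_def in_keys_iff)
  then have nz: "s \<noteq> 0" by auto
  have "0 \<le> monomial_val (\<nu> i) s"
    using nz s0 pairing_nonneg by (subst le_monomial_val) auto
  moreover have "\<forall>m\<in>keys s. monomial_val (\<nu> i) s \<le> pairing m (\<nu> i)"
    using le_monomial_val[OF nz] by blast
  then have "monomial_val (\<nu> i) s \<le> 0" using s0 by auto
  ultimately show ?thesis by simp
qed

text \<open>Stated through lower bounds because the exponents with pairing at least \<open>v\<close>
  form a monoid ideal, so the bound passes between a numerator and the expansion of the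
  germ.\<close>

lemma le_germ_val:
  assumes x: "x \<in> carrier R" "x \<noteq> \<zero>\<^bsub>R\<^esub>"
  shows "v \<le> germ_val (\<nu> i) x \<longleftrightarrow> supported {m \<in> S. v \<le> pairing m (\<nu> i)} (coeff x)"
proof -
  have key: "v \<le> monomial_val (\<nu> i) b \<longleftrightarrow> supported {m \<in> S. v \<le> pairing m (\<nu> i)} (coeff x)"
    if b: "(b, t) \<in> x" for b t v
  proof -
    obtain a s where as: "a \<in> A" "s \<in> den" "x = frac S a s" using x by (elim carrierE)
    have bt: "b \<in> A" "t \<in> den" "x = frac S b t" using b as frac_eq_iff[of a s b t]
      by (auto simp: frac_mem)
    have "b \<noteq> 0"
    proof
      assume "b = 0"
      then have "x = \<zero>\<^bsub>R\<^esub>" using bt frac_eq_iff[of 0 t 0 1] A_closed(4) den_one by (simp add: zero_R)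
      then show False using x(2) by simp
    qed
    then have "v \<le> monomial_val (\<nu> i) b \<longleftrightarrow> keys b \<subseteq> {m \<in> S. v \<le> pairing m (\<nu> i)}"
      using bt(1) by (auto simp: le_monomial_val semigroup_algebra_def)
    also have "\<dots> \<longleftrightarrow> supported {m \<in> S. v \<le> pairing m (\<nu> i)} (coeff x)"
      using frac_germs_in[OF monoid_ideal_val1 bt(1,2), of v i] x(1)
        by (auto simp: bt(3)[symmetric] germs_in_def)
    finally show ?thesis .
  qed
  obtain a s where as: "a \<in> A" "s \<in> den" "x = frac S a s" using x by (elim carrierE)
  then have mem: "(a, s) \<in> x" by (simp add: frac_mem)
  have "germ_val (\<nu> i) x = monomial_val (\<nu> i) a"
    unfolding germ_val_def
  proof (rule the_equality)
    show "\<exists>(a', s)\<in>x. monomial_val (\<nu> i) a = monomial_val (\<nu> i) a' - monomial_val (\<nu> i) s"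
      using mem as monomial_val_den by (intro bexI[of _ "(a, s)"]) auto
    fix w assume "\<exists>(a, s)\<in>x. w = monomial_val (\<nu> i) a - monomial_val (\<nu> i) s"
    then obtain b t where bt: "(b, t) \<in> x" "w = monomial_val (\<nu> i) b - monomial_val (\<nu> i) t" by auto
    then have "t \<in> den" using as by (simp add: frac_mem)
    then have w: "w = monomial_val (\<nu> i) b" using bt monomial_val_den by simp
    \<comment> \<open>Two integers with the same lower bounds are equal, and by \<open>key\<close>
      the lower bounds do not depend on the representative.\<close>
    show "w = monomial_val (\<nu> i) a"
      unfolding w using key[OF bt(1)] key[OF mem] by (meson order_antisym order_refl)
  qed
  then show ?thesis using key[OF mem] by simp
qed

lemma filtration_eq: "filtration S \<nu> v = germs_in {m \<in> S. \<forall>i. v $ i \<le> pairing m (\<nu> i)}"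
proof -
  have "(\<forall>i. v $ i \<le> germ_val (\<nu> i) x) \<longleftrightarrow> supported {m \<in> S. \<forall>i. v $ i \<le> pairing m (\<nu> i)} (coeff x)"
    if "x \<in> carrier R" "x \<noteq> \<zero>\<^bsub>R\<^esub>" for x
    unfolding le_germ_val[OF that] supported_def by auto
  note key = this
  show ?thesis
  proof (rule Set.set_eqI)
    fix x
    show "x \<in> filtration S \<nu> v \<longleftrightarrow> x \<in> germs_in {m \<in> S. \<forall>i. v $ i \<le> pairing m (\<nu> i)}"
    proof (cases "x = \<zero>\<^bsub>R\<^esub>")
      case True
      then show ?thesis unfolding filtration_def using germs_in_closed(3) by (simp add: R_closed)
    next
      case False
      then show ?thesis unfolding filtration_def germs_in_def mem_Collect_eq using key by blast
    qed
  qed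
qed

end

section \<open>Quotients of spaces of germs\<close>

abbreviation "KC \<equiv> (ring_of_type_algebra :: complex ring)"

lemma KC_simps [simp]:
  "carrier KC = UNIV" "a \<otimes>\<^bsub>KC\<^esub> b = a * b" "a \<oplus>\<^bsub>KC\<^esub> b = a + b" "\<one>\<^bsub>KC\<^esub> = 1" "\<zero>\<^bsub>KC\<^esub> = 0"
  by (simp_all add: ring_of_type_algebra_def)

context coordinates
begin

text \<open>Every axiom is an identity of vectors, checked coordinate by coordinate.\<close>

lemma vectorspace: "vectorspace KC V"
proof (rule vectorspace.intro)
  have inv: "\<exists>y\<in>carrier V. y \<oplus> x = \<zero>" if "x \<in> carrier V" for x
    using that by (intro bexI[of _ "(-1) \<odot> x"] coord_inj)
      (auto simp: add_closed smult_closed zero_closed coord_add coord_smult coord_zero)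
  have "abelian_group V"
    by (rule abelian_groupI, simp_all only: add_closed zero_closed inv)
       (rule coord_inj; simp add: add_closed smult_closed zero_closed coord_add coord_smult
           coord_zero algebra_simps)+
  then show "Module.module KC V"
    by (intro moduleI cring_from_type_algebra)
       (simp_all add: smult_closed, (rule coord_inj; simp add: add_closed smult_closed coord_add
           coord_smult algebra_simps)+)
qed (rule field_from_type_algebra)

definition basis_vec :: "'m \<Rightarrow> 'a" where
  "basis_vec m = vec (\<lambda>k. if k = m then 1 else 0)"

lemma basis_vec: "basis_vec m \<in> carrier V" "k \<in> T \<Longrightarrow> l k (basis_vec m) = (if k = m then 1 else 0)"
  by (simp_all add: basis_vec_def vec)

text \<open>The vectors dual to the coordinates form a basis: evaluating the coordinate
  \<open>m\<close> isolates the coefficient at \<open>basis_vec m\<close> in any linear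
  combination.\<close>

lemma complex_dim_eq: "complex_dim V = card T"
proof -
  interpret vs: vectorspace KC V by (rule vectorspace)
  have inj: "inj_on basis_vec T"
  proof (rule inj_onI)
    fix m k assume "m \<in> T" "k \<in> T" "basis_vec m = basis_vec k"
    then show "m = k" using basis_vec(2)[of m m] basis_vec(2)[of m k] by (auto split: if_splits)
  qed
  let ?B = "basis_vec ` T"
  have B: "?B \<subseteq> carrier V" "finite ?B" using basis_vec finite_T by auto
  have coord_lincomb: "l k (vs.lincomb a A) = (\<Sum>b\<in>A. a b * l k b)"
    if "k \<in> T" "finite A" "A \<subseteq> carrier V" for k a A
    using that(2,3)
  proof (induction A rule: finite_induct)
    case empty
    then show ?case using coord_zero[OF that(1)] by (simp add: vs.lincomb_def)
  next
    case (insert x A)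
    have "vs.lincomb a (insert x A) = a x \<odot> x \<oplus> vs.lincomb a A"
      unfolding vs.lincomb_def using insert smult_closed by (intro vs.finsum_insert) auto
    moreover have "vs.lincomb a A \<in> carrier V" using insert by (intro vs.lincomb_closed) auto
    ultimately show ?case using insert that(1) by (simp add: coord_add coord_smult smult_closed)
  qed
  have "vs.lin_indpt ?B"
  proof
    assume "vs.lin_dep ?B"
    then obtain A a v where A: "finite A" "A \<subseteq> ?B" "vs.lincomb a A = \<zero>" "v \<in> A" "a v \<noteq> 0"
      unfolding vs.lin_dep_def by auto
    obtain m where m: "m \<in> T" "v = basis_vec m" using A by auto
    have "0 = (\<Sum>b\<in>A. a b * l m b)"
      using coord_lincomb[of m A a] A B m coord_zero by auto
    also have "\<dots> = (\<Sum>b\<in>A. if b = v then a v else 0)"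
    proof (rule sum.cong)
      fix b assume "b \<in> A"
      then obtain k where "k \<in> T" "b = basis_vec k" using A by auto
      then show "a b * l m b = (if b = v then a v else 0)"
        using m inj by (auto simp: basis_vec inj_on_def)
    qed simp
    also have "\<dots> = a v" using A by simp
    finally show False using A by simp
  qed
  moreover have "vs.span ?B = carrier V"
  proof (intro equalityI subsetI)
    fix x assume "x \<in> vs.span ?B"
    then show "x \<in> carrier V" using vs.span_closed[OF B(1)] by blast
  next
    fix x assume x: "x \<in> carrier V"
    define a where "a = (\<lambda>b. l (the_inv_into T basis_vec b) x)"
    have a: "a (basis_vec m) = l m x" if "m \<in> T" for m
      using that inj by (simp add: a_def the_inv_into_f_f)
    have "l k (vs.lincomb a ?B) = l k x" if k: "k \<in> T" for k
    proof -
      have "l k (vs.lincomb a ?B) = (\<Sum>m\<in>T. a (basis_vec m) * l k (basis_vec m))"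
        using coord_lincomb[OF k B(2,1)] inj by (simp add: sum.reindex)
      also have "\<dots> = (\<Sum>m\<in>T. if m = k then l k x else 0)"
        using k by (intro sum.cong) (auto simp: a basis_vec)
      finally show ?thesis using k finite_T by simp
    qed
    then have "vs.lincomb a ?B = x"
      using B x by (intro coord_inj vs.lincomb_closed) auto
    then show "x \<in> vs.span ?B" unfolding vs.span_def using B by auto
  qed
  ultimately have "vs.dim = card ?B" using B by (intro vs.dim_basis) (auto simp: vs.basis_def)
  then show ?thesis using inj by (simp add: complex_dim_def card_image)
qed

end

context toric
begin

context
  fixes I J :: "(int ^ 'd) set"
  assumes IJ: "J \<subseteq> I" "I \<subseteq> S" "finite (I - J)"
begin

abbreviation "V \<equiv> R\<lparr>carrier := germs_in I\<rparr>"

text \<open>A coset in explicit form. Since \<open>I\<close> and \<open>J\<close> are arbitrary up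
  to finiteness of \<open>I - J\<close>, the same construction covers the graded pieces of the
  filtration and, with \<open>I = S\<close>, the jet spaces.\<close>

definition germ_class :: "'d germ \<Rightarrow> 'd germ set" where
  "germ_class x = {y \<in> germs_in I. \<forall>m\<in>I - J. coeff y m = coeff x m}"

lemma germs_in_carrier: "x \<in> germs_in I \<Longrightarrow> x \<in> carrier R"
  by (simp add: germs_in_def)

lemma germs_sub:
  assumes "x \<in> germs_in I" "y \<in> germs_in I"
  defines "h \<equiv> y \<oplus>\<^bsub>R\<^esub> (-1) \<odot>\<^bsub>R\<^esub> x"
  shows "h \<in> germs_in I" "coeff h = (\<lambda>m. coeff y m - coeff x m)" "h \<oplus>\<^bsub>R\<^esub> x = y" "x \<oplus>\<^bsub>R\<^esub> h = y"
proof -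
  note c = germs_in_carrier[OF assms(1)] germs_in_carrier[OF assms(2)]
  show "h \<in> germs_in I" unfolding h_def using assms by (intro germs_in_closed)
  then have hc: "h \<in> carrier R" by (rule germs_in_carrier)
  show ch: "coeff h = (\<lambda>m. coeff y m - coeff x m)"
    unfolding h_def using c by (simp add: coeff_add coeff_smult R_closed)
  show "h \<oplus>\<^bsub>R\<^esub> x = y" "x \<oplus>\<^bsub>R\<^esub> h = y"
    using c hc ch by (intro coeff_inj; simp add: R_closed coeff_add)+
qed

lemma coset_germ_class:
  assumes x: "x \<in> germs_in I"
  shows "germs_in J +>\<^bsub>V\<^esub> x = germ_class x"
proof (intro equalityI subsetI)
  fix y assume "y \<in> germs_in J +>\<^bsub>V\<^esub> x"
  then obtain h where h: "h \<in> germs_in J" "y = h \<oplus>\<^bsub>R\<^esub> x" unfolding a_r_coset_def' by auto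
  then have hI: "h \<in> germs_in I" using IJ by (auto simp: germs_in_def supported_def)
  have "coeff y m = coeff x m" if "m \<in> I - J" for m
    using h x that unfolding h(2) germs_in_def by (auto simp: coeff_add supported_def)
  then show "y \<in> germ_class x" using h hI x germs_in_closed by (auto simp: germ_class_def)
next
  fix y assume y: "y \<in> germ_class x"
  then have yI: "y \<in> germs_in I" by (simp add: germ_class_def)
  note h = germs_sub[OF x yI]
  define k where "k = y \<oplus>\<^bsub>R\<^esub> (-1) \<odot>\<^bsub>R\<^esub> x"
  have k: "k \<in> germs_in I" "\<And>m. coeff k m = coeff y m - coeff x m" "k \<oplus>\<^bsub>R\<^esub> x = y"
    using h by (simp_all add: k_def)
  have "m \<in> J" if "coeff k m \<noteq> 0" for m
  proof (rule ccontr)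
    assume "m \<notin> J"
    then have "m \<in> I - J" using k(1) that by (auto simp: germs_in_def supported_def)
    then show False using y k(2)[of m] that by (auto simp: germ_class_def)
  qed
  then have "k \<in> germs_in J" using k(1) by (auto simp: germs_in_def supported_def)
  then show "y \<in> germs_in J +>\<^bsub>V\<^esub> x" unfolding a_r_coset_def' using k(3) by (intro UN_I[of k]) auto
qed

abbreviation "Q \<equiv> quotient_space V (germs_in J)"

lemma carrier_Q: "carrier Q = germ_class ` germs_in I"
  unfolding quotient_space_def FactRing_def A_RCOSETS_def' using coset_germ_class by auto

lemma zero_Q: "\<zero>\<^bsub>Q\<^esub> = germ_class \<zero>\<^bsub>R\<^esub>"
  unfolding quotient_space_def FactRing_def germ_class_def germs_in_def
  using IJ by (auto simp: coeff_zero supported_def)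

lemma add_Q:
  assumes x: "x \<in> germs_in I" and y: "y \<in> germs_in I"
  shows "germ_class x \<oplus>\<^bsub>Q\<^esub> germ_class y = germ_class (x \<oplus>\<^bsub>R\<^esub> y)"
proof -
  have "germ_class x \<oplus>\<^bsub>Q\<^esub> germ_class y = (\<Union>h\<in>germ_class x. \<Union>k\<in>germ_class y. {h \<oplus>\<^bsub>R\<^esub> k})"
    unfolding quotient_space_def FactRing_def by (simp add: set_add_def')
  also have "\<dots> = germ_class (x \<oplus>\<^bsub>R\<^esub> y)"
  proof (intro equalityI subsetI)
    fix z assume "z \<in> (\<Union>h\<in>germ_class x. \<Union>k\<in>germ_class y. {h \<oplus>\<^bsub>R\<^esub> k})"
    then obtain h k where "h \<in> germ_class x" "k \<in> germ_class y" "z = h \<oplus>\<^bsub>R\<^esub> k" by auto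
    then show "z \<in> germ_class (x \<oplus>\<^bsub>R\<^esub> y)"
      using x y by (auto simp: germ_class_def germs_in_closed coeff_add germs_in_carrier)
  next
    fix z assume z: "z \<in> germ_class (x \<oplus>\<^bsub>R\<^esub> y)"
    then have zI: "z \<in> germs_in I" by (simp add: germ_class_def)
    note h = germs_sub[OF x zI]
    have "z \<oplus>\<^bsub>R\<^esub> (-1) \<odot>\<^bsub>R\<^esub> x \<in> germ_class y"
      using h(1,2) z x y by (auto simp: germ_class_def coeff_add germs_in_carrier)
    moreover have "x \<in> germ_class x" using x by (simp add: germ_class_def)
    ultimately show "z \<in> (\<Union>h\<in>germ_class x. \<Union>k\<in>germ_class y. {h \<oplus>\<^bsub>R\<^esub> k})"
      using h(4) by (intro UN_I) auto
  qed
  finally show ?thesis .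
qed

lemma smult_Q:
  assumes x: "x \<in> germs_in I"
  shows "c \<odot>\<^bsub>Q\<^esub> germ_class x = germ_class (c \<odot>\<^bsub>R\<^esub> x)"
proof -
  have "c \<odot>\<^bsub>Q\<^esub> germ_class x = (\<Union>a\<in>germ_class x. germs_in J +>\<^bsub>V\<^esub> (c \<odot>\<^bsub>R\<^esub> a))"
    unfolding quotient_space_def by simp
  also have "\<dots> = (\<Union>a\<in>germ_class x. germ_class (c \<odot>\<^bsub>R\<^esub> x))"
  proof (intro SUP_cong refl)
    fix a assume a: "a \<in> germ_class x"
    then have aI: "a \<in> germs_in I" by (simp add: germ_class_def)
    have "germs_in J +>\<^bsub>V\<^esub> (c \<odot>\<^bsub>R\<^esub> a) = germ_class (c \<odot>\<^bsub>R\<^esub> a)"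
      using aI by (intro coset_germ_class germs_in_closed)
    also have "\<dots> = germ_class (c \<odot>\<^bsub>R\<^esub> x)"
      using a aI x by (auto simp: germ_class_def coeff_smult germs_in_carrier)
    finally show "germs_in J +>\<^bsub>V\<^esub> (c \<odot>\<^bsub>R\<^esub> a) = germ_class (c \<odot>\<^bsub>R\<^esub> x)" .
  qed
  also have "\<dots> = germ_class (c \<odot>\<^bsub>R\<^esub> x)"
  proof -
    have "x \<in> germ_class x" using x by (simp add: germ_class_def)
    then show ?thesis by auto
  qed
  finally show ?thesis .
qed

definition class_coeff :: "int ^ 'd \<Rightarrow> 'd germ set \<Rightarrow> complex" where
  "class_coeff m C = coeff (SOME x. x \<in> C) m"

lemma class_coeff:
  assumes "x \<in> germs_in I" "m \<in> I - J"
  shows "class_coeff m (germ_class x) = coeff x m"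
proof -
  have "x \<in> germ_class x" using assms by (simp add: germ_class_def)
  then have "(SOME y. y \<in> germ_class x) \<in> germ_class x" by (rule someI)
  then show ?thesis using assms unfolding class_coeff_def by (simp add: germ_class_def)
qed

lemma germ_class_eq_iff:
  assumes "x \<in> germs_in I" "y \<in> germs_in I"
  shows "germ_class x = germ_class y \<longleftrightarrow> (\<forall>m\<in>I - J. coeff x m = coeff y m)"
  using assms unfolding germ_class_def by auto

definition poly_germ :: "(int ^ 'd \<Rightarrow> complex) \<Rightarrow> 'd germ" where
  "poly_germ c = frac S (\<Sum>m\<in>I - J. single m (c m)) 1"

lemma poly_germ:
  "poly_germ c \<in> germs_in I" "coeff (poly_germ c) m = (if m \<in> I - J then c m else 0)"
proof -
  let ?a = "\<Sum>m\<in>I - J. single m (c m)"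
  have lk: "lookup ?a m = (if m \<in> I - J then c m else 0)" for m
    using IJ(3) by (simp add: lookup_sum lookup_single when_def)
  have keys: "keys ?a \<subseteq> I"
  proof
    fix m assume "m \<in> keys ?a"
    then have "lookup ?a m \<noteq> 0" by (rule in_keys_iff[THEN iffD1])
    then show "m \<in> I" unfolding lk by (simp split: if_splits)
  qed
  then have aA: "?a \<in> A" using IJ by (auto simp: semigroup_algebra_def)
  have "expansion ?a 1 = lookup ?a"
    using aA by (intro expansion_unique den_one) (auto simp: supported_lookup semigroup_algebra_def
        convolve_one)
  then have c: "coeff (poly_germ c) = lookup ?a"
    unfolding poly_germ_def using aA by (simp add: coeff_frac den_one)
  then show "coeff (poly_germ c) m = (if m \<in> I - J then c m else 0)" by (simp add: lk)
  have "poly_germ c \<in> carrier R" unfolding poly_germ_def using aA den_one by (rule frac_carrier)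
  then show "poly_germ c \<in> germs_in I"
    unfolding germs_in_def mem_Collect_eq c supported_lookup using keys by (rule conjI)
qed

text \<open>The coefficients at the exponents in \<open>I - J\<close> determine a class and can be
  prescribed at will by a polynomial. Dimensions and projective topology of the quotient are then
  available from the coordinates.\<close>

lemma coordinates_Q: "coordinates Q (I - J) class_coeff"
proof
  show "finite (I - J)" by (rule IJ)
  show "class_coeff m \<in> linear_forms Q" if "m \<in> I - J" for m
    unfolding linear_forms_def carrier_Q using that
    by (auto simp: add_Q smult_Q class_coeff germs_in_closed coeff_add coeff_smult germs_in_carrier
        simp del: Diff_iff)
  show "x = y" if xy: "x \<in> carrier Q" "y \<in> carrier Q"
      and eq: "\<And>m. m \<in> I - J \<Longrightarrow> class_coeff m x = class_coeff m y" for x y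
  proof -
    obtain a b where "x = germ_class a" "a \<in> germs_in I" "y = germ_class b" "b \<in> germs_in I"
      using xy by (auto simp: carrier_Q)
    then show ?thesis using eq by (simp add: germ_class_eq_iff class_coeff del: Diff_iff)
  qed
  show "\<exists>x\<in>carrier Q. \<forall>m\<in>I - J. class_coeff m x = c m" for c
    unfolding carrier_Q by (intro bexI[of _ "germ_class (poly_germ c)"])
      (auto simp: class_coeff poly_germ simp del: Diff_iff)
qed (auto simp: carrier_Q zero_Q add_Q smult_Q germs_in_closed class_coeff coeff_zero simp del:
    Diff_iff)

end

lemma complex_dim_quotient:
  assumes "J \<subseteq> I" "I \<subseteq> S" "finite (I - J)"
  shows "complex_dim (quotient_space (R\<lparr>carrier := germs_in I\<rparr>) (germs_in J)) = card (I - J)"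
  using coordinates.complex_dim_eq[OF coordinates_Q[OF assms]] .

text \<open>An exponent in the difference has \<open>pairing m (\<nu> i) \<le> v $ i\<close> for
  some \<open>i\<close>, so the difference is finite and the dimension is its cardinality.\<close>

lemma dim_series_eq:
  "dim_series S \<nu> v = int (card {m \<in> S. (\<forall>i. v $ i \<le> pairing m (\<nu> i))
      \<and> \<not> (\<forall>i. v $ i + 1 \<le> pairing m (\<nu> i))})"
proof -
  let ?I = "{m \<in> S. \<forall>i. v $ i \<le> pairing m (\<nu> i)}" and ?J = "{m \<in> S. \<forall>i. (v + 1) $ i \<le> pairing m (\<nu> i)}"
  have v1: "(v + 1) $ i = v $ i + 1" for i by simp
  have sub: "?J \<subseteq> ?I"
  proof
    fix m assume m: "m \<in> ?J"
    have "v $ i \<le> pairing m (\<nu> i)" for i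
    proof -
      have "(v + 1) $ i \<le> pairing m (\<nu> i)" using m by blast
      then show ?thesis unfolding v1 by linarith
    qed
    then show "m \<in> ?I" using m by blast
  qed
  have "?I - ?J \<subseteq> (\<Union>i. {m \<in> S. pairing m (\<nu> i) \<le> v $ i})"
  proof
    fix m assume m: "m \<in> ?I - ?J"
    then obtain i where "\<not> (v + 1) $ i \<le> pairing m (\<nu> i)" by auto
    then have "pairing m (\<nu> i) \<le> v $ i" unfolding v1 by linarith
    then show "m \<in> (\<Union>i. {m \<in> S. pairing m (\<nu> i) \<le> v $ i})" using m by auto
  qed
  then have fin: "finite (?I - ?J)" by (rule finite_subset) (simp add: finite_pairing_le)
  have "dim_series S \<nu> v = int (card (?I - ?J))"
    unfolding dim_series_def filtration_eq by (subst complex_dim_quotient[OF sub _ fin]) auto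
  also have "?I - ?J = {m \<in> S. (\<forall>i. v $ i \<le> pairing m (\<nu> i)) \<and> \<not> (\<forall>i. v $ i + 1 \<le> pairing m (\<nu> i))}"
    unfolding v1 by auto
  finally show ?thesis .
qed

end

section \<open>The Poincare series\<close>

lemma laurent_mult_convolve: "laurent_mult p F = convolve p F"
  by (simp add: laurent_mult_def convolve_def)

lemma convolve_shift: "convolve p (\<lambda>v. F (v + u)) v = convolve p F (v + u)"
  by (simp add: convolve_def algebra_simps)

lemma prod_tvar: "finite F \<Longrightarrow> (\<Prod>i\<in>F. tvar i) = single (\<Sum>i\<in>F. axis i 1) 1"
  by (induction F rule: finite_induct) (auto simp: tvar_def mult_single)

lemma prod_tvar_UNIV: "(\<Prod>i\<in>(UNIV :: 'r::finite set). tvar i) = single 1 1"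
proof -
  have "(\<Sum>i\<in>(UNIV :: 'r set). axis i (1::int)) = 1"
    by (simp add: vec_eq_iff axis_def)
  then show ?thesis by (simp add: prod_tvar)
qed

text \<open>The factor \<open>tvar j - 1\<close> takes a difference in direction \<open>j\<close>,
  which turns the half-line \<open>v $ j \<le> u $ j\<close> into the single point
  \<open>u $ j + 1\<close>. After all directions one lattice point is left.\<close>

lemma convolve_tvar_prod_orthant:
  fixes u :: "int ^ 'r::finite"
  shows "finite F \<Longrightarrow> convolve (\<Prod>i\<in>F. (tvar i - 1)) (\<lambda>v. if \<forall>i. v $ i \<le> u $ i then 1 else 0) =
    (\<lambda>v. if (\<forall>i\<in>F. v $ i = u $ i + 1) \<and> (\<forall>i. i \<notin> F \<longrightarrow> v $ i \<le> u $ i) then 1 else 0)"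
proof (induction F rule: finite_induct)
  case empty
  then show ?case by (simp add: convolve_one)
next
  case (insert j F)
  let ?H = "\<lambda>F v. if (\<forall>i\<in>F. v $ i = u $ i + 1) \<and> (\<forall>i. i \<notin> F \<longrightarrow> v $ i \<le> u $ i) then 1 else (0::int)"
  have "convolve (\<Prod>i\<in>insert j F. (tvar i - 1)) (\<lambda>v. if \<forall>i. v $ i \<le> u $ i then 1 else 0) =
    convolve (tvar j - 1) (?H F)"
    using insert by (simp add: convolve_mult)
  also have "\<dots> = (\<lambda>v. ?H F (v - axis j 1) - ?H F v)"
    by (simp add: convolve_minus convolve_one tvar_def convolve_single fun_eq_iff)
  also have "\<dots> = ?H (insert j F)"
  proof
    fix v
    define P where "P \<longleftrightarrow> (\<forall>i\<in>F. v $ i = u $ i + 1) \<and> (\<forall>i. i \<notin> insert j F \<longrightarrow> v $ i \<le> u $ i)"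
    have ax: "(v - axis j 1) $ i = (if i = j then v $ j - 1 else v $ i)" for i by (simp add: axis_def)
    have 1: "((\<forall>i\<in>F. (v - axis j 1) $ i = u $ i + 1) \<and> (\<forall>i. i \<notin> F \<longrightarrow> (v - axis j 1) $ i \<le> u $ i)) \<longleftrightarrow>
        P \<and> v $ j - 1 \<le> u $ j"
      unfolding P_def ax using insert(2) by (auto split: if_splits)
    have 2: "((\<forall>i\<in>F. v $ i = u $ i + 1) \<and> (\<forall>i. i \<notin> F \<longrightarrow> v $ i \<le> u $ i)) \<longleftrightarrow> P \<and> v $ j \<le> u $ j"
      unfolding P_def using insert(2) by auto
    have 3: "((\<forall>i\<in>insert j F. v $ i = u $ i + 1) \<and> (\<forall>i. i \<notin> insert j F \<longrightarrow> v $ i \<le> u $ i)) \<longleftrightarrow>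
        P \<and> v $ j = u $ j + 1"
      unfolding P_def using insert(2) by auto
    show "?H F (v - axis j 1) - ?H F v = ?H (insert j F) v"
      unfolding 1 2 3 by auto
  qed
  finally show ?case .
qed

text \<open>The boundary of an orthant is the orthant minus its translate by the vector of ones.
  Each of them becomes one point, which leaves +1 at \<open>u + 1\<close> and -1 at
  \<open>u\<close>.\<close>

lemma convolve_box:
  fixes u :: "int ^ 'r::finite"
  shows "convolve (\<Prod>i\<in>UNIV. (tvar i - 1))
      (\<lambda>v. if (\<forall>i. v $ i \<le> u $ i) \<and> \<not> (\<forall>i. v $ i + 1 \<le> u $ i) then 1 else 0) v =
    (if u = v - 1 then 1 else 0) - (if u = v then 1 else (0::int))"
proof -
  let ?c = "\<lambda>v :: int ^ 'r. if \<forall>i. v $ i \<le> u $ i then 1 else (0::int)"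
  let ?p = "\<Prod>i\<in>(UNIV :: 'r set). (tvar i - 1)"
  have G: "convolve ?p ?c v = (if u = v - 1 then 1 else 0)" for v
    by (subst convolve_tvar_prod_orthant) (auto simp: vec_eq_iff algebra_simps)
  have "(\<lambda>v. if (\<forall>i. v $ i \<le> u $ i) \<and> \<not> (\<forall>i. v $ i + 1 \<le> u $ i) then 1 else (0::int))
      = (\<lambda>v. ?c v - ?c (v + 1))"
  proof
    fix v
    have "(\<forall>i. v $ i + 1 \<le> u $ i) \<Longrightarrow> (\<forall>i. v $ i \<le> u $ i)" by (smt (verit))
    then show "(if (\<forall>i. v $ i \<le> u $ i) \<and> \<not> (\<forall>i. v $ i + 1 \<le> u $ i) then 1 else (0::int))
        = ?c v - ?c (v + 1)"
      by auto
  qed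
  then have "convolve ?p (\<lambda>v. if (\<forall>i. v $ i \<le> u $ i)
      \<and> \<not> (\<forall>i. v $ i + 1 \<le> u $ i) then 1 else (0::int)) v =
      convolve ?p ?c v - convolve ?p ?c (v + 1)"
    using convolve_shift[of ?p ?c 1 v] by (simp only: convolve_fun_diff)
  then show ?thesis by (simp add: G)
qed

text \<open>The difference of two solutions is invariant under translation by the vector of ones, so
  a power series with this property vanishes. For two-sided series uniqueness fails, which is why
  the restriction to \<open>power_series\<close> matters.\<close>

lemma power_series_diff_unique:
  fixes P Q :: "('r::finite) series"
  assumes "P \<in> power_series" "Q \<in> power_series"
    and "convolve ((\<Prod>i\<in>UNIV. tvar i) - 1) P = convolve ((\<Prod>i\<in>UNIV. tvar i) - 1) Q"
  shows "P = Q"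
proof
  fix v :: "int ^ 'r"
  define D where "D = (\<lambda>v. P v - Q v)"
  have step: "D (v - 1) = D v" for v
    using fun_cong[OF assms(3), of v]
    by (simp add: D_def prod_tvar_UNIV convolve_minus convolve_one convolve_single)
  have "D (v - of_nat k) = D v" for k :: nat
  proof (induction k)
    case (Suc k)
    have "v - of_nat (Suc k) = v - of_nat k - 1" by (simp add: algebra_simps)
    then show ?case using step[of "v - of_nat k"] Suc by (simp only:)
  qed simp
  moreover define i :: 'r where "i = undefined"
  \<comment> \<open>Just enough translations to make the coordinate \<open>i\<close> negative, where
    both series vanish.\<close>
  have "(v - of_nat (Suc (nat (v $ i)))) $ i < 0" by (simp add: of_nat_index)
  then have "D (v - of_nat (Suc (nat (v $ i)))) = 0"
    using assms(1,2) unfolding power_series_def D_def by (smt (verit) mem_Collect_eq)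
  ultimately have "D v = 0" by metis
  then show "P v = Q v" by (simp add: D_def)
qed

context toric
begin

definition exponent :: "int ^ 'd \<Rightarrow> int ^ 'r" where
  "exponent m = (\<chi> i. pairing m (\<nu> i))"

lemma exponent_nth [simp]: "exponent m $ i = pairing m (\<nu> i)"
  by (simp add: exponent_def)

definition lattice_count :: "int ^ 'r \<Rightarrow> int" where
  "lattice_count v = int (card {m \<in> S. exponent m = v})"

lemma finite_exponent: "finite {m \<in> S. exponent m = v}"
  by (rule finite_subset[OF _ finite_pairing_le[of undefined "v $ undefined"]]) auto

text \<open>The dimension series is the sum over all exponents of the orthant boundaries
  \<open>?\<delta> m\<close>, to which \<open>convolve_box\<close> applies one at a time.\<close>

lemma poincare_series_eq: "poincare_series S \<nu> = lattice_count"
  unfolding poincare_series_def laurent_mult_convolve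
proof (rule the_equality)
  have ps: "lattice_count \<in> power_series"
    unfolding power_series_def
  proof (intro CollectI allI impI)
    fix v i assume "lattice_count v \<noteq> 0"
    then have "{m \<in> S. exponent m = v} \<noteq> {}" unfolding lattice_count_def by (metis card.empty of_nat_0)
    then obtain m where "m \<in> S" "exponent m = v" by blast
    then show "0 \<le> v $ i" using pairing_nonneg[of m i] by auto
  qed
  let ?p = "\<Prod>i\<in>(UNIV :: 'r set). (tvar i - 1)"
  let ?\<delta> = "\<lambda>m (v :: int ^ 'r). if (\<forall>i. v $ i \<le> exponent m $ i)
      \<and> \<not> (\<forall>i. v $ i + 1 \<le> exponent m $ i) then 1 else (0::int)"
  have eq: "convolve ((\<Prod>i\<in>UNIV. tvar i) - 1) lattice_count = convolve ?p (dim_series S \<nu>)"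
  proof
    fix v :: "int ^ 'r"
    have fin: "finite {m \<in> S. ?\<delta> m u \<noteq> 0}" for u :: "int ^ 'r"
    proof (rule finite_subset)
      show "{m \<in> S. ?\<delta> m u \<noteq> 0} \<subseteq> (\<Union>i. {m \<in> S. pairing m (\<nu> i) \<le> u $ i})"
      proof
        fix m assume m: "m \<in> {m \<in> S. ?\<delta> m u \<noteq> 0}"
        then obtain i where "\<not> u $ i + 1 \<le> exponent m $ i" by (auto split: if_splits)
        then have "pairing m (\<nu> i) \<le> u $ i" by simp
        then show "m \<in> (\<Union>i. {m \<in> S. pairing m (\<nu> i) \<le> u $ i})" using m by blast
      qed
    qed (simp add: finite_pairing_le)
    \<comment> \<open>The finitely many exponents visible at \<open>v\<close>: those entering some
      coefficient used by the convolution, and those counted at \<open>v - 1\<close> and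
      \<open>v\<close>. Summing over \<open>F\<close> makes the exchange of sums legitimate.\<close>
    define F where "F = (\<Union>w\<in>keys ?p. {m \<in> S. ?\<delta> m (v - w) \<noteq> 0}) \<union>
      {m \<in> S. exponent m = v - 1} \<union> {m \<in> S. exponent m = v}"
    have F: "finite F"
      unfolding F_def by (intro finite_UnI finite_UN_I finite_keys fin finite_exponent)
    have FS: "F \<subseteq> S" unfolding F_def by auto
    have count: "lattice_count u = (\<Sum>m\<in>F. if exponent m = u then 1 else 0)" if "u = v \<or> u = v - 1" for u
    proof -
      have "{m \<in> S. exponent m = u} = {m \<in> F. exponent m = u}"
        using that FS unfolding F_def by auto
      then show ?thesis unfolding lattice_count_def using F by (simp add: sum.If_cases Int_def)
    qed
    have dim: "dim_series S \<nu> (v - w) = (\<Sum>m\<in>F. ?\<delta> m (v - w))" if "w \<in> keys ?p" for w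
    proof -
      let ?Q = "\<lambda>m. (\<forall>i. (v - w) $ i \<le> exponent m $ i) \<and> \<not> (\<forall>i. (v - w) $ i + 1 \<le> exponent m $ i)"
      have "{m \<in> S. ?Q m} = {m \<in> F. ?Q m}"
      proof (intro equalityI subsetI)
        fix m assume "m \<in> {m \<in> S. ?Q m}"
        then have "m \<in> {m \<in> S. ?\<delta> m (v - w) \<noteq> 0}" "?Q m" by auto
        then show "m \<in> {m \<in> F. ?Q m}" unfolding F_def using that by blast
      qed (use FS in auto)
      then have "int (card {m \<in> S. ?Q m}) = (\<Sum>m\<in>F. ?\<delta> m (v - w))"
        using F by (simp only: sum.If_cases) (simp add: Int_def)
      then show ?thesis unfolding dim_series_eq by simp
    qed
    have "convolve ?p (dim_series S \<nu>) v = (\<Sum>w\<in>keys ?p. lookup ?p w * (\<Sum>m\<in>F. ?\<delta> m (v - w)))"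
      unfolding convolve_def by (intro sum.cong) (simp_all only: dim)
    also have "\<dots> = (\<Sum>m\<in>F. convolve ?p (?\<delta> m) v)"
      unfolding convolve_def sum_distrib_left by (rule sum.swap)
    also have "\<dots> = (\<Sum>m\<in>F. (if exponent m = v - 1 then 1 else 0) - (if exponent m = v then 1 else 0))"
      by (intro sum.cong refl convolve_box)
    also have "\<dots> = lattice_count (v - 1) - lattice_count v"
      by (simp add: count sum_subtractf)
    finally show "convolve ((\<Prod>i\<in>UNIV. tvar i) - 1) lattice_count v = convolve ?p (dim_series S \<nu>) v"
      by (simp add: prod_tvar_UNIV convolve_minus convolve_one convolve_single)
  qed
  show "lattice_count \<in> power_series \<and> convolve ((\<Prod>i\<in>UNIV. tvar i) - 1) lattice_count
      = convolve ?p (dim_series S \<nu>)"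
    using ps eq by blast
  fix P assume "P \<in> power_series \<and> convolve ((\<Prod>i\<in>UNIV. tvar i) - 1) P = convolve ?p (dim_series S \<nu>)"
  then show "P = lattice_count" using power_series_diff_unique[OF _ ps] eq by simp
qed

end

section \<open>Level sets as cylinders\<close>

lemma constructible_subset: "B \<in> constructible V \<Longrightarrow> B \<subseteq> proj V"
  by (induction rule: constructible.induct) (auto simp: zero_locus_def)

lemma constructible_empty: "{} \<in> constructible V"
proof -
  have "zero_locus V {\<lambda>_. 1} \<in> constructible V"
    by (rule constructible.closed) (auto intro: homogeneous_poly.const)
  moreover have "zero_locus V {\<lambda>_. 1} = {}"
  proof -
    have "x \<in> L \<Longrightarrow> L \<notin> zero_locus V {\<lambda>_. 1}" for x L by (auto simp: zero_locus_def)
    moreover have "\<exists>x. x \<in> L" if "L \<in> proj V" for L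
      using that unfolding proj_def punctured_line_def by (auto intro!: exI[of _ 1])
    ultimately show ?thesis by (auto simp: zero_locus_def)
  qed
  ultimately show ?thesis by simp
qed

lemma constructible_Int:
  assumes "A \<in> constructible V" "B \<in> constructible V"
  shows "A \<inter> B \<in> constructible V"
proof -
  have "A \<inter> B = proj V - ((proj V - A) \<union> (proj V - B))"
    using constructible_subset[OF assms(1)] by auto
  then show ?thesis using assms by (auto intro: constructible.intros)
qed

text \<open>The additional set \<open>A\<close> keeps an empty intersection inside the projective
  space.\<close>

lemma constructible_INT:
  assumes "finite I" "\<And>i. i \<in> I \<Longrightarrow> f i \<in> constructible V" "A \<in> constructible V"
  shows "A \<inter> (\<Inter>i\<in>I. f i) \<in> constructible V"
  using assms(1,2)
proof (induction I rule: finite_induct)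
  case (insert i I)
  then have "(A \<inter> (\<Inter>i\<in>I. f i)) \<inter> f i \<in> constructible V" by - (rule constructible_Int, auto)
  then show ?case by (simp add: Int_ac)
qed (use assms(3) in simp)

lemma (in coordinates) linear_zero_locus_constructible:
  "F \<subseteq> T \<Longrightarrow> zero_locus V (l ` F) \<in> constructible V"
  by (intro constructible.closed) (use coord_linear homogeneous_poly.linear in blast)

lemma (in coordinates) punctured_line_zero_locus:
  assumes "y \<in> carrier V - {\<zero>\<^bsub>V\<^esub>}" "F \<subseteq> T"
  shows "punctured_line V y \<in> zero_locus V (l ` F) \<longleftrightarrow> (\<forall>m\<in>F. l m y = 0)"
proof
  assume "punctured_line V y \<in> zero_locus V (l ` F)"
  moreover have "y \<in> punctured_line V y"
    unfolding punctured_line_def using smult_one[of y] assms(1) by (intro CollectI exI[of _ 1]) auto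
  ultimately show "\<forall>m\<in>F. l m y = 0" by (auto simp: zero_locus_def)
next
  assume "\<forall>m\<in>F. l m y = 0"
  then show "punctured_line V y \<in> zero_locus V (l ` F)"
    using assms coord_smult[of _ y] by (auto simp: zero_locus_def proj_def punctured_line_def
        subset_iff)
qed

context toric
begin

section \<open>Coordinates on jet spaces\<close>

abbreviation "jets k \<equiv> jet_space S k"

abbreviation "jet_line k \<equiv> punctured_line (jet_space S k)"

abbreviation "level w \<equiv> level_set S (t_nu \<nu>) (t_monomial w)"

text \<open>The monomials outside the power of the maximal ideal that is divided out; their classes
  form a basis of the \<open>k\<close>-jets.\<close>

definition jet_basis :: "nat \<Rightarrow> (int ^ 'd) set" where
  "jet_basis k = S - deg_ge (Suc k)"

lemma jet_params: "deg_ge (Suc k) \<subseteq> S" "S \<subseteq> S" "finite (S - deg_ge (Suc k))"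
  using monoid_ideal_deg_ge finite_diff_deg_ge by (auto simp: monoid_ideal_def)

lemma R_update: "R\<lparr>carrier := germs_in S\<rparr> = R"
  by (simp add: germs_in_S)

lemma jet_space_eq: "jets k = Q S (deg_ge (Suc k))"
  unfolding jet_space_def jet_ideal_eq R_update ..

lemma jet_eq: "x \<in> carrier R \<Longrightarrow> jet S k x = germ_class S (deg_ge (Suc k)) x"
  using coset_germ_class[OF jet_params, where x=x, unfolded R_update]
    unfolding jet_def jet_ideal_eq germs_in_S .

lemma coordinates_jet: "coordinates (jets k) (jet_basis k) class_coeff"
  unfolding jet_space_eq jet_basis_def by (rule coordinates_Q[OF jet_params])

lemma carrier_jet: "carrier (jets k) = jet S k ` carrier R"
  using carrier_Q[OF jet_params, of k] jet_eq[of _ k] unfolding jet_space_eq germs_in_S by simp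

lemma coeff_jet: "x \<in> carrier R \<Longrightarrow> m \<in> jet_basis k \<Longrightarrow> class_coeff m (jet S k x) = coeff x m"
  using class_coeff[OF jet_params, where x=x and m=m] by (simp add: jet_eq germs_in_S jet_basis_def)

lemma jet_smult: "x \<in> carrier R \<Longrightarrow> c \<odot>\<^bsub>jets k\<^esub> jet S k x = jet S k (c \<odot>\<^bsub>R\<^esub> x)"
  using smult_Q[OF jet_params, where x=x and c=c] by (simp add: jet_eq jet_space_eq germs_in_S R_closed)

lemma jet_zero: "\<zero>\<^bsub>jets k\<^esub> = jet S k \<zero>\<^bsub>R\<^esub>"
  using zero_Q[OF jet_params] by (simp add: jet_eq jet_space_eq R_closed)

lemma jet_eq_iff:
  assumes "x \<in> carrier R" "y \<in> carrier R"
  shows "jet S k x = jet S k y \<longleftrightarrow> (\<forall>m\<in>jet_basis k. coeff x m = coeff y m)"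
  using germ_class_eq_iff[OF jet_params, where x=x and y=y] assms
    by (simp add: jet_eq germs_in_S jet_basis_def)

lemma jet_eq_zero_iff:
  "x \<in> carrier R \<Longrightarrow> jet S k x = \<zero>\<^bsub>jets k\<^esub> \<longleftrightarrow> (\<forall>m\<in>jet_basis k. coeff x m = 0)"
  unfolding jet_zero by (simp add: jet_eq_iff R_closed coeff_zero)

text \<open>The lift is the truncated polynomial. Having no coefficients beyond the jet, it allows
  conditions on germs to be compared with conditions on jets even at low order.\<close>

lemma jet_lift:
  assumes "y \<in> carrier (jets k)"
  obtains x where "x \<in> carrier R" "jet S k x = y" "\<And>m. m \<notin> jet_basis k \<Longrightarrow> coeff x m = 0"
proof -
  interpret J: coordinates "jets k" "jet_basis k" class_coeff by (rule coordinates_jet)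
  define x where "x = poly_germ S (deg_ge (Suc k)) (\<lambda>m. class_coeff m y)"
  have x: "x \<in> carrier R" "coeff x m = (if m \<in> jet_basis k then class_coeff m y else 0)" for m
    unfolding x_def jet_basis_def using poly_germ[OF jet_params] by (simp_all add: germs_in_S)
  have "jet S k x = y"
    using assms x by (intro J.coord_inj) (auto simp: carrier_jet coeff_jet)
  then show ?thesis using that[of x] x by auto
qed

lemma poly_germ_exists: "m \<in> S \<Longrightarrow> \<exists>x\<in>carrier R. coeff x = (\<lambda>n. if n = m then 1 else 0)"
proof -
  assume m: "m \<in> S"
  have p: "S - {m} \<subseteq> S" "S \<subseteq> S" "finite (S - (S - {m}))"
    using m by (auto intro: finite_subset[of _ "{m}"])
  show ?thesis
    using poly_germ[OF p, of "\<lambda>_. 1"] m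
    by (intro bexI[of _ "poly_germ S (S - {m}) (\<lambda>_. 1)"]) (auto simp: germs_in_S fun_eq_iff)
qed

lemma jet_image_line:
  "x \<in> carrier R \<Longrightarrow> jet S k ` punctured_line R x = jet_line k (jet S k x)"
  unfolding punctured_line_def using jet_smult by auto

text \<open>\<open>B\<close> avoids the point added to the projective space, so a germ with zero jet
  is never in the cylinder; for such a germ the image of the line is \<open>{0}\<close>, which is
  not in \<open>proj\<close> either.\<close>

lemma cylinder_iff:
  assumes x: "x \<in> carrier R" "x \<noteq> \<zero>\<^bsub>R\<^esub>" and B: "B \<subseteq> proj (jets k)"
  shows "punctured_line R x \<in> cylinder S k B \<longleftrightarrow> jet_line k (jet S k x) \<in> B"
proof -
  interpret J: coordinates "jets k" "jet_basis k" class_coeff by (rule coordinates_jet)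
  have L: "punctured_line R x \<in> proj R" using x by (auto simp: proj_def)
  have jc: "jet S k x \<in> carrier (jets k)" using x by (simp add: carrier_jet)
  have self: "y \<in> jet_line k y" if "y \<in> carrier (jets k)" for y
    unfolding punctured_line_def using J.smult_one[OF that] by (intro CollectI exI[of _ 1]) auto
  have "jet_line k (jet S k x) \<noteq> {\<zero>\<^bsub>jets k\<^esub>}"
    if "jet_line k (jet S k x) \<in> B"
  proof -
    have "jet_line k (jet S k x) \<in> proj (jets k)" using that B by auto
    then obtain y where y: "y \<in> carrier (jets k)" "y \<noteq> \<zero>\<^bsub>jets k\<^esub>"
      "jet_line k (jet S k x) = jet_line k y"
      by (auto simp: proj_def)
    then show ?thesis using self[OF y(1)] by auto
  qed
  note nonzero = this
  have "punctured_line R x \<in> cylinder S k B \<longleftrightarrow> jet_proj S k (punctured_line R x) \<in> Some ` B"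
    unfolding cylinder_def using L by simp
  also have "\<dots> \<longleftrightarrow> jet_line k (jet S k x) \<in> B"
    unfolding jet_proj_def jet_image_line[OF x(1)] if_split[of "\<lambda>z. z \<in> Some ` B"] using nonzero
      by blast
  finally show ?thesis .
qed

section \<open>Germs with prescribed valuation vector\<close>

definition exponents_ge :: "int ^ 'r \<Rightarrow> (int ^ 'd) set" where
  "exponents_ge w = {m \<in> S. \<forall>i. w $ i \<le> pairing m (\<nu> i)}"

definition face :: "int ^ 'r \<Rightarrow> 'r \<Rightarrow> (int ^ 'd) set" where
  "face w i = {m \<in> exponents_ge w. pairing m (\<nu> i) = w $ i}"

text \<open>The condition that the valuation vector equals \<open>w\<close>, in terms of the
  support: it satisfies all lower bounds and attains each of them, possibly at different
  exponents.\<close>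

definition has_val :: "int ^ 'r \<Rightarrow> 'd germ \<Rightarrow> bool" where
  "has_val w x \<longleftrightarrow> supported (exponents_ge w) (coeff x) \<and> (\<forall>i. \<exists>m\<in>face w i. coeff x m \<noteq> 0)"

lemma face_Inter: "{m. \<forall>i. m \<in> face w i} = {m \<in> S. exponent m = w}"
  by (auto simp: face_def exponents_ge_def vec_eq_iff)

text \<open>Equality with an integer is split into a lower bound that holds and the next one that
  fails, since \<open>le_germ_val\<close> describes lower bounds only.\<close>

lemma has_val_iff:
  assumes x: "x \<in> carrier R" "x \<noteq> \<zero>\<^bsub>R\<^esub>"
  shows "(\<chi> i. germ_val (\<nu> i) x) = w \<longleftrightarrow> has_val w x"
proof -
  have S: "coeff x m \<noteq> 0 \<Longrightarrow> m \<in> S" for m using supported_coeff[OF x(1)] by (auto simp: supported_def)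
  have "(\<chi> i. germ_val (\<nu> i) x) = w \<longleftrightarrow> (\<forall>i. w $ i \<le> germ_val (\<nu> i) x \<and> \<not> w $ i + 1 \<le> germ_val (\<nu> i) x)"
    unfolding vec_eq_iff vec_lambda_beta by (intro all_cong1) linarith
  also have "\<dots> \<longleftrightarrow> (\<forall>i. (\<forall>m. coeff x m \<noteq> 0 \<longrightarrow> w $ i \<le> pairing m (\<nu> i)) \<and>
      (\<exists>m. coeff x m \<noteq> 0 \<and> \<not> w $ i + 1 \<le> pairing m (\<nu> i)))"
    unfolding le_germ_val[OF x] supported_def using S by (intro all_cong1) blast
  also have "\<dots> \<longleftrightarrow> has_val w x"
  proof
    assume a: "\<forall>i. (\<forall>m. coeff x m \<noteq> 0 \<longrightarrow> w $ i \<le> pairing m (\<nu> i)) \<and>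
      (\<exists>m. coeff x m \<noteq> 0 \<and> \<not> w $ i + 1 \<le> pairing m (\<nu> i))"
    have sup: "m \<in> exponents_ge w" if "coeff x m \<noteq> 0" for m
      unfolding exponents_ge_def using S[OF that] a that by blast
    have "\<exists>m\<in>face w i. coeff x m \<noteq> 0" for i
    proof -
      obtain m where m: "coeff x m \<noteq> 0" "\<not> w $ i + 1 \<le> pairing m (\<nu> i)" using a by blast
      moreover have "w $ i \<le> pairing m (\<nu> i)" using a m by blast
      ultimately have "m \<in> face w i" unfolding face_def using sup[OF m(1)] by auto
      then show ?thesis using m by blast
    qed
    then show "has_val w x" unfolding has_val_def supported_def using sup by blast
  next
    assume h: "has_val w x"
    show "\<forall>i. (\<forall>m. coeff x m \<noteq> 0 \<longrightarrow> w $ i \<le> pairing m (\<nu> i)) \<and>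
      (\<exists>m. coeff x m \<noteq> 0 \<and> \<not> w $ i + 1 \<le> pairing m (\<nu> i))"
    proof (intro allI conjI impI)
      fix i m assume "coeff x m \<noteq> 0"
      then show "w $ i \<le> pairing m (\<nu> i)" using h
        by (auto simp: has_val_def supported_def exponents_ge_def)
    next
      fix i
      obtain m where "m \<in> face w i" "coeff x m \<noteq> 0" using h unfolding has_val_def by blast
      then show "\<exists>m. coeff x m \<noteq> 0 \<and> \<not> w $ i + 1 \<le> pairing m (\<nu> i)"
        by (intro exI[of _ m]) (auto simp: face_def)
    qed
  qed
  finally show ?thesis .
qed

lemma has_val_nonzero: "has_val w x \<Longrightarrow> x \<noteq> \<zero>\<^bsub>R\<^esub>"
  unfolding has_val_def by (auto simp: coeff_zero)

lemma has_val_monomial: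
  assumes "m \<in> S" "exponent m = w" "coeff x = (\<lambda>n. if n = m then 1 else 0)"
  shows "has_val w x"
proof -
  have "m \<in> face w i" for i using assms(1,2) face_Inter[of w] by blast
  moreover from this have "m \<in> exponents_ge w" by (auto simp: face_def)
  ultimately show ?thesis
    unfolding has_val_def supported_def assms(3) by (auto intro!: bexI[of _ m])
qed

lemma smult_nonzero: "x \<in> carrier R \<Longrightarrow> x \<noteq> \<zero>\<^bsub>R\<^esub> \<Longrightarrow> c \<noteq> 0 \<Longrightarrow> c \<odot>\<^bsub>R\<^esub> x \<noteq> \<zero>\<^bsub>R\<^esub>"
proof
  assume x: "x \<in> carrier R" "x \<noteq> \<zero>\<^bsub>R\<^esub>" "c \<noteq> 0" and "c \<odot>\<^bsub>R\<^esub> x = \<zero>\<^bsub>R\<^esub>"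
  then have "coeff (c \<odot>\<^bsub>R\<^esub> x) = (\<lambda>_. 0)" by (simp add: coeff_zero)
  then have "coeff x = coeff \<zero>\<^bsub>R\<^esub>" using x by (simp add: coeff_smult coeff_zero fun_eq_iff)
  then show False using x coeff_inj[of x "\<zero>\<^bsub>R\<^esub>"] R_closed(3) by simp
qed

text \<open>Scaling does not change the support, so all representatives of the line have the same
  valuation vector and \<open>the_elem\<close> is applied to a singleton.\<close>

lemma t_nu_line:
  assumes x: "x \<in> carrier R" "x \<noteq> \<zero>\<^bsub>R\<^esub>"
  shows "t_nu \<nu> (punctured_line R x) = t_monomial (\<chi> i. germ_val (\<nu> i) x)"
proof -
  define w where "w = (\<chi> i. germ_val (\<nu> i) x)"
  have hx: "has_val w x" using has_val_iff[OF x, of w] unfolding w_def by blast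
  have "(\<chi> i. germ_val (\<nu> i) y) = w" if y: "y \<in> punctured_line R x" for y
  proof -
    obtain c where c: "c \<noteq> 0" "y = c \<odot>\<^bsub>R\<^esub> x" using y by (auto simp: punctured_line_def)
    have "has_val w y" using hx c x by (simp add: has_val_def coeff_smult supported_def)
    then show ?thesis using has_val_iff[of y w] c x smult_nonzero R_closed by simp
  qed
  moreover have "\<exists>y. y \<in> punctured_line R x" by (auto simp: punctured_line_def intro!: exI[of _ 1])
  ultimately have "(\<lambda>y. t_monomial (\<chi> i. germ_val (\<nu> i) y)) ` punctured_line R x = {t_monomial w}"
    by auto
  then show ?thesis unfolding t_nu_def w_def by simp
qed

lemma t_monomial_inj: "t_monomial v = t_monomial w \<longleftrightarrow> v = w"
proof
  assume "t_monomial v = t_monomial w"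
  then have "t_monomial v v = t_monomial w v" by simp
  then show "v = w" by (simp add: t_monomial_def split: if_splits)
qed simp

lemma level_set_monomial:
  "level w = {punctured_line R x | x. x \<in> carrier R \<and> has_val w x}"
proof (intro equalityI subsetI)
  fix L assume "L \<in> level w"
  then obtain x where x: "x \<in> carrier R" "x \<noteq> \<zero>\<^bsub>R\<^esub>" "L = punctured_line R x" "t_nu \<nu> L = t_monomial w"
    unfolding level_set_def proj_def by blast
  then have "has_val w x" using t_nu_line[of x] has_val_iff[of x w] by (simp add: t_monomial_inj)
  then show "L \<in> {punctured_line R x | x. x \<in> carrier R \<and> has_val w x}" using x by blast
next
  fix L assume "L \<in> {punctured_line R x | x. x \<in> carrier R \<and> has_val w x}"
  then obtain x where x: "x \<in> carrier R" "has_val w x" "L = punctured_line R x" by blast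
  then have nz: "x \<noteq> \<zero>\<^bsub>R\<^esub>" using has_val_nonzero by blast
  then have "t_nu \<nu> L = t_monomial w" using x t_nu_line[of x] has_val_iff[of x w] by simp
  then show "L \<in> level w" using x nz by (auto simp: level_set_def proj_def)
qed

lemma has_val_scale:
  assumes "x \<in> carrier R" "y \<in> carrier R" "punctured_line R x = punctured_line R y" "has_val w x"
  shows "has_val w y"
proof -
  have x: "x \<noteq> \<zero>\<^bsub>R\<^esub>" using assms(4) has_val_nonzero by blast
  have "coeff (1 \<odot>\<^bsub>R\<^esub> y) = coeff y" using assms(2) by (simp add: coeff_smult)
  then have "1 \<odot>\<^bsub>R\<^esub> y = y" using assms(2) by (intro coeff_inj R_closed)
  then have "y \<in> punctured_line R y" unfolding punctured_line_def by (intro CollectI exI[of _ 1]) simp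
  then obtain c where "c \<noteq> 0" "y = c \<odot>\<^bsub>R\<^esub> x" unfolding assms(3)[symmetric]
    by (auto simp: punctured_line_def)
  then show ?thesis using assms(1,4) by (simp add: has_val_def coeff_smult supported_def)
qed

lemma level_set_line:
  assumes "x \<in> carrier R"
  shows "punctured_line R x \<in> level w \<longleftrightarrow> has_val w x"
  unfolding level_set_monomial using assms has_val_scale by blast

section \<open>Bases of the cylinders\<close>

definition jet_cone :: "nat \<Rightarrow> int ^ 'r \<Rightarrow> 'd germ set set" where
  "jet_cone k w = {y \<in> carrier (jets k). (\<forall>m\<in>jet_basis k - exponents_ge w. class_coeff m y = 0) \<and>
     (\<forall>i. \<exists>m\<in>face w i \<inter> jet_basis k. class_coeff m y \<noteq> 0)}"

abbreviation jet_cell :: "nat \<Rightarrow> int ^ 'r \<Rightarrow> 'd germ set set set" where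
  "jet_cell k w \<equiv> jet_line k ` jet_cone k w"

lemma homog_jet_cone: "coordinates.homog (jets k) (jet_cone k w)"
proof -
  interpret J: coordinates "jets k" "jet_basis k" class_coeff by (rule coordinates_jet)
  show ?thesis unfolding J.homog_def jet_cone_def using J.smult_closed J.coord_zero
    by (auto simp: J.coord_smult)
qed

text \<open>The coordinate arrangement given by the faces seen in the \<open>k\<close>-jets. It is
  computed for every \<open>k\<close>, because an arbitrary presentation of a level set as a
  cylinder may use any order.\<close>

lemma euler_char_jet_cell:
  "euler_char (subtopology (proj_topology (jets k)) (jet_cell k w)) =
    int (card {m \<in> S. exponent m = w \<and> m \<in> jet_basis k})"
proof -
  interpret J: coordinates "jets k" "jet_basis k" class_coeff by (rule coordinates_jet)
  have "jet_cone k w = {x \<in> J.subspace (exponents_ge w \<inter> jet_basis k). \<forall>i. \<exists>j\<in>face w i \<inter> jet_basis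
      k. class_coeff j x \<noteq> 0}"
    unfolding jet_cone_def J.subspace_def by auto
  then have "J.proj_euler (jet_cone k w) (int (card {m. \<forall>i. m \<in> face w i \<inter> jet_basis k}))"
    by (simp only:) (rule J.proj_euler_coordinate_arrangement; auto simp: face_def)
  from has_euler_euler_char[OF this]
  have "euler_char (subtopology (proj_topology (jets k)) (jet_cell k w)) =
      int (card {m. \<forall>i. m \<in> face w i \<inter> jet_basis k})" .
  also have "{m. \<forall>i. m \<in> face w i \<inter> jet_basis k} = {m \<in> S. exponent m = w \<and> m \<in> jet_basis k}"
    using face_Inter[of w] by auto
  finally show ?thesis .
qed

lemma constructible_jet_cell: "jet_cell k w \<in> constructible (jets k)"
proof -
  interpret J: coordinates "jets k" "jet_basis k" class_coeff by (rule coordinates_jet)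
  let ?P = "proj (jets k)"
  let ?Z = "\<lambda>F. zero_locus (jets k) (class_coeff ` F)"
  have "?Z (jet_basis k - exponents_ge w) \<inter> (\<Inter>i\<in>UNIV. ?P - ?Z (face w i \<inter> jet_basis k))
      \<in> constructible (jets k)"
    by (intro constructible_INT constructible.compl J.linear_zero_locus_constructible) auto
  also have "?Z (jet_basis k - exponents_ge w) \<inter> (\<Inter>i\<in>UNIV. ?P - ?Z (face w i \<inter> jet_basis k))
      = jet_cell k w"
  proof (intro equalityI subsetI)
    fix L assume L: "L \<in> ?Z (jet_basis k - exponents_ge w) \<inter> (\<Inter>i\<in>UNIV. ?P - ?Z (face w i \<inter> jet_basis
        k))"
    then have "L \<in> ?P" by auto
    then obtain y where y: "y \<in> carrier (jets k) - {\<zero>\<^bsub>jets k\<^esub>}" "L = jet_line k y"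
      unfolding proj_def by blast
    have "y \<in> jet_cone k w"
      using L y J.punctured_line_zero_locus[OF y(1), of "jet_basis k - exponents_ge w"]
        J.punctured_line_zero_locus[OF y(1), of "face w i \<inter> jet_basis k" for i]
      unfolding jet_cone_def by auto
    then show "L \<in> jet_cell k w" using y by blast
  next
    fix L assume "L \<in> jet_cell k w"
    then obtain y where y: "y \<in> jet_cone k w" "L = jet_line k y" by blast
    then have yc: "y \<in> carrier (jets k) - {\<zero>\<^bsub>jets k\<^esub>}"
      using homog_jet_cone[of k w] unfolding J.homog_def by blast
    show "L \<in> ?Z (jet_basis k - exponents_ge w) \<inter> (\<Inter>i\<in>UNIV. ?P - ?Z (face w i \<inter> jet_basis k))"
      using y yc J.punctured_line_zero_locus[OF yc, of "jet_basis k - exponents_ge w"]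
        J.punctured_line_zero_locus[OF yc, of "face w i \<inter> jet_basis k" for i]
      unfolding jet_cone_def proj_def by auto
  qed
  finally show ?thesis .
qed

lemma jet_cell_iff:
  assumes "x \<in> carrier R"
  shows "jet_line k (jet S k x) \<in> jet_cell k w \<longleftrightarrow> jet S k x \<in> jet_cone k w"
proof -
  interpret J: coordinates "jets k" "jet_basis k" class_coeff by (rule coordinates_jet)
  show ?thesis using J.proj_image_mem[OF homog_jet_cone] assms by (simp add: carrier_jet)
qed

lemma jet_cone_iff:
  assumes "x \<in> carrier R"
  shows "jet S k x \<in> jet_cone k w \<longleftrightarrow> (\<forall>m\<in>jet_basis k - exponents_ge w. coeff x m = 0) \<and>
     (\<forall>i. \<exists>m\<in>face w i \<inter> jet_basis k. coeff x m \<noteq> 0)"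
  unfolding jet_cone_def using assms by (auto simp: carrier_jet coeff_jet)

text \<open>For such \<open>k\<close>, every exponent that the jets ignore has pairings larger than
  all entries of \<open>w\<close>. It satisfies the lower bounds strictly and thus affects neither
  part of \<open>has_val\<close>.\<close>

lemma level_set_cylinder:
  fixes w :: "int ^ 'r"
  assumes k: "\<And>i. w $ i \<le> int k"
  shows "level w = cylinder S k (jet_cell k w)"
proof -
  \<comment> \<open>Jets of order \<open>k\<close> forget \<open>deg_ge (Suc k)\<close>, so the
    pairing is at least \<open>k + 1\<close> and exceeds \<open>w $ i\<close> strictly.\<close>
  have big: "w $ i < pairing m (\<nu> i)" if "m \<in> deg_ge (Suc k)" for m i
    using deg_ge_pairing[OF that, of i] k[of i] by simp
  have 1: "m \<in> jet_basis k" if "m \<in> S" "m \<notin> exponents_ge w" for m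
  proof (rule ccontr)
    assume "m \<notin> jet_basis k"
    then have "w $ i \<le> pairing m (\<nu> i)" for i using big[of m i] that by (simp add: jet_basis_def)
    then show False using that by (simp add: exponents_ge_def)
  qed
  have 2: "m \<in> jet_basis k" if "m \<in> face w i" for m i
    using big[of m i] that by (auto simp: jet_basis_def face_def exponents_ge_def)
  have key: "has_val w x \<longleftrightarrow> jet S k x \<in> jet_cone k w" if x: "x \<in> carrier R" for x
  proof -
    have S: "coeff x m \<noteq> 0 \<Longrightarrow> m \<in> S" for m using supported_coeff[OF x] by (auto simp: supported_def)
    have "supported (exponents_ge w) (coeff x) \<longleftrightarrow> (\<forall>m\<in>jet_basis k - exponents_ge w. coeff x m = 0)"
      unfolding supported_def using 1 S by blast
    moreover have "(\<exists>m\<in>face w i. coeff x m \<noteq> 0) \<longleftrightarrow> (\<exists>m\<in>face w i \<inter> jet_basis k. coeff x m \<noteq> 0)" for i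
      using 2 by blast
    ultimately show ?thesis unfolding has_val_def jet_cone_iff[OF x] by simp
  qed
  have sub: "jet_cell k w \<subseteq> proj (jets k)" by (rule constructible_subset[OF constructible_jet_cell])
  show ?thesis
  proof (intro equalityI subsetI)
    fix L assume "L \<in> level w"
    then obtain x where x: "x \<in> carrier R" "has_val w x" "L = punctured_line R x"
      unfolding level_set_monomial by blast
    then show "L \<in> cylinder S k (jet_cell k w)"
      using cylinder_iff[OF x(1) has_val_nonzero[OF x(2)] sub] jet_cell_iff[OF x(1)] key[OF x(1)]
        by simp
  next
    fix L assume L: "L \<in> cylinder S k (jet_cell k w)"
    then obtain x where x: "x \<in> carrier R" "x \<noteq> \<zero>\<^bsub>R\<^esub>" "L = punctured_line R x"
      unfolding cylinder_def proj_def by blast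
    then show "L \<in> level w"
      using L cylinder_iff[OF x(1,2) sub] jet_cell_iff[OF x(1)] key[OF x(1)] level_set_line[OF x(1)]
        by simp
  qed
qed

text \<open>Every jet comes from a germ, so a nonempty base has a nonempty cylinder.\<close>

lemma cylinder_eq_empty:
  assumes "B \<subseteq> proj (jets k)" "cylinder S k B = {}"
  shows "B = {}"
proof (rule ccontr)
  assume "B \<noteq> {}"
  then obtain y where y: "y \<in> carrier (jets k)" "y \<noteq> \<zero>\<^bsub>jets k\<^esub>"
      "jet_line k y \<in> B"
    using assms(1) unfolding proj_def by blast
  obtain x where x: "x \<in> carrier R" "jet S k x = y" using jet_lift[OF y(1)] by blast
  then have "x \<noteq> \<zero>\<^bsub>R\<^esub>" using y(2) jet_zero by blast
  then have "punctured_line R x \<in> cylinder S k B" using cylinder_iff[OF x(1) _ assms(1)] x y by simp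
  then show False using assms(2) by simp
qed

lemma cylinder_euler_char_empty: "cylinder_euler_char S {} = 0"
  unfolding cylinder_euler_char_def
proof (rule the_equality)
  have e: "euler_char (subtopology (proj_topology (jets k)) {}) = 0" for k
    by (rule has_euler_euler_char[OF has_euler_empty]) simp
  have "cylinder S 0 {} = {}" by (simp add: cylinder_def)
  then show "\<exists>k. \<exists>B\<in>constructible (jets k). {} = cylinder S k B \<and>
      0 = euler_char (subtopology (proj_topology (jets k)) B)"
    using constructible_empty e by (intro exI[of _ 0] bexI[of _ "{}"]) auto
  fix c assume "\<exists>k. \<exists>B\<in>constructible (jets k). {} = cylinder S k B \<and>
      c = euler_char (subtopology (proj_topology (jets k)) B)"
  then obtain k B where "B \<in> constructible (jets k)" "{} = cylinder S k B"
      "c = euler_char (subtopology (proj_topology (jets k)) B)" by blast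
  moreover from this have "B = {}" using cylinder_eq_empty constructible_subset by metis
  ultimately show "c = 0" using e by simp
qed

text \<open>If a nonempty level set is a cylinder over the \<open>k\<close>-jets at all, then membership does not depend
  on the coefficients that \<open>k\<close>-jets do not see, and this determines the base of the cylinder.\<close>

lemma cylinder_base_unique:
  assumes B: "B \<subseteq> proj (jets k)" and eq: "level w = cylinder S k B"
    and x0: "x0 \<in> carrier R" "has_val w x0"
  shows "B = jet_cell k w" "\<And>m. m \<in> S \<Longrightarrow> exponent m = w \<Longrightarrow> m \<in> jet_basis k"
proof -
  have key: "has_val w x \<longleftrightarrow> jet_line k (jet S k x) \<in> B" if "x \<in> carrier R" "x \<noteq> \<zero>\<^bsub>R\<^esub>" for x
    using cylinder_iff[OF that B] level_set_line[OF that(1), of w] unfolding eq by simp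
  \<comment> \<open>A germ with zero jet would be sent to the added point, which is not in the
    base.\<close>
  have nz: "\<exists>m\<in>jet_basis k. coeff x m \<noteq> 0" if x: "x \<in> carrier R" "has_val w x" for x
  proof (rule ccontr)
    interpret J: coordinates "jets k" "jet_basis k" class_coeff by (rule coordinates_jet)
    assume "\<not> ?thesis"
    then have z: "jet S k x = \<zero>\<^bsub>jets k\<^esub>" using x jet_eq_zero_iff by blast
    have "jet_line k (jet S k x) \<in> B" using key x has_val_nonzero by blast
    then have "jet_line k \<zero>\<^bsub>jets k\<^esub> \<in> proj (jets k)" using B z by auto
    then obtain y where y: "y \<in> carrier (jets k)" "y \<noteq> \<zero>\<^bsub>jets k\<^esub>"
      "jet_line k \<zero>\<^bsub>jets k\<^esub> = jet_line k y"
      unfolding proj_def by blast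
    then obtain c where "y = c \<odot>\<^bsub>jets k\<^esub> \<zero>\<^bsub>jets k\<^esub>"
      using J.punctured_line_eq[OF J.zero_closed y(1)] by blast
    then have "y = \<zero>\<^bsub>jets k\<^esub>"
      using y J.zero_closed by (intro J.coord_inj) (auto simp: J.coord_smult J.coord_zero)
    then show False using y by simp
  qed
  show basis: "m \<in> jet_basis k" if m: "m \<in> S" "exponent m = w" for m
  proof -
    obtain x where x: "x \<in> carrier R" "coeff x = (\<lambda>n. if n = m then 1 else 0)"
      using poly_germ_exists[OF m(1)] by blast
    then have "has_val w x" using has_val_monomial m by blast
    from nz[OF x(1) this] show ?thesis unfolding x(2) by (auto split: if_splits)
  qed
  \<comment> \<open>If the jets ignored \<open>m\<close>, adding its monomial to \<open>x0\<close>
    would leave the jet unchanged, and with it membership in the level set, but would violate the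
    lower bounds.\<close>
  have zone: "m \<in> jet_basis k" if m: "m \<in> S" "m \<notin> exponents_ge w" for m
  proof (rule ccontr)
    assume mk: "m \<notin> jet_basis k"
    obtain x where x: "x \<in> carrier R" "coeff x = (\<lambda>n. if n = m then 1 else 0)"
      using poly_germ_exists[OF m(1)] by blast
    define z where "z = x0 \<oplus>\<^bsub>R\<^esub> x"
    have z: "z \<in> carrier R" "coeff z n = coeff x0 n + (if n = m then 1 else 0)" for n
      using x x0 by (simp_all add: z_def R_closed coeff_add)
    have "coeff x0 m = 0" using x0(2) m by (auto simp: has_val_def supported_def)
    then have zm: "coeff z m \<noteq> 0" using z by simp
    then have "z \<noteq> \<zero>\<^bsub>R\<^esub>" by (auto simp: coeff_zero)
    moreover have "jet S k z = jet S k x0" using z x0 mk by (subst jet_eq_iff) auto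
    ultimately have "has_val w z" using key[of z] key[of x0] z x0 has_val_nonzero by simp
    then show False using zm m by (auto simp: has_val_def supported_def)
  qed
  \<comment> \<open>Restricted to germs without hidden coefficients: the order \<open>k\<close> is
    not bounded below by \<open>w\<close> here, so a face might be met only at an exponent outside
    \<open>jet_basis k\<close>.\<close>
  have cone: "has_val w x \<longleftrightarrow> jet S k x \<in> jet_cone k w"
    if x: "x \<in> carrier R" and supp: "\<And>m. m \<notin> jet_basis k \<Longrightarrow> coeff x m = 0" for x
  proof -
    have S: "coeff x m \<noteq> 0 \<Longrightarrow> m \<in> S" for m using supported_coeff[OF x] by (auto simp: supported_def)
    have "supported (exponents_ge w) (coeff x) \<longleftrightarrow> (\<forall>m\<in>jet_basis k - exponents_ge w. coeff x m = 0)"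
      unfolding supported_def using zone S by blast
    moreover have "(\<exists>m\<in>face w i. coeff x m \<noteq> 0) \<longleftrightarrow> (\<exists>m\<in>face w i \<inter> jet_basis k. coeff x m \<noteq> 0)" for i
      using supp by blast
    ultimately show ?thesis unfolding has_val_def jet_cone_iff[OF x] by simp
  qed
  have mem: "jet_line k y \<in> B \<longleftrightarrow> y \<in> jet_cone k w"
    if y: "y \<in> carrier (jets k)" "y \<noteq> \<zero>\<^bsub>jets k\<^esub>" for y
  proof -
    obtain x where x: "x \<in> carrier R" "jet S k x = y" "\<And>m. m \<notin> jet_basis k \<Longrightarrow> coeff x m = 0"
      using jet_lift[OF y(1)] by blast
    then have "x \<noteq> \<zero>\<^bsub>R\<^esub>" using y(2) jet_zero by blast
    then show ?thesis using key[OF x(1)] cone[OF x(1,3)] x(2) by simp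
  qed
  show "B = jet_cell k w"
  proof (intro equalityI subsetI)
    fix L assume L: "L \<in> B"
    then obtain y where "y \<in> carrier (jets k)" "y \<noteq> \<zero>\<^bsub>jets k\<^esub>" "L = jet_line k y"
      using B unfolding proj_def by blast
    then show "L \<in> jet_cell k w" using mem L by blast
  next
    interpret J: coordinates "jets k" "jet_basis k" class_coeff by (rule coordinates_jet)
    fix L assume "L \<in> jet_cell k w"
    then obtain y where y: "y \<in> jet_cone k w" "L = jet_line k y" by blast
    then have "y \<in> carrier (jets k) - {\<zero>\<^bsub>jets k\<^esub>}"
      using homog_jet_cone[of k w] unfolding J.homog_def by blast
    then show "L \<in> B" using mem y by blast
  qed
qed

lemma level_set_constructible:
  obtains k where "level w = cylinder S k (jet_cell k w)"
proof -
  \<comment> \<open>Any common upper bound of the entries of \<open>w\<close> would do; the sum of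
    their positive parts is one.\<close>
  define k where "k = (\<Sum>i\<in>UNIV. nat (w $ i))"
  have "w $ i \<le> int k" for i
  proof -
    have "nat (w $ i) \<le> k" unfolding k_def by (rule member_le_sum) auto
    then show ?thesis by linarith
  qed
  then show ?thesis using that level_set_cylinder by blast
qed

text \<open>Whatever order and base are used, the base is a \<open>jet_cell\<close> and all
  exponents over \<open>w\<close> are visible in it, so the description has one value. The empty
  level set is separate, since determining the base starts from a germ in it.\<close>

lemma cylinder_euler_char_level_set:
  "cylinder_euler_char S (level w) = lattice_count w"
proof (cases "level w = {}")
  case True
  have "{m \<in> S. exponent m = w} = {}"
  proof (rule ccontr)
    assume "\<not> ?thesis"
    then obtain m where m: "m \<in> S" "exponent m = w" by blast
    obtain x where x: "x \<in> carrier R" "coeff x = (\<lambda>n. if n = m then 1 else 0)"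
      using poly_germ_exists[OF m(1)] by blast
    then have "has_val w x" using has_val_monomial m by blast
    then show False using True x(1) unfolding level_set_monomial by blast
  qed
  then have "lattice_count w = 0" unfolding lattice_count_def by (simp only: card.empty of_nat_0)
  then show ?thesis using True cylinder_euler_char_empty by simp
next
  case False
  then obtain x0 where x0: "x0 \<in> carrier R" "has_val w x0" unfolding level_set_monomial by blast
  have euler: "euler_char (subtopology (proj_topology (jets k)) B) = lattice_count w"
    if B: "B \<in> constructible (jets k)" "level w = cylinder S k B" for k B
  proof -
    note u = cylinder_base_unique[OF constructible_subset[OF B(1)] B(2) x0]
    have "{m \<in> S. exponent m = w \<and> m \<in> jet_basis k} = {m \<in> S. exponent m = w}" using u(2) by blast
    then show ?thesis unfolding u(1) euler_char_jet_cell lattice_count_def by simp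
  qed
  obtain k where k: "level w = cylinder S k (jet_cell k w)"
    by (rule level_set_constructible)
  show ?thesis
    unfolding cylinder_euler_char_def
  proof (rule the_equality)
    show "\<exists>k. \<exists>B\<in>constructible (jets k). level w = cylinder S k B \<and>
      lattice_count w = euler_char (subtopology (proj_topology (jets k)) B)"
      using k constructible_jet_cell euler[OF constructible_jet_cell k] by metis
  qed (use euler in metis)
qed

section \<open>Summing the integral\<close>

lemma t_nu_power_series:
  assumes "L \<in> proj R"
  obtains w where "t_nu \<nu> L = t_monomial w" "t_monomial w \<in> power_series"
proof -
  obtain x where x: "x \<in> carrier R" "x \<noteq> \<zero>\<^bsub>R\<^esub>"
      "L = punctured_line R x" using assms unfolding proj_def by blast
  have "0 \<le> germ_val (\<nu> i) x" for i
    unfolding le_germ_val[OF x(1,2)] supported_def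
    using supported_coeff[OF x(1)] pairing_nonneg by (auto simp: supported_def)
  then have "t_monomial (\<chi> i. germ_val (\<nu> i) x) \<in> power_series"
    unfolding power_series_def t_monomial_def by auto
  then show ?thesis using that t_nu_line[OF x(1,2)] x(3) by blast
qed

lemma level_set_not_monomial: "(\<And>w. g \<noteq> t_monomial w) \<Longrightarrow> level_set S (t_nu \<nu>) g = {}"
  unfolding level_set_def using t_nu_power_series by blast

text \<open>The only value of \<open>t_nu\<close> with a nonzero coefficient at \<open>v\<close> is
  \<open>t_monomial v\<close>, so each coefficient of the integral has at most one summand, equal to
  \<open>lattice_count v\<close>.\<close>

theorem has_euler_integral_poincare: "has_euler_integral S (t_nu \<nu>) (poincare_series S \<nu>)"
  unfolding has_euler_integral_def poincare_series_eq
proof (intro conjI allI)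
  show "cylindrical_function S (t_nu \<nu>)"
    unfolding cylindrical_function_def
  proof (intro conjI ballI impI)
    show "t_nu \<nu> ` proj R \<subseteq> power_series"
    proof
      fix g assume "g \<in> t_nu \<nu> ` proj R"
      then obtain L where "L \<in> proj R" "g = t_nu \<nu> L" by blast
      then show "g \<in> power_series" using t_nu_power_series[of L] by metis
    qed
    fix g :: "'r series"
    show "cylindrical S (level_set S (t_nu \<nu>) g)"
    proof (cases "\<exists>w. g = t_monomial w")
      case True
      then obtain w where w: "g = t_monomial w" by blast
      obtain k where "level w = cylinder S k (jet_cell k w)"
        by (rule level_set_constructible)
      then show ?thesis unfolding w cylindrical_def using constructible_jet_cell by blast
    next
      case False
      then have "level_set S (t_nu \<nu>) g = cylinder S 0 {}"
        using level_set_not_monomial[of g] by (auto simp: cylinder_def)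
      then show ?thesis unfolding cylindrical_def using constructible_empty by blast
    qed
  qed
  fix v :: "int ^ 'r"
  define G where "G = {g \<in> power_series - {\<lambda>_. 0}. cylinder_euler_char S (level_set S (t_nu \<nu>) g) *
      g v \<noteq> 0}"
  have mono: "g = t_monomial v \<and> lattice_count v \<noteq> 0" if "g \<in> G" for g
  proof -
    have nz: "cylinder_euler_char S (level_set S (t_nu \<nu>) g) \<noteq> 0"
        "g v \<noteq> 0" using that by (auto simp: G_def)
    then obtain w where w: "g = t_monomial w"
      using level_set_not_monomial[of g] cylinder_euler_char_empty by metis
    then have "w = v" using nz(2) by (auto simp: t_monomial_def split: if_splits)
    then show ?thesis using w nz(1) by (simp add: cylinder_euler_char_level_set)
  qed
  have "G = (if lattice_count v \<noteq> 0 then {t_monomial v} else {})"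
  proof (cases "lattice_count v \<noteq> 0")
    case True
    then have "{m \<in> S. exponent m = v} \<noteq> {}" unfolding lattice_count_def by (metis card.empty of_nat_0)
    then obtain m where "m \<in> S" "exponent m = v" by blast
    then have "0 \<le> v $ i" for i using pairing_nonneg[of m i] by auto
    then have "t_monomial v \<in> power_series" by (auto simp: power_series_def t_monomial_def)
    moreover have "t_monomial v v = 1" by (simp add: t_monomial_def)
    moreover from this have "t_monomial v \<noteq> (\<lambda>_. 0)" by (metis zero_neq_one)
    ultimately have "t_monomial v \<in> G"
      unfolding G_def using True by (simp add: cylinder_euler_char_level_set)
    then have "G = {t_monomial v}" using mono by blast
    then show ?thesis using True by simp
  next
    case False
    then have "G = {}" using mono by blast
    then show ?thesis using False by simp
  qed
  moreover have tv: "t_monomial v v = 1" by (simp add: t_monomial_def)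
  ultimately have "finite G \<and> lattice_count v
      = (\<Sum>g\<in>G. cylinder_euler_char S (level_set S (t_nu \<nu>) g) * g v)"
    using tv by (simp add: cylinder_euler_char_level_set)
  then show "let G = {g \<in> power_series - {\<lambda>_. 0}. cylinder_euler_char S (level_set S (t_nu \<nu>) g) * g
      v \<noteq> 0}
    in finite G \<and> lattice_count v = (\<Sum>g\<in>G. cylinder_euler_char S (level_set S (t_nu \<nu>) g) * g v)"
    unfolding Let_def G_def .
qed

end

text \<open>From an interior point one can move a little against \<open>m\<close> without leaving
  the cone. The pairing is still nonnegative there, so it was positive before the move.\<close>

lemma pairing_interior_pos:
  fixes m n :: "int ^ 'd"
  assumes "real_vec m \<in> dual_cone \<sigma>" "m \<noteq> 0" "real_vec n \<in> interior \<sigma>"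
  shows "0 < pairing m n"
proof -
  obtain e where e: "e > 0" "cball (real_vec n) e \<subseteq> \<sigma>"
    using assms(3) by (meson mem_interior_cball)
  obtain i where "m $ i \<noteq> 0" using assms(2) by (auto simp: vec_eq_iff)
  then have "real_vec m \<noteq> 0" by (auto simp: real_vec_def vec_eq_iff)
  then have nm: "norm (real_vec m) > 0" by simp
  \<comment> \<open>The step has length exactly \<open>e\<close>; it lowers the inner product with
    \<open>m\<close> by \<open>e * norm (real_vec m)\<close>, which is positive.\<close>
  define y where "y = real_vec n - (e / norm (real_vec m)) *\<^sub>R real_vec m"
  have "y \<in> cball (real_vec n) e" using e nm by (simp add: y_def dist_norm)
  then have "0 \<le> real_vec m \<bullet> y" using assms(1) e by (auto simp: dual_cone_def)
  also have "real_vec m \<bullet> y = real_vec m \<bullet> real_vec n - e * norm (real_vec m)"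
    using nm by (simp add: y_def inner_diff_right power2_eq_square flip: power2_norm_eq_inner)
  finally have "0 < real_vec m \<bullet> real_vec n" using e nm by (smt (verit) mult_pos_pos)
  also have "real_vec m \<bullet> real_vec n = real_of_int (pairing m n)"
    by (simp add: inner_vec_def real_vec_def pairing_def)
  finally show ?thesis by simp
qed

theorem proposition2:
  fixes \<sigma> :: "(real ^ 'd) set"
    and S :: "(int ^ 'd) set"
    and \<nu> :: "'r::finite \<Rightarrow> int ^ 'd"
  assumes "rational_polyhedral_cone \<sigma>"
    and "strongly_convex_cone \<sigma>"
    and "dim \<sigma> = CARD('d)"
    and "S \<subseteq> {m. real_vec m \<in> dual_cone \<sigma>}"
    and "finitely_generated_submonoid S"
    and "convex_cone hull (real_vec ` S) = dual_cone \<sigma>"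
    and "group_closure S = UNIV"
    and "inj \<nu>"
    and "\<And>i. real_vec (\<nu> i) \<in> interior \<sigma>"
  shows "has_euler_integral S (t_nu \<nu>) (poincare_series S \<nu>)"
proof -
  interpret toric S \<nu>
  proof
    show "0 < pairing m (\<nu> i)" if "m \<in> S" "m \<noteq> 0" for m i
      using pairing_interior_pos[of m \<sigma> "\<nu> i"] assms(4,9) that by blast
  qed (rule assms(5))
  show ?thesis by (rule has_euler_integral_poincare)
qed

end
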